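(* Let $g:\mathbb{N}\to\mathbb{R}$ be any function with $g(t)\to\infty$ as $t\to\infty$. Then there is a function $\varepsilon:\mathbb{N}\to[0,\infty)$ with $\varepsilon(t)\to 0$ as $t\to\infty$ such that the following holds for all integers $1\le k<t$ with $t-k\ge g(t)\log_2 t$: (i) for every positive integer $n$, every graph on $n$ vertices with no $K_t$-minor contains at most \[ n\cdot\left(\frac{C^*_t(k)}{|V(T^*_t(k))|}\right)^{1+\varepsilon(t)} \] cliques of order $k$; (ii) (sharpness) for every $n\ge 2t$ there is a graph on $n$ vertices with no $K_t$-minor containing at least $n\cdot\left(\frac{C^*_t(k)}{|V(T^*_t(k))|}\right)^{1-\varepsilon(t)}$ cliques of order $k$.
   Context: A clique of order $k$ ($k$-clique) is a set of $k$ pairwise adjacent vertices. A graph $H$ is a minor of $G$ if $H$ can be obtained from $G$ by deleting vertices and edges and contracting edges. For integers $N\ge\omega\ge1$, the Turán graph $T(N,\omega)$ is the complete $\omega$-partite graph on $N$ vertices whose parts have sizes $\lfloor N/\omega\rfloor$ or $\lceil N/\omega\rceil$. For integers $1\le k<t$, $T^*_t(k)$ denotes a Turán graph $T(2t-\omega-1,\omega)$ which has the maximum number of cliques of order $k$ among all choices of $\omega$ with $k\le\omega\le t-1$, and $C^*_t(k)$ denotes the number of cliques of order $k$ in $T^*_t(k)$.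
   Formalization: The pairs k = t−1 with t ≥ 3 are excluded: there C*_t(k)/|V(T*_t(k))| = 2/t < 1 and (i) fails for every ε ≥ 0 (e.g. g(3)=0, t=3, k=2, the path on 4 vertices). Graphs have natural numbers as vertices, which loses nothing up to isomorphism. *)

theory Defs
  imports "Graph_Theory.Graph_Theory" "HOL-Analysis.Analysis"
begin

(* A finite simple graph is a pair_graph of Graph_Theory: a finite loop-free symmetric digraph, in
   which the edge {u, v} is the pair of arcs (u, v), (v, u). *)

definition cliques :: "nat \<Rightarrow> 'a pair_pre_digraph \<Rightarrow> 'a set set" where
  "cliques k G = {S. S \<subseteq> pverts G \<and> card S = k \<and>
     (\<forall>u\<in>S. \<forall>v\<in>S. u \<noteq> v \<longrightarrow> (u, v) \<in> parcs G)}"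

definition num_cliques :: "nat \<Rightarrow> 'a pair_pre_digraph \<Rightarrow> nat" where
  "num_cliques k G = card (cliques k G)"

definition delete_vertex :: "'a pair_pre_digraph \<Rightarrow> 'a \<Rightarrow> 'a pair_pre_digraph" where
  "delete_vertex G v =
     \<lparr> pverts = pverts G - {v}, parcs = {(x, y) \<in> parcs G. x \<noteq> v \<and> y \<noteq> v} \<rparr>"

definition delete_edge :: "'a pair_pre_digraph \<Rightarrow> 'a \<Rightarrow> 'a \<Rightarrow> 'a pair_pre_digraph" where
  "delete_edge G u v = \<lparr> pverts = pverts G, parcs = parcs G - {(u, v), (v, u)} \<rparr>"

(* The merged vertex keeps the name u; loops and parallel edges are suppressed. *)
definition contract_edge :: "'a pair_pre_digraph \<Rightarrow> 'a \<Rightarrow> 'a \<Rightarrow> 'a pair_pre_digraph" where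
  "contract_edge G u v =
     (let f = (\<lambda>x. if x = v then u else x) in
      \<lparr> pverts = f ` pverts G,
        parcs = {(f x, f y) | x y. (x, y) \<in> parcs G \<and> f x \<noteq> f y} \<rparr>)"

inductive minor_step :: "'a pair_pre_digraph \<Rightarrow> 'a pair_pre_digraph \<Rightarrow> bool" where
  "v \<in> pverts G \<Longrightarrow> minor_step G (delete_vertex G v)"
| "(u, v) \<in> parcs G \<Longrightarrow> minor_step G (delete_edge G u v)"
| "(u, v) \<in> parcs G \<Longrightarrow> minor_step G (contract_edge G u v)"

(* complete_digraph t only asks for t pairwise adjacent vertices, so being isomorphic to K_t needs
   no further closure of the minor relation under isomorphism. *)
definition has_complete_minor :: "nat \<Rightarrow> 'a pair_pre_digraph \<Rightarrow> bool" where
  "has_complete_minor t G \<longleftrightarrow>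
     (\<exists>H. minor_step\<^sup>*\<^sup>* G H \<and> complete_digraph t (with_proj H))"

definition turan_graph :: "nat \<Rightarrow> nat \<Rightarrow> 'a pair_pre_digraph \<Rightarrow> bool" where
  "turan_graph N w G \<longleftrightarrow> pair_graph G \<and> card (pverts G) = N \<and>
     (\<exists>P. partition_on (pverts G) P \<and> card P = w \<and>
        (\<forall>A\<in>P. int (card A) = \<lfloor>real N / real w\<rfloor> \<or> int (card A) = \<lceil>real N / real w\<rceil>) \<and>
        parcs G = {(u, v). u \<in> pverts G \<and> v \<in> pverts G \<and> \<not> (\<exists>A\<in>P. u \<in> A \<and> v \<in> A)})"

(* T is a possible choice of T*_t(k), for 1 <= k < t. Several w may attain the maximum, so T, and
   even its number of vertices, need not be unique up to isomorphism; the number of k-cliques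
   C*_t(k) = num_cliques k T is. Vertices in nat lose nothing, the graphs being finite.
   Pitfall: for k = t - 1 >= 2 the only choice is T(t,t-1), K_t minus an edge, which has t vertices
   but only two k-cliques. The base num_cliques k T / card (pverts T) = 2/t is then below 1, and
   the upper bound n * (2/t) powr (1 + e) fails for every e >= 0 and all large n: glueing n - t + 2
   copies of K_(t-1) along a common K_(t-2) gives n vertices, no K_t-minor and n - t + 2 cliques. *)
definition turan_star :: "nat \<Rightarrow> nat \<Rightarrow> nat pair_pre_digraph \<Rightarrow> bool" where
  "turan_star t k T \<longleftrightarrow>
     (\<exists>w\<in>{k..t - 1}. turan_graph (2 * t - w - 1) w T) \<and>
     (\<forall>w\<in>{k..t - 1}. \<forall>T' :: nat pair_pre_digraph.
        turan_graph (2 * t - w - 1) w T' \<longrightarrow> num_cliques k T' \<le> num_cliques k T)"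

lemma card_residue_class:
  fixes N w r :: nat
  assumes "r < w"
  shows "card {i. i < N \<and> i mod w = r} = (if r < N mod w then N div w + 1 else N div w)"
proof -
  let ?m = "if r < N mod w then N div w + 1 else N div w"
  have lt: "q * w + r < N \<longleftrightarrow> q < ?m" for q
  proof -
    have N: "N = N div w * w + N mod w" by simp
    have mw: "N mod w < w" using assms by simp
    consider "q < N div w" | "q = N div w" | "q > N div w" by linarith
    then show ?thesis
    proof cases
      case 1
      then have "(q + 1) * w \<le> N div w * w" by (intro mult_le_mono) auto
      then have "q * w + w \<le> N div w * w" by (simp add: algebra_simps)
      then have "q * w + r < N" using assms div_times_less_eq_dividend[of N w] by linarith
      then show ?thesis using 1 by simp
    next
      case 2
      have "q * w + r < N \<longleftrightarrow> r < N mod w" using N 2 by (metis add_less_cancel_left)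
      then show ?thesis using 2 by auto
    next
      case 3
      then have "(N div w + 1) * w \<le> q * w" by (intro mult_le_mono) auto
      then have "N div w * w + w \<le> q * w" by (simp add: algebra_simps)
      then have "\<not> q * w + r < N" using N mw by linarith
      then show ?thesis using 3 by simp
    qed
  qed
  have "{i. i < N \<and> i mod w = r} = (\<lambda>q. q * w + r) ` {..<?m}"
  proof (intro equalityI subsetI)
    fix i assume i: "i \<in> {i. i < N \<and> i mod w = r}"
    then have "i = i div w * w + r" using div_mult_mod_eq[of i w] by simp
    with i lt[of "i div w"] show "i \<in> (\<lambda>q. q * w + r) ` {..<?m}" by auto
  next
    fix i assume "i \<in> (\<lambda>q. q * w + r) ` {..<?m}"
    then obtain q where "q < ?m" and i: "i = q * w + r" by auto
    with lt[of q] assms show "i \<in> {i. i < N \<and> i mod w = r}" by simp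
  qed
  moreover have "inj_on (\<lambda>q. q * w + r) {..<?m}" using assms by (auto simp: inj_on_def)
  ultimately show ?thesis by (simp add: card_image)
qed

lemma turan_graph_exists:
  assumes "1 \<le> w" "w \<le> N"
  shows "\<exists>G :: nat pair_pre_digraph. turan_graph N w G"
proof -
  define A where "A r = {i. i < N \<and> i mod w = r}" for r :: nat
  define G :: "nat pair_pre_digraph"
    where "G = \<lparr> pverts = {..<N}, parcs = {(u, v). u < N \<and> v < N \<and> u mod w \<noteq> v mod w} \<rparr>"
  let ?P = "A ` {..<w}"
  have mem: "r \<in> A r" if "r < w" for r using that assms by (auto simp: A_def)
  have inj: "inj_on A {..<w}"
  proof (rule inj_onI)
    fix r s assume "r \<in> {..<w}" "s \<in> {..<w}" "A r = A s"
    then show "r = s" using mem[of r] by (auto simp: A_def)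
  qed
  have same: "(\<exists>B\<in>?P. u \<in> B \<and> v \<in> B) \<longleftrightarrow> u < N \<and> v < N \<and> u mod w = v mod w" for u v
    using assms by (auto simp: A_def intro!: bexI[of _ "u mod w"])
  have "finite (parcs G)"
    by (rule finite_subset[of _ "{..<N} \<times> {..<N}"]) (auto simp: G_def)
  then have graph: "pair_graph G"
    by unfold_locales (auto simp: G_def symmetric_def sym_def)
  have part: "partition_on (pverts G) ?P"
  proof (rule partition_onI)
    show "\<Union> ?P = pverts G" using assms by (auto simp: A_def G_def)
    show "{} \<notin> ?P" using mem by auto
    show "disjnt p p'" if "p \<in> ?P" "p' \<in> ?P" "p \<noteq> p'" for p p'
      using that by (auto simp: A_def disjnt_def)
  qed
  have sizes: "int (card B) = \<lfloor>real N / real w\<rfloor> \<or> int (card B) = \<lceil>real N / real w\<rceil>"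
    if "B \<in> ?P" for B
  proof -
    obtain r where r: "r < w" and B: "B = A r" using \<open>B \<in> ?P\<close> by auto
    have fl: "\<lfloor>real N / real w\<rfloor> = int (N div w)" by (simp add: floor_divide_of_nat_eq)
    have cl: "\<lceil>real N / real w\<rceil> = int (N div w) + 1" if "r < N mod w"
    proof -
      have "\<not> w dvd N" using that by (auto simp: dvd_eq_mod_eq_0)
      have "real N / real w \<noteq> of_int \<lfloor>real N / real w\<rfloor>"
      proof
        assume "real N / real w = of_int \<lfloor>real N / real w\<rfloor>"
        then have "real N = real (N div w) * real w"
          using assms unfolding fl by (simp add: field_simps)
        then have "N = N div w * w" by (metis of_nat_eq_iff of_nat_mult)
        with \<open>\<not> w dvd N\<close> show False by (metis dvd_triv_right)
      qed
      then show ?thesis using fl by (simp add: ceiling_altdef)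
    qed
    show ?thesis using card_residue_class[OF r, of N] fl cl unfolding B A_def by (auto split: if_splits)
  qed
  have arcs: "parcs G = {(u, v). u \<in> pverts G \<and> v \<in> pverts G \<and> \<not> (\<exists>B\<in>?P. u \<in> B \<and> v \<in> B)}"
    unfolding same by (auto simp: G_def)
  have "card ?P = w" using inj by (simp add: card_image)
  moreover have "card (pverts G) = N" by (simp add: G_def)
  ultimately have "turan_graph N w G"
    unfolding turan_graph_def using graph part sizes arcs by blast
  then show ?thesis ..
qed

lemma num_cliques_le:
  assumes "finite (pverts G)"
  shows "num_cliques k G \<le> 2 ^ card (pverts G)"
proof -
  have "num_cliques k G \<le> card (Pow (pverts G))" unfolding num_cliques_def
    by (rule card_mono) (use assms in \<open>auto simp: cliques_def\<close>)
  then show ?thesis using assms by (simp add: card_Pow)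
qed

lemma turan_star_exists:
  assumes "1 \<le> k" "k < t"
  shows "\<exists>T. turan_star t k T"
proof -
  define Q where "Q T \<longleftrightarrow> (\<exists>w\<in>{k..t - 1}. turan_graph (2 * t - w - 1) w T)"
    for T :: "nat pair_pre_digraph"
  obtain T0 :: "nat pair_pre_digraph" where "turan_graph (2 * t - k - 1) k T0"
    using assms turan_graph_exists[of k "2 * t - k - 1"] by fastforce
  moreover have "k \<in> {k..t - 1}" using assms by simp
  ultimately have "\<exists>T. Q T" unfolding Q_def by blast
  moreover have "num_cliques k T < 2 ^ (2 * t) + 1" if "Q T" for T
  proof -
    obtain w where T: "turan_graph (2 * t - w - 1) w T" using \<open>Q T\<close> by (auto simp: Q_def)
    then have "finite (pverts T)"
      by (auto simp: turan_graph_def intro: pair_fin_digraph.pair_finite_verts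
          dest!: pair_graph.axioms(1) pair_digraph.axioms(1))
    from num_cliques_le[OF this, of k] T
    have "num_cliques k T \<le> 2 ^ (2 * t - w - 1)" by (simp add: turan_graph_def)
    also have "\<dots> \<le> 2 ^ (2 * t)" by (intro power_increasing) auto
    finally show ?thesis by simp
  qed
  ultimately obtain T where "Q T" "\<forall>T'. Q T' \<longrightarrow> num_cliques k T' \<le> num_cliques k T"
    using ex_has_greatest_nat[of Q _ "num_cliques k" "2 ^ (2 * t) + 1"] by (metis less_imp_le)
  then have "turan_star t k T" unfolding turan_star_def Q_def by blast
  then show ?thesis ..
qed

end

theory Submission
  imports Defs "HOL-Computational_Algebra.Polynomial" "HOL-Real_Asymp.Real_Asymp"
begin

text \<open>
  Mader's argument shows that a graph without \<open>K\<^sub>t\<close>-minor has a vertex of degree \<open>O(t log t)\<close> in every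
  subgraph, so it suffices to count the \<open>(k - 1)\<close>-cliques inside a vertex set of that size. Put
  \<open>x = |W| - j\<close> for the \<open>j\<close>-cliques in \<open>W\<close>; as long as some vertex has at least \<open>\<delta>x\<close> non-neighbours in \<open>W\<close>,
  branch on whether the clique contains it, which multiplies \<open>x\<close> by at most \<open>1 - \<delta>\<close> if it does. Hence
  \<open>O(log t / \<delta>)\<close> vertices are chosen before \<open>W\<close> is almost complete.

  In an almost complete \<open>W\<close> with a largest clique \<open>K\<close> of size \<open>\<omega>\<close>, small connected subsets of \<open>W - K\<close>
  dominate \<open>W\<close>, and together with the vertices of \<open>K\<close> they form a clique minor. If \<open>k\<close> is near \<open>t\<close>,
  branch sets of size \<open>o(log t)\<close> bound \<open>|W - K|\<close>, and a \<open>j\<close>-clique is given by its trace on \<open>W - K\<close>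
  and at most \<open>\<omega> choose j\<close> completions. In the middle range, branch sets of size two give
  \<open>|W| \<le> 2t - \<omega> + o(t)\<close>, and Zykov's theorem compares \<open>W\<close> with \<open>T(2t - \<omega> - 1, \<omega>)\<close>. For small \<open>k\<close>
  the degeneracy bound alone suffices. Sharpness: \<open>T(2t - \<omega> - 1, \<omega>)\<close> has no \<open>K\<^sub>t\<close>-minor, since at most
  \<open>\<omega>\<close> branch sets are singletons, and neither have disjoint copies of it.
\<close>

section \<open>Branch sets of complete minors\<close>

text \<open>Let B be the number of k-cliques per vertex of the extremal Turan graph. Only log B
  matters, so each lossy step may cost a factor exp(o(log B)); what is affordable depends on k,
  which forces three ranges, cut where k or t - k equals t^0.95. For small k, log(t/k) has order log
  t and hides the polylogarithmic excess of the degeneracy over t. In the middle that excess would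
  be fatal, but log B is at least of order t^0.95 and pays for about t^0.8 log t chosen vertices and
  t^0.85 surplus vertices. For small t - k, log B is at least about (t - k) log(t/(t - k)). There
  O(log t) chosen vertices, each costing a factor polynomial in t, are affordable because t - k
  exceeds every constant multiple of log t: this is where g enters. It also forces a constant
  \<delta>, so pairs no longer dominate and larger branch sets are needed. Two further points shape
  the exponent. B has to exceed 1, which fails for k = 1 and for k = t - 1. Packing disjoint copies
  into n vertices loses up to a factor 2, so B^\<epsilon> must be at least 2 as well.\<close>

definition simple_graph :: "'a set \<Rightarrow> 'a rel \<Rightarrow> bool" where
  "simple_graph V E \<longleftrightarrow> finite V \<and> E \<subseteq> V \<times> V \<and> sym E \<and> irrefl E"

text \<open>Connectedness is phrased by cuts: these pull back along a contraction without any walks.\<close>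
definition linked :: "'a rel \<Rightarrow> 'a set \<Rightarrow> bool" where
  "linked E S \<longleftrightarrow> S \<noteq> {} \<and> (\<forall>A. A \<subseteq> S \<and> A \<noteq> {} \<and> A \<noteq> S \<longrightarrow> (\<exists>a\<in>A. \<exists>b\<in>S - A. (a, b) \<in> E))"

text \<open>A set of branch sets instead of an indexed family: linked sets are nonempty and distinct
  members are disjoint, so \<open>card F\<close> is the order of the complete minor.\<close>

definition complete_model :: "'a rel \<Rightarrow> 'a set \<Rightarrow> 'a set set \<Rightarrow> bool" where
  "complete_model E U F \<longleftrightarrow> (\<forall>B\<in>F. B \<subseteq> U \<and> linked E B) \<and>
     (\<forall>B\<in>F. \<forall>C\<in>F. B \<noteq> C \<longrightarrow> B \<inter> C = {} \<and> (\<exists>b\<in>B. \<exists>c\<in>C. (b, c) \<in> E))"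

text \<open>The relation stays that of the ambient graph while \<open>U\<close> shrinks, so heredity
  is plain monotonicity in \<open>U\<close>.\<close>

definition minor_free :: "nat \<Rightarrow> 'a rel \<Rightarrow> 'a set \<Rightarrow> bool" where
  "minor_free t E U \<longleftrightarrow> \<not> (\<exists>F. complete_model E U F \<and> card F = t)"

lemma pair_graph_iff: "pair_graph G \<longleftrightarrow> simple_graph (pverts G) (parcs G)"
proof
  assume "pair_graph G"
  then interpret pair_graph G .
  show "simple_graph (pverts G) (parcs G)"
    unfolding simple_graph_def
  proof (intro conjI)
    show "sym (parcs G)" using pair_sym_arcs by (simp add: symmetric_def)
    show "irrefl (parcs G)" using pair_no_loops by (fastforce simp: irrefl_def)
  qed (use pair_finite_verts wellformed' in auto)
next
  assume a: "simple_graph (pverts G) (parcs G)"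
  then have "finite (parcs G)"
    by (auto simp: simple_graph_def intro: finite_subset[of _ "pverts G \<times> pverts G"])
  with a show "pair_graph G"
    by unfold_locales (auto simp: simple_graph_def symmetric_def irrefl_def)
qed

lemma simple_graphD:
  assumes "simple_graph V E"
  shows "finite V" "E \<subseteq> V \<times> V" "sym E" "irrefl E" "finite E"
    "\<And>x y. (x, y) \<in> E \<Longrightarrow> x \<in> V" "\<And>x y. (x, y) \<in> E \<Longrightarrow> y \<in> V"
    "\<And>x y. (x, y) \<in> E \<Longrightarrow> (y, x) \<in> E" "\<And>x. (x, x) \<notin> E"
  using assms finite_subset[of E "V \<times> V"]
  by (auto simp: simple_graph_def irrefl_def sym_def)

lemma linked_singleton: "linked E {x}"
  by (auto simp: linked_def)

lemma linkedD:
  assumes "linked E S" "A \<subseteq> S" "A \<noteq> {}" "A \<noteq> S"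
  obtains a b where "a \<in> A" "b \<in> S" "b \<notin> A" "(a, b) \<in> E"
  using assms unfolding linked_def by blast

lemma linked_subrel: "linked E S \<Longrightarrow> E \<subseteq> E' \<Longrightarrow> linked E' S"
  unfolding linked_def by blast

text \<open>A cut of the union either cuts one of the two sets properly, or equals one of them; in
  the latter case the sets are disjoint and the connecting edge crosses the cut.\<close>

lemma linked_Un:
  assumes "linked E S" "linked E T" "sym E" "S \<inter> T \<noteq> {} \<or> (\<exists>s\<in>S. \<exists>t\<in>T. (s, t) \<in> E)"
  shows "linked E (S \<union> T)"
  unfolding linked_def
proof (intro conjI allI impI)
  show "S \<union> T \<noteq> {}" using assms by (auto simp: linked_def)
  fix A assume A: "A \<subseteq> S \<union> T \<and> A \<noteq> {} \<and> A \<noteq> S \<union> T"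
  show "\<exists>a\<in>A. \<exists>b\<in>S \<union> T - A. (a, b) \<in> E"
  proof (cases "(A \<inter> S \<noteq> {} \<and> A \<inter> S \<noteq> S) \<or> (A \<inter> T \<noteq> {} \<and> A \<inter> T \<noteq> T)")
    case True
    then show ?thesis
    proof
      assume h: "A \<inter> S \<noteq> {} \<and> A \<inter> S \<noteq> S"
      obtain a b where "a \<in> A \<inter> S" "b \<in> S" "b \<notin> A \<inter> S" "(a, b) \<in> E"
        using linkedD[OF assms(1), of "A \<inter> S"] h by blast
      then show ?thesis by blast
    next
      assume h: "A \<inter> T \<noteq> {} \<and> A \<inter> T \<noteq> T"
      obtain a b where "a \<in> A \<inter> T" "b \<in> T" "b \<notin> A \<inter> T" "(a, b) \<in> E"
        using linkedD[OF assms(2), of "A \<inter> T"] h by blast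
      then show ?thesis by blast
    qed
  next
    case False
    then consider "S \<subseteq> A" "A \<inter> T = {}" | "T \<subseteq> A" "A \<inter> S = {}" using A by blast
    then show ?thesis
    proof cases
      case 1
      then have "S \<inter> T = {}" "A = S" using A by auto
      then show ?thesis using 1 assms(4) by blast
    next
      case 2
      then have "S \<inter> T = {}" "A = T" using A by auto
      then obtain s t where "s \<in> S" "t \<in> A" "(s, t) \<in> E" using assms(4) by blast
      moreover from this have "(t, s) \<in> E" using assms(3) by (auto dest: symD)
      moreover have "s \<in> S \<union> T - A" using 2(2) \<open>s \<in> S\<close> by blast
      ultimately show ?thesis by (intro bexI[of _ t] bexI[of _ s])
    qed
  qed
qed

lemma complete_model_mono: "complete_model E U F \<Longrightarrow> U \<subseteq> U' \<Longrightarrow> F' \<subseteq> F \<Longrightarrow> complete_model E U' F'"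
  unfolding complete_model_def by (meson order_trans subsetD)

lemma complete_model_image:
  assumes "\<And>B. B \<in> F \<Longrightarrow> l B \<subseteq> U \<and> linked E (l B)"
    "\<And>B C. B \<in> F \<Longrightarrow> C \<in> F \<Longrightarrow> B \<noteq> C \<Longrightarrow> l B \<inter> l C = {} \<and> (\<exists>b\<in>l B. \<exists>c\<in>l C. (b, c) \<in> E)"
  shows "complete_model E U (l ` F)"
  unfolding complete_model_def
proof (intro conjI ballI impI)
  fix B C assume "B \<in> l ` F" "C \<in> l ` F" "B \<noteq> C"
  then obtain B' C' where BC: "B = l B'" "C = l C'" "B' \<in> F" "C' \<in> F" "B' \<noteq> C'" by blast
  show "B \<inter> C = {}" "\<exists>b\<in>B. \<exists>c\<in>C. (b, c) \<in> E" using assms(2)[OF BC(3-5)] BC(1,2) by simp_all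
qed (use assms(1) in auto)

lemma minor_free_subset: "minor_free t E U' \<Longrightarrow> U \<subseteq> U' \<Longrightarrow> minor_free t E U"
  unfolding minor_free_def using complete_model_mono by blast

lemma minor_free_card_less:
  assumes "minor_free t E U" "complete_model E U F" "finite U"
  shows "card F < t"
proof (rule ccontr)
  assume "\<not> card F < t"
  then obtain F' where "F' \<subseteq> F" "card F' = t" by (meson ex_card not_less)
  with assms complete_model_mono[OF assms(2) subset_refl] show False unfolding minor_free_def by blast
qed

section \<open>Equivalence of minor steps and branch sets\<close>

lemma simple_graph_minor_step:
  assumes "minor_step G H" "simple_graph (pverts G) (parcs G)"
  shows "simple_graph (pverts H) (parcs H)"
  using assms
proof cases
  case (1 v)
  then show ?thesis using assms(2)
    by (auto simp: delete_vertex_def simple_graph_def sym_def irrefl_def)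
next
  case (2 u v)
  then show ?thesis using assms(2)
    by (auto simp: delete_edge_def simple_graph_def sym_def irrefl_def)
next
  case (3 u v)
  note G = simple_graphD[OF assms(2)]
  define f where "f x = (if x = v then u else x)" for x
  have H: "pverts H = f ` pverts G" "parcs H = {(f x, f y) |x y. (x, y) \<in> parcs G \<and> f x \<noteq> f y}"
    unfolding 3 contract_edge_def Let_def f_def by simp_all
  have "sym (parcs H)"
  proof (rule symI)
    fix a b assume "(a, b) \<in> parcs H"
    then obtain x y where "a = f x" "b = f y" "(x, y) \<in> parcs G" "f x \<noteq> f y" unfolding H by blast
    then show "(b, a) \<in> parcs H" unfolding H using G(8)[of x y] by force
  qed
  moreover have "irrefl (parcs H)" by (auto simp: irrefl_def H)
  moreover have "parcs H \<subseteq> pverts H \<times> pverts H" unfolding H using G(6,7) by blast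
  ultimately show ?thesis using G(1) by (simp add: simple_graph_def H(1))
qed

text \<open>Branch sets are pulled back along the contraction, so the one containing
  \<open>u\<close> regains \<open>v\<close>. Removing \<open>v\<close> again recovers the old set,
  hence their number is unchanged.\<close>

lemma lift_model_contract:
  assumes G: "simple_graph (pverts G) (parcs G)" and uv: "(u, v) \<in> parcs G"
    and F: "complete_model (parcs (contract_edge G u v)) (pverts (contract_edge G u v)) F"
  shows "\<exists>F'. complete_model (parcs G) (pverts G) F' \<and> card F' = card F"
proof -
  note GD = simple_graphD[OF G]
  define f where "f x = (if x = v then u else x)" for x
  define l where "l B = (if u \<in> B then insert v B else B)" for B
  let ?E = "parcs (contract_edge G u v)"
  have V: "pverts (contract_edge G u v) = pverts G - {v}"
    using GD(6,7,9) uv by (auto simp: contract_edge_def Let_def)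
  have E: "(x, y) \<in> ?E \<Longrightarrow> \<exists>x' y'. f x' = x \<and> f y' = y \<and> (x', y') \<in> parcs G" for x y
    unfolding contract_edge_def Let_def pair_pre_digraph.simps f_def by blast
  have nv: "v \<notin> B" "B \<subseteq> pverts G" "linked ?E B" if "B \<in> F" for B
    using F that unfolding complete_model_def V by auto
  have lf: "x \<in> l B \<longleftrightarrow> f x \<in> B" if "B \<in> F" for x B
    using nv[OF that] by (auto simp: l_def f_def)
  have "linked (parcs G) (l B)" if B: "B \<in> F" for B
    unfolding linked_def
  proof (intro conjI allI impI)
    show "l B \<noteq> {}" using nv[OF B] by (auto simp: l_def linked_def)
    fix A assume A: "A \<subseteq> l B \<and> A \<noteq> {} \<and> A \<noteq> l B"
    show "\<exists>a\<in>A. \<exists>b\<in>l B - A. (a, b) \<in> parcs G"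
    \<comment> \<open>Either the cut separates \<open>u\<close> from \<open>v\<close> and the
      contracted edge crosses it, or it is a union of fibres and comes from a cut in the contracted
      graph.\<close>
    proof (cases "u \<in> B \<and> (u \<in> A \<longleftrightarrow> v \<notin> A)")
      case True
      then have "u \<in> l B" "v \<in> l B" by (auto simp: l_def)
      then show ?thesis using True uv GD(8)[OF uv] by blast
    next
      case False
      have sub: "A - {v} \<subseteq> B" using A by (auto simp: l_def split: if_splits)
      have ne: "A - {v} \<noteq> {}" using A False nv(1)[OF B] by (auto simp: l_def split: if_splits)
      have ne2: "A - {v} \<noteq> B" using A False nv(1)[OF B] by (auto simp: l_def split: if_splits)
      obtain a b where ab: "a \<in> A - {v}" "b \<in> B" "b \<notin> A - {v}" "(a, b) \<in> ?E"
        using linkedD[OF nv(3)[OF B] sub ne ne2] .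
      obtain a' b' where e: "f a' = a" "f b' = b" "(a', b') \<in> parcs G" using E[OF ab(4)] by blast
      have "a' \<in> A" using e(1) ab(1) False sub A lf[OF B, of v] by (auto simp: f_def split: if_splits)
      moreover have "b' \<in> l B" using e(2) ab(2) lf[OF B] by auto
      moreover have "b' \<notin> A" using e(2) ab(2,3) nv(1)[OF B] False
        by (auto simp: f_def split: if_splits)
      ultimately show ?thesis using e(3) by blast
    qed
  qed
  moreover have "l B \<inter> l C = {} \<and> (\<exists>b\<in>l B. \<exists>c\<in>l C. (b, c) \<in> parcs G)"
    if B: "B \<in> F" and C: "C \<in> F" and ne: "B \<noteq> C" for B C
  proof -
    have d: "B \<inter> C = {}" "\<exists>b\<in>B. \<exists>c\<in>C. (b, c) \<in> ?E"
      using F B C ne unfolding complete_model_def by blast+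
    then obtain b c where "b \<in> B" "c \<in> C" "(b, c) \<in> ?E" by blast
    with E[OF this(3)] lf[OF B] lf[OF C] have "\<exists>b\<in>l B. \<exists>c\<in>l C. (b, c) \<in> parcs G" by metis
    then show ?thesis using d lf[OF B] lf[OF C] by blast
  qed
  moreover have "l B \<subseteq> pverts G" if "B \<in> F" for B
    using nv[OF that] GD(7)[OF uv] by (auto simp: l_def)
  ultimately have "complete_model (parcs G) (pverts G) (l ` F)"
    by (intro complete_model_image) auto
  moreover have "inj_on l F"
  proof (rule inj_onI)
    fix B C assume "B \<in> F" "C \<in> F" "l B = l C"
    moreover have "B = l B - {v}" if "B \<in> F" for B using nv(1)[OF that] by (auto simp: l_def)
    ultimately show "B = C" by metis
  qed
  ultimately show ?thesis by (metis card_image)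
qed

lemma has_complete_minor_imp_model:
  assumes "minor_step\<^sup>*\<^sup>* G H" "simple_graph (pverts G) (parcs G)"
    "\<exists>F. complete_model (parcs H) (pverts H) F \<and> card F = t"
  shows "\<exists>F. complete_model (parcs G) (pverts G) F \<and> card F = t"
  using assms
proof (induction rule: converse_rtranclp_induct)
  case (step G G')
  have "\<exists>F. complete_model (parcs G') (pverts G') F \<and> card F = t"
    using step simple_graph_minor_step by blast
  then obtain F where F: "complete_model (parcs G') (pverts G') F" "card F = t" by blast
  show ?case
  \<comment> \<open>Both kinds of deletion yield a subgraph, and a model in a subgraph is a model in
    the graph; any other step is a contraction.\<close>
  proof (cases "parcs G' \<subseteq> parcs G \<and> pverts G' \<subseteq> pverts G")
    case True
    then have "complete_model (parcs G) (pverts G) F" using F(1) linked_subrel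
      unfolding complete_model_def by (meson subset_iff)
    then show ?thesis using F(2) by blast
  next
    case False
    with step(1) obtain u v where "(u, v) \<in> parcs G" "G' = contract_edge G u v"
      by cases (auto simp: delete_vertex_def delete_edge_def)
    then show ?thesis using lift_model_contract[OF step(4)] F by metis
  qed
qed

text \<open>Induction on the number of vertices: an uncovered vertex is deleted, and otherwise an
  edge inside a branch set with more than one vertex is contracted. When neither exists, the branch
  sets are exactly the singletons and the graph is complete of order \<open>t\<close>.\<close>

lemma model_imp_has_complete_minor:
  assumes "simple_graph (pverts G) (parcs G)" "complete_model (parcs G) (pverts G) F" "card F = t"
  shows "has_complete_minor t G"
  using assms
proof (induction "card (pverts G)" arbitrary: G F rule: less_induct)
  case less
  note GD = simple_graphD[OF less.prems(1)]
  have Fv: "B \<subseteq> pverts G" "linked (parcs G) B" if "B \<in> F" for B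
    using less.prems(2) that unfolding complete_model_def by auto
  have dis: "B \<inter> C = {}" "\<exists>b\<in>B. \<exists>c\<in>C. (b, c) \<in> parcs G" if "B \<in> F" "C \<in> F" "B \<noteq> C" for B C
    using less.prems(2) that unfolding complete_model_def by auto
  have step: "has_complete_minor t G"
    if "minor_step G G'" "card (pverts G') < card (pverts G)"
      "complete_model (parcs G') (pverts G') F'" "card F' = t" for G' F'
    using less.hyps[OF that(2) simple_graph_minor_step[OF that(1) less.prems(1)] that(3,4)] that(1)
    unfolding has_complete_minor_def by (meson converse_rtranclp_into_rtranclp)
  show ?case
  proof (cases "pverts G \<subseteq> \<Union>F")
    case False
    then obtain v where v: "v \<in> pverts G" "v \<notin> \<Union>F" by blast
    let ?H = "delete_vertex G v"
    have l: "linked (parcs ?H) B" if BF: "B \<in> F" for B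
      unfolding linked_def
    proof (intro conjI allI impI)
      show "B \<noteq> {}" using Fv[OF BF] by (auto simp: linked_def)
      fix A assume A: "A \<subseteq> B \<and> A \<noteq> {} \<and> A \<noteq> B"
      obtain a b where "a \<in> A" "b \<in> B" "b \<notin> A" "(a, b) \<in> parcs G"
        using linkedD[OF Fv(2)[OF BF]] A by blast
      then show "\<exists>a\<in>A. \<exists>b\<in>B - A. (a, b) \<in> parcs ?H"
        using v BF A by (auto simp: delete_vertex_def)
    qed
    have "complete_model (parcs ?H) (pverts ?H) F"
      unfolding complete_model_def
    proof (intro conjI ballI impI)
      fix B assume "B \<in> F"
      then show "B \<subseteq> pverts ?H" using Fv v by (auto simp: delete_vertex_def)
    next
      fix B C assume h: "B \<in> F" "C \<in> F" "B \<noteq> C"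
      obtain b c where "b \<in> B" "c \<in> C" "(b, c) \<in> parcs G" using dis[OF h] by blast
      then show "\<exists>b\<in>B. \<exists>c\<in>C. (b, c) \<in> parcs ?H" using h v by (auto simp: delete_vertex_def)
    qed (use l dis in auto)
    moreover have "card (pverts ?H) < card (pverts G)"
      using card_Diff1_less[OF GD(1) v(1)] by (simp add: delete_vertex_def)
    ultimately show ?thesis using step minor_step.intros(1)[OF v(1)] less.prems(3) by blast
  next
    case cover: True
    show ?thesis
    proof (cases "\<exists>B\<in>F. \<exists>u\<in>B. B \<noteq> {u}")
      case True
      then obtain B u where B: "B \<in> F" "u \<in> B" "B \<noteq> {u}" by blast
      obtain v where v: "v \<in> B" "v \<noteq> u" "(u, v) \<in> parcs G"
        using linkedD[of "parcs G" B "{u}"] Fv(2)[OF B(1)] B(2,3) by blast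
      let ?H = "contract_edge G u v"
      define f where "f x = (if x = v then u else x)" for x
      define s where "s C = C - {v}" for C
      have VH: "pverts ?H = pverts G - {v}"
        using GD(6,7,9) v by (auto simp: contract_edge_def Let_def)
      have EH: "(f x, f y) \<in> parcs ?H" if "(x, y) \<in> parcs G" "f x \<noteq> f y" for x y
        using that unfolding contract_edge_def Let_def f_def pair_pre_digraph.simps by blast
      have vB: "v \<notin> C" if "C \<in> F" "C \<noteq> B" for C using dis(1)[OF that(1) B(1) that(2)] v(1) by auto
      have fs: "f x \<in> s C" if "x \<in> C" "C \<in> F" for x C
        using that vB B v by (auto simp: f_def s_def)
      have "linked (parcs ?H) (s C)" if C: "C \<in> F" for C
        unfolding linked_def
      proof (intro conjI allI impI)
        show "s C \<noteq> {}" using fs[OF _ C] Fv[OF C] by (auto simp: linked_def)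
        fix A assume A: "A \<subseteq> s C \<and> A \<noteq> {} \<and> A \<noteq> s C"
        define A' where "A' = {x\<in>C. f x \<in> A}"
        have "A \<subseteq> A'" using A by (auto simp: A'_def s_def f_def)
        moreover obtain y where y: "y \<in> s C" "y \<notin> A" using A by blast
        then have "y \<notin> A'" "y \<in> C" by (auto simp: A'_def f_def s_def)
        ultimately have "A' \<subseteq> C" "A' \<noteq> {}" "A' \<noteq> C" using A by (auto simp: A'_def)
        then obtain a b where ab: "a \<in> A'" "b \<in> C" "b \<notin> A'" "(a, b) \<in> parcs G"
          using linkedD[OF Fv(2)[OF C]] by blast
        have "f a \<in> A" "f b \<in> s C - A" using ab fs[OF _ C] by (auto simp: A'_def)
        moreover from this have "f a \<noteq> f b" by auto
        ultimately show "\<exists>a\<in>A. \<exists>b\<in>s C - A. (a, b) \<in> parcs ?H" using EH[OF ab(4)] by blast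
      qed
      moreover have "s C \<inter> s D = {} \<and> (\<exists>b\<in>s C. \<exists>c\<in>s D. (b, c) \<in> parcs ?H)"
        if h: "C \<in> F" "D \<in> F" "C \<noteq> D" for C D
      proof -
        obtain c d where cd: "c \<in> C" "d \<in> D" "(c, d) \<in> parcs G" using dis(2)[OF h] by blast
        have disj: "s C \<inter> s D = {}" using dis(1)[OF h] by (auto simp: s_def)
        then have "f c \<noteq> f d" using fs[OF cd(1) h(1)] fs[OF cd(2) h(2)] by auto
        then show ?thesis using disj EH[OF cd(3)] fs[OF cd(1) h(1)] fs[OF cd(2) h(2)] by blast
      qed
      moreover have "s C \<subseteq> pverts ?H" if "C \<in> F" for C
        using Fv(1)[OF that] VH by (auto simp: s_def)
      ultimately have "complete_model (parcs ?H) (pverts ?H) (s ` F)"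
        by (intro complete_model_image) auto
      moreover have "inj_on s F"
      proof (rule inj_onI, rule ccontr)
        fix C D assume h: "C \<in> F" "D \<in> F" "s C = s D" "C \<noteq> D"
        obtain x where "x \<in> C" using Fv[OF h(1)] by (auto simp: linked_def)
        then have "f x \<in> s C" "f x \<in> s D" using fs h by auto
        then show False using dis(1)[OF h(1,2,4)] by (auto simp: s_def)
      qed
      moreover have "card (pverts ?H) < card (pverts G)"
        using Fv(1)[OF B(1)] v(1) GD(1) unfolding VH by (intro psubset_card_mono) auto
      ultimately show ?thesis
        using step[OF minor_step.intros(3)[OF v(3)]] less.prems(3) by (simp add: card_image)
    next
      case False
      then have sing: "B = {u}" if "B \<in> F" "u \<in> B" for B u using that by blast
      have F: "F = (\<lambda>u. {u}) ` pverts G"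
      proof
        show "F \<subseteq> (\<lambda>u. {u}) ` pverts G"
        proof
          fix B assume B: "B \<in> F"
          then obtain u where "u \<in> B" using Fv(2) by (force simp: linked_def)
          with sing[OF B this] Fv(1)[OF B] show "B \<in> (\<lambda>u. {u}) ` pverts G" by blast
        qed
        show "(\<lambda>u. {u}) ` pverts G \<subseteq> F" using cover sing by fastforce
      qed
      have "card (pverts G) = t" using less.prems(3) unfolding F by (simp add: card_image)
      moreover have "(x, y) \<in> parcs G" if "x \<in> pverts G" "y \<in> pverts G" "x \<noteq> y" for x y
        using dis(2)[of "{x}" "{y}"] that F by auto
      then have "parcs G = {(u, v). (u, v) \<in> pverts G \<times> pverts G \<and> u \<noteq> v}"
        using GD(2,9) by auto
      ultimately have "complete_digraph t (with_proj G)"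
        unfolding complete_digraph_pair_def using GD(1) by blast
      then show ?thesis unfolding has_complete_minor_def by blast
    qed
  qed
qed

lemma has_complete_minor_iff:
  assumes "pair_graph G"
  shows "has_complete_minor t G \<longleftrightarrow> \<not> minor_free t (parcs G) (pverts G)"
proof
  assume "has_complete_minor t G"
  then obtain H where H: "minor_step\<^sup>*\<^sup>* G H" "complete_digraph t (with_proj H)"
    unfolding has_complete_minor_def by blast
  from H(2) have "complete_model (parcs H) (pverts H) ((\<lambda>u. {u}) ` pverts H)"
    unfolding complete_digraph_pair_def complete_model_def by (auto simp: linked_singleton)
  moreover have "card ((\<lambda>u. {u}) ` pverts H) = t"
    using H(2) unfolding complete_digraph_pair_def by (simp add: card_image)
  ultimately show "\<not> minor_free t (parcs G) (pverts G)"
    using has_complete_minor_imp_model[OF H(1)] assms unfolding pair_graph_iff minor_free_def by blast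
next
  assume "\<not> minor_free t (parcs G) (pverts G)"
  then show "has_complete_minor t G"
    using model_imp_has_complete_minor assms unfolding pair_graph_iff minor_free_def by blast
qed

section \<open>Counting cliques\<close>

definition is_clique :: "'a rel \<Rightarrow> 'a set \<Rightarrow> bool" where
  "is_clique E S \<longleftrightarrow> (\<forall>u\<in>S. \<forall>v\<in>S. u \<noteq> v \<longrightarrow> (u, v) \<in> E)"

definition cliques_in :: "'a rel \<Rightarrow> 'a set \<Rightarrow> nat \<Rightarrow> 'a set set" where
  "cliques_in E U k = {S. S \<subseteq> U \<and> card S = k \<and> is_clique E S}"

definition clique_count :: "'a rel \<Rightarrow> 'a set \<Rightarrow> nat \<Rightarrow> nat" where
  "clique_count E U k = card (cliques_in E U k)"

lemma num_cliques_eq: "num_cliques k G = clique_count (parcs G) (pverts G) k"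
  by (simp add: num_cliques_def cliques_def clique_count_def cliques_in_def is_clique_def)

lemma is_clique_subset: "is_clique E S \<Longrightarrow> T \<subseteq> S \<Longrightarrow> is_clique E T"
  by (auto simp: is_clique_def)

lemma finite_cliques_in [simp]: "finite U \<Longrightarrow> finite (cliques_in E U k)"
  by (rule finite_subset[of _ "Pow U"]) (auto simp: cliques_in_def)

lemma clique_count_mono: "finite U' \<Longrightarrow> U \<subseteq> U' \<Longrightarrow> clique_count E U k \<le> clique_count E U' k"
  unfolding clique_count_def by (rule card_mono) (auto simp: cliques_in_def)

lemma clique_count_0 [simp]: "finite U \<Longrightarrow> clique_count E U 0 = 1"
proof -
  assume "finite U"
  then have "cliques_in E U 0 = {{}}"
    by (auto simp: cliques_in_def is_clique_def dest: finite_subset)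
  then show ?thesis by (simp add: clique_count_def)
qed

lemma clique_count_1: "clique_count E U 1 = card U"
proof -
  have "cliques_in E U 1 = (\<lambda>x. {x}) ` U"
    by (auto simp: cliques_in_def is_clique_def card_Suc_eq)
  then show ?thesis by (simp add: clique_count_def card_image)
qed

lemma clique_count_le_choose: "finite U \<Longrightarrow> clique_count E U k \<le> card U choose k"
proof -
  assume U: "finite U"
  have "clique_count E U k \<le> card {S. S \<subseteq> U \<and> card S = k}"
    unfolding clique_count_def by (rule card_mono) (use U in \<open>auto simp: cliques_in_def\<close>)
  then show ?thesis using n_subsets[OF U] by simp
qed

lemma clique_count_le_1: "finite U \<Longrightarrow> card U \<le> k \<Longrightarrow> clique_count E U k \<le> 1"
  using clique_count_le_choose[of U E k] by (cases "card U = k") (auto simp: binomial_eq_0)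

lemma clique_count_Suc:
  assumes "finite U" "v \<in> U" "sym E" "irrefl E"
  shows "clique_count E U (Suc j) = clique_count E (U - {v}) (Suc j) + clique_count E (U \<inter> E `` {v}) j"
proof -
  let ?A = "cliques_in E (U - {v}) (Suc j)" and ?B = "cliques_in E (U \<inter> E `` {v}) j"
  have nv: "v \<notin> S" if "S \<in> ?B" for S using that assms(4) by (auto simp: cliques_in_def irrefl_def)
  have fin: "finite S" if "S \<subseteq> U" for S using assms(1) that finite_subset by blast
  have "cliques_in E U (Suc j) = ?A \<union> insert v ` ?B"
  proof (intro equalityI subsetI)
    fix S assume S: "S \<in> cliques_in E U (Suc j)"
    show "S \<in> ?A \<union> insert v ` ?B"
    proof (cases "v \<in> S")
      case False
      then show ?thesis using S by (auto simp: cliques_in_def)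
    next
      case True
      have "S - {v} \<in> ?B" using S True fin[of S]
        by (auto simp: cliques_in_def is_clique_def)
      moreover have "S = insert v (S - {v})" using True by blast
      ultimately show ?thesis by blast
    qed
  next
    fix S assume "S \<in> ?A \<union> insert v ` ?B"
    then show "S \<in> cliques_in E U (Suc j)"
    proof
      assume "S \<in> ?A" then show ?thesis by (auto simp: cliques_in_def)
    next
      assume "S \<in> insert v ` ?B"
      then obtain T where T: "T \<in> ?B" "S = insert v T" by blast
      have "card S = Suc j" using nv[OF T(1)] T fin[of T] by (auto simp: cliques_in_def)
      then show ?thesis using T assms(2) symD[OF assms(3)]
        by (auto simp: cliques_in_def is_clique_def)
    qed
  qed
  moreover have "inj_on (insert v) ?B"
  proof (rule inj_onI)
    fix S T assume "S \<in> ?B" "T \<in> ?B" "insert v S = insert v T"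
    then show "S = T" using nv[of S] nv[of T] by (metis Diff_insert_absorb)
  qed
  moreover have "?A \<inter> insert v ` ?B = {}" by (auto simp: cliques_in_def)
  ultimately show ?thesis using assms(1)
    by (simp add: clique_count_def card_Un_disjoint card_image)
qed

text \<open>Vertices of degree at most \<open>d\<close> are deleted one by one. A deleted vertex
  lies in at most \<open>M\<close> of the remaining cliques, since the other \<open>j\<close>
  vertices of each form a clique in its neighbourhood.\<close>

lemma clique_count_degenerate:
  assumes "finite U" "sym E" "irrefl E"
    and "\<And>W. W \<subseteq> U \<Longrightarrow> W \<noteq> {} \<Longrightarrow> \<exists>v\<in>W. card (W \<inter> E `` {v}) \<le> d"
    and "\<And>W. W \<subseteq> U \<Longrightarrow> card W \<le> d \<Longrightarrow> clique_count E W j \<le> M"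
  shows "clique_count E U (Suc j) \<le> card U * M"
  using assms
proof (induction "card U" arbitrary: U)
  case 0
  then have "cliques_in E U (Suc j) = {}" by (auto simp: cliques_in_def)
  then show ?case by (simp add: clique_count_def)
next
  case (Suc n)
  then have "U \<noteq> {}" by auto
  then obtain v where v: "v \<in> U" "card (U \<inter> E `` {v}) \<le> d" using Suc.prems(4)[of U] by blast
  have "clique_count E (U - {v}) (Suc j) \<le> card (U - {v}) * M"
  proof (rule Suc.hyps(1))
    show "n = card (U - {v})" using Suc.hyps(2) Suc.prems(1) v(1) by simp
    show "\<exists>w\<in>W. card (W \<inter> E `` {w}) \<le> d" if "W \<subseteq> U - {v}" "W \<noteq> {}" for W
      using Suc.prems(4)[of W] that by blast
    show "clique_count E W j \<le> M" if "W \<subseteq> U - {v}" "card W \<le> d" for W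
      using Suc.prems(5)[of W] that by blast
  qed (use Suc.prems in auto)
  moreover have "clique_count E (U \<inter> E `` {v}) j \<le> M" using Suc.prems(5) v(2) by blast
  moreover have "card U = Suc (card (U - {v}))" using v(1) Suc.prems(1) by (metis card.remove)
  ultimately show ?case using clique_count_Suc[OF Suc.prems(1) v(1) Suc.prems(2,3)] by simp
qed

text \<open>\<open>r\<close> bounds how often a branching vertex can be taken into the clique before
  |U| - j drops below 1, where at most one clique is left. Exclusions cost nothing, and the bound (n
  + 1)^r counts the possible positions of the inclusions. Since each inclusion lowers the clique
  order by one, \<open>j0 + r \<le> j\<close> keeps the orders at the leaves at least
  \<open>j0\<close>.\<close>

lemma clique_count_peel:
  fixes \<delta> M :: real
  assumes "0 < \<delta>" "\<delta> < 1" "1 \<le> M" "sym E" "irrefl E" "finite U"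
    and "\<And>W i. W \<subseteq> U \<Longrightarrow> j0 \<le> i \<Longrightarrow> i \<le> j \<Longrightarrow> i < card W \<Longrightarrow>
       (\<And>v. v \<in> W \<Longrightarrow> real (card (W - E `` {v} - {v})) < \<delta> * (real (card W) - real i)) \<Longrightarrow>
       real (clique_count E W i) \<le> M"
    and "real (card U) - real j < (1 / (1 - \<delta>)) ^ r" "j0 + r \<le> j"
  shows "real (clique_count E U j) \<le> real (card U + 1) ^ r * M"
  using assms(6-9)
proof (induction "card U" arbitrary: U r j rule: less_induct)
  case less
  note U = less.prems(1) and tb = less.prems(2)
  have one: "1 \<le> real (card U + 1) ^ r" by simp
  have M1: "M \<le> real (card U + 1) ^ r * M" using mult_right_mono[OF one, of M] assms(3) by simp
  show ?case
  proof (cases "card U \<le> j")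
    case True
    then have "real (clique_count E U j) \<le> 1" using clique_count_le_1[OF U True, of E] by linarith
    then show ?thesis using M1 assms(3) by linarith
  next
    case gt: False
    define x where "x = real (card U) - real j"
    have x: "1 \<le> x" using gt by (simp add: x_def)
    have "r \<noteq> 0" using less.prems(3) x unfolding x_def by (cases r) auto
    then obtain r' where r: "r = Suc r'" by (cases r) auto
    obtain j' where j: "j = Suc j'" using less.prems(4) r by (cases j) auto
    show ?thesis
    proof (cases "\<forall>v\<in>U. real (card (U - E `` {v} - {v})) < \<delta> * x")
      case True
      then have "real (clique_count E U j) \<le> M"
        using tb[of U j] gt less.prems(4) by (auto simp: x_def)
      then show ?thesis using M1 by linarith
    next
      case False
      then obtain v where v: "v \<in> U" "\<delta> * x \<le> real (card (U - E `` {v} - {v}))" by force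
      let ?N = "U \<inter> E `` {v}"
      have vN: "v \<notin> E `` {v}" using assms(5) by (auto simp: irrefl_def)
      have cU: "card U = Suc (card (U - {v}))" using v(1) U by (metis card.remove)
      have "card U = card ?N + card (U - E `` {v})"
        by (metis U card_Int_Diff)
      moreover have "card (U - E `` {v}) = Suc (card (U - E `` {v} - {v}))"
        using v(1) vN U by (metis DiffI card.remove finite_Diff)
      ultimately have cN: "real (card U) = real (card ?N) + 1 + real (card (U - E `` {v} - {v}))"
        by simp
      have "real (clique_count E (U - {v}) j) \<le> real (card (U - {v}) + 1) ^ r * M"
      proof (rule less.hyps)
        show "card (U - {v}) < card U" using cU by simp
        show "real (card (U - {v})) - real j < (1 / (1 - \<delta>)) ^ r" using less.prems(3) cU by simp
        show "real (clique_count E W i) \<le> M"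
          if "W \<subseteq> U - {v}" "j0 \<le> i" "i \<le> j" "i < card W"
            "\<And>v. v \<in> W \<Longrightarrow> real (card (W - E `` {v} - {v})) < \<delta> * (real (card W) - real i)" for W i
          using tb[of W i] that by auto
      qed (use U less.prems in auto)
      also have "\<dots> = real (card U) ^ r * M" using cU by simp
      finally have 1: "real (clique_count E (U - {v}) j) \<le> real (card U) ^ r * M" .
      have "real (clique_count E ?N j') \<le> real (card ?N + 1) ^ r' * M"
      proof (rule less.hyps)
        show "card ?N < card U" using cN by linarith
        \<comment> \<open>The vertex \<open>v\<close> itself leaves both terms of the potential, so
          the potential drops by exactly the number of non-neighbours of \<open>v\<close>.\<close>
        have "real (card ?N) - real j' = x - real (card (U - E `` {v} - {v}))"
          using cN by (simp add: x_def j)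
        also have "\<dots> \<le> (1 - \<delta>) * x" using v(2) by (simp add: algebra_simps)
        also have "\<dots> < (1 - \<delta>) * (1 / (1 - \<delta>)) ^ r"
          using less.prems(3) assms(2) by (intro mult_strict_left_mono) (auto simp: x_def)
        also have "\<dots> = (1 / (1 - \<delta>)) ^ r'" using assms(2) by (simp add: r)
        finally show "real (card ?N) - real j' < (1 / (1 - \<delta>)) ^ r'" .
        show "real (clique_count E W i) \<le> M"
          if "W \<subseteq> ?N" "j0 \<le> i" "i \<le> j'" "i < card W"
            "\<And>v. v \<in> W \<Longrightarrow> real (card (W - E `` {v} - {v})) < \<delta> * (real (card W) - real i)" for W i
          using tb[of W i] that by (auto simp: j)
      qed (use U less.prems r j in auto)
      also have "\<dots> \<le> real (card U) ^ r' * M"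
        using cN assms(3) by (intro mult_right_mono power_mono) auto
      finally have 2: "real (clique_count E ?N j') \<le> real (card U) ^ r' * M" .
      have "real (clique_count E U j) = real (clique_count E (U - {v}) j) + real (clique_count E ?N j')"
        using clique_count_Suc[OF U v(1) assms(4,5)] unfolding j by simp
      \<comment> \<open>With n the number of vertices, n^r + n^(r-1) = n^(r-1) (n + 1) <= (n + 1)^r
        closes the recursion.\<close>
      also have "\<dots> \<le> real (card U) ^ r' * real (card U + 1) * M"
        using 1 2 by (simp add: r algebra_simps)
      also have "\<dots> \<le> real (card U + 1) ^ r' * real (card U + 1) * M"
        using assms(3) by (intro mult_right_mono power_mono) auto
      finally show ?thesis by (simp add: r mult.commute)
    qed
  qed
qed

text \<open>Cliques are sorted by their trace on \<open>R\<close>. Serves twice: with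
  \<open>R\<close> the complement of a maximum clique, and with \<open>R\<close> the vertices in
  excess of the order of a Turan graph.\<close>

lemma clique_count_decompose:
  assumes "finite U" "R \<subseteq> U"
    and "\<And>I. I \<subseteq> R \<Longrightarrow> is_clique E I \<Longrightarrow> card I \<le> j \<Longrightarrow>
       clique_count E {x \<in> U - R. \<forall>i\<in>I. (i, x) \<in> E} (j - card I) \<le> M"
  shows "clique_count E U j \<le> 2 ^ card R * M"
proof -
  have R: "finite R" using assms finite_subset by blast
  define Q where "Q I = {x \<in> U - R. \<forall>i\<in>I. (i, x) \<in> E}" for I
  define J where "J = {I \<in> Pow R. is_clique E I \<and> card I \<le> j}"
  have "cliques_in E U j \<subseteq> (\<Union>I\<in>J. (\<union>) I ` cliques_in E (Q I) (j - card I))"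
  proof
    fix S assume S: "S \<in> cliques_in E U j"
    then have fS: "finite S" using assms(1) finite_subset by (auto simp: cliques_in_def)
    have c: "card S = card (S \<inter> R) + card (S - R)" using fS by (metis card_Int_Diff)
    have "S \<inter> R \<in> J" using S c by (auto simp: J_def cliques_in_def is_clique_def)
    moreover have "S - R \<in> cliques_in E (Q (S \<inter> R)) (j - card (S \<inter> R))"
      using S c by (auto simp: cliques_in_def is_clique_def Q_def)
    moreover have "S = (S \<inter> R) \<union> (S - R)" by blast
    ultimately show "S \<in> (\<Union>I\<in>J. (\<union>) I ` cliques_in E (Q I) (j - card I))" by blast
  qed
  then have "clique_count E U j \<le> card (\<Union>I\<in>J. (\<union>) I ` cliques_in E (Q I) (j - card I))"
    unfolding clique_count_def using R assms(1) by (intro card_mono) (auto simp: J_def Q_def)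
  also have "\<dots> \<le> (\<Sum>I\<in>J. card ((\<union>) I ` cliques_in E (Q I) (j - card I)))"
    by (rule card_UN_le) (use R in \<open>simp add: J_def\<close>)
  also have "\<dots> \<le> (\<Sum>I\<in>J. M)"
  proof (rule sum_mono)
    fix I assume "I \<in> J"
    have "card ((\<union>) I ` cliques_in E (Q I) (j - card I)) \<le> clique_count E (Q I) (j - card I)"
      unfolding clique_count_def by (rule card_image_le) (use assms(1) in \<open>simp add: Q_def\<close>)
    also have "\<dots> \<le> M" unfolding Q_def by (rule assms(3)) (use \<open>I \<in> J\<close> in \<open>auto simp: J_def\<close>)
    finally show "card ((\<union>) I ` cliques_in E (Q I) (j - card I)) \<le> M" .
  qed
  also have "\<dots> = card J * M" by simp
  also have "card J \<le> card (Pow R)" by (rule card_mono) (use R in \<open>auto simp: J_def\<close>)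
  then have "card J * M \<le> 2 ^ card R * M" using R by (simp add: card_Pow)
  finally show ?thesis .
qed

text \<open>The vertices of \<open>K\<close> that can complete a trace \<open>I\<close> form a
  clique together with \<open>I\<close>; by maximality of \<open>K\<close> there are at most |K| -
  |I| of them.\<close>

lemma clique_count_near_clique:
  assumes "finite U" "sym E" "K \<subseteq> U" "is_clique E K" "j \<le> card K"
    and max: "\<And>S. S \<subseteq> U \<Longrightarrow> is_clique E S \<Longrightarrow> card S \<le> card K"
  shows "clique_count E U j \<le> 2 ^ card (U - K) * (card K choose j)"
proof (rule clique_count_decompose[OF assms(1)])
  fix I assume I: "I \<subseteq> U - K" "is_clique E I" "card I \<le> j"
  define Q where "Q = {x \<in> U - (U - K). \<forall>i\<in>I. (i, x) \<in> E}"
  have fin: "finite I" "finite Q" using I(1) assms(1) by (auto simp: Q_def dest: finite_subset)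
  have QK: "Q \<subseteq> K" by (auto simp: Q_def)
  have "is_clique E (Q \<union> I)"
    unfolding is_clique_def
  proof (intro ballI impI)
    fix x y assume xy: "x \<in> Q \<union> I" "y \<in> Q \<union> I" "x \<noteq> y"
    have QI: "(i, z) \<in> E" "(z, i) \<in> E" if "i \<in> I" "z \<in> Q" for i z
      using that symD[OF assms(2)] by (auto simp: Q_def)
    consider "x \<in> Q" "y \<in> Q" | "x \<in> I" "y \<in> I" | "x \<in> I" "y \<in> Q" | "x \<in> Q" "y \<in> I"
      using xy by blast
    then show "(x, y) \<in> E"
      by cases (use subsetD[OF QK] I(2) assms(4) xy(3) QI in \<open>auto simp: is_clique_def\<close>)
  qed
  then have "card (Q \<union> I) \<le> card K" using max[of "Q \<union> I"] QK I(1) assms(3) by blast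
  moreover have "card (Q \<union> I) = card Q + card I"
    using QK I(1) fin by (intro card_Un_disjoint) auto
  ultimately have c: "card Q \<le> card K - card I" by linarith
  have "clique_count E Q (j - card I) \<le> card Q choose (j - card I)"
    by (rule clique_count_le_choose[OF fin(2)])
  also have "\<dots> \<le> (card K - card I) choose (j - card I)" using c by (rule binomial_right_mono)
  \<comment> \<open>After complementation the lower index is |K| - j, independent of the trace, and
    monotonicity in the upper index applies.\<close>
  also have "\<dots> = (card K - card I) choose (card K - j)"
    using I(3) assms(5) by (subst binomial_symmetric) auto
  also have "\<dots> \<le> card K choose (card K - j)" by (rule binomial_right_mono) simp
  also have "\<dots> = card K choose j" using assms(5) by (simp add: binomial_symmetric[symmetric])
  finally show "clique_count E {x \<in> U - (U - K). \<forall>i\<in>I. (i, x) \<in> E} (j - card I) \<le> card K choose j"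
    by (simp add: Q_def)
qed auto

section \<open>Dominating branch sets\<close>

definition dominates :: "'a rel \<Rightarrow> 'a set \<Rightarrow> 'a set \<Rightarrow> bool" where
  "dominates E B W \<longleftrightarrow> (\<forall>x\<in>W. x \<in> B \<or> (\<exists>b\<in>B. (b, x) \<in> E))"

text \<open>Greedy choice: when the last set is picked, only q - 1 sets of at most \<open>b\<close>
  elements are in the way, so q b <= u + b suffices.\<close>

lemma disjoint_family_exists:
  assumes "finite R"
    and "\<And>U0. U0 \<subseteq> R \<Longrightarrow> card U0 \<le> u \<Longrightarrow> \<exists>B\<subseteq>R - U0. P B \<and> card B \<le> b \<and> B \<noteq> {}"
    and "q * b \<le> u + b"
  shows "\<exists>F. card F = q \<and> finite F \<and> (\<forall>B\<in>F. P B \<and> B \<subseteq> R) \<and>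
     (\<forall>B\<in>F. \<forall>C\<in>F. B \<noteq> C \<longrightarrow> B \<inter> C = {}) \<and> card (\<Union>F) \<le> q * b"
  using assms(3)
proof (induction q)
  case 0
  show ?case by (rule exI[of _ "{}"]) simp
next
  case (Suc q)
  then obtain F where F: "card F = q" "finite F" "\<forall>B\<in>F. P B \<and> B \<subseteq> R"
    "\<forall>B\<in>F. \<forall>C\<in>F. B \<noteq> C \<longrightarrow> B \<inter> C = {}" "card (\<Union>F) \<le> q * b" by auto
  have "card (\<Union>F) \<le> u" "\<Union>F \<subseteq> R" using F Suc.prems by auto
  then obtain B where B: "B \<subseteq> R - \<Union>F" "P B" "card B \<le> b" "B \<noteq> {}" using assms(2) by metis
  then have "B \<notin> F" by blast
  have "card (\<Union>(insert B F)) \<le> card B + card (\<Union>F)" by (simp add: card_Un_le)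
  then have "card (\<Union>(insert B F)) \<le> Suc q * b" using B(3) F(5) by simp
  then show ?case using F B \<open>B \<notin> F\<close> by (intro exI[of _ "insert B F"]) auto
qed

text \<open>A dominating set is adjacent to every nonempty set disjoint from it, so such sets can be
  added to the singletons of a clique without further conditions.\<close>

lemma complete_model_dominating:
  assumes "finite W" "sym E" "K \<subseteq> W" "is_clique E K" "finite F"
    and F: "\<And>B. B \<in> F \<Longrightarrow> B \<subseteq> W - K \<and> linked E B \<and> dominates E B W"
    and dis: "\<And>B C. B \<in> F \<Longrightarrow> C \<in> F \<Longrightarrow> B \<noteq> C \<Longrightarrow> B \<inter> C = {}"
  shows "\<exists>F'. complete_model E W F' \<and> card F' = card K + card F"
proof -
  let ?S = "(\<lambda>x. {x}) ` K"
  have K: "finite K" using assms(1,3) finite_subset by blast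
  have ne: "B \<noteq> {}" if "B \<in> F" for B using F[OF that] by (simp add: linked_def)
  have "complete_model E W (?S \<union> F)"
    unfolding complete_model_def
  proof (intro conjI ballI impI)
    fix B assume "B \<in> ?S \<union> F"
    then show "B \<subseteq> W" "linked E B" using F assms(3) by (auto simp: linked_singleton)
  next
    fix B C assume BC: "B \<in> ?S \<union> F" "C \<in> ?S \<union> F" "B \<noteq> C"
    have sub: "B \<subseteq> W" "C \<subseteq> W" "B \<noteq> {}" "C \<noteq> {}" using BC(1,2) F ne assms(3) by auto
    have avoid: "X \<inter> {x} = {}" if "X \<in> F" "x \<in> K" for X x using F[OF that(1)] that(2) by auto
    have dj: "B \<inter> C = {}" using BC
    proof (elim UnE imageE)
      fix x y assume "B = {x}" "C = {y}" "B \<noteq> C" then show ?thesis by auto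
    next
      fix x assume "B = {x}" "x \<in> K" "C \<in> F" then show ?thesis using avoid[of C x] by auto
    next
      fix x assume "C = {x}" "x \<in> K" "B \<in> F" then show ?thesis using avoid[of B x] by auto
    next
      assume "B \<in> F" "C \<in> F" "B \<noteq> C" then show ?thesis using dis by simp
    qed
    then show "B \<inter> C = {}" .
    have dom: "\<exists>b\<in>B. \<exists>c\<in>C. (b, c) \<in> E" if h: "B \<in> F" "C \<subseteq> W" "C \<noteq> {}" "B \<inter> C = {}" for B C
    proof -
      obtain c where "c \<in> C" using h(3) by blast
      moreover from this have c: "c \<notin> B" "c \<in> W" using h(2,4) by auto
      moreover have "dominates E B W" using F[OF h(1)] by simp
      ultimately have "\<exists>b\<in>B. (b, c) \<in> E" by (auto simp: dominates_def)
      then show ?thesis using \<open>c \<in> C\<close> by blast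
    qed
    show "\<exists>b\<in>B. \<exists>c\<in>C. (b, c) \<in> E"
    proof (cases "B \<in> F")
      case True
      show ?thesis by (rule dom[OF True sub(2,4) dj])
    next
      case B: False
      then obtain x where x: "B = {x}" "x \<in> K" using BC by blast
      show ?thesis
      proof (cases "C \<in> F")
        case True
        have "\<exists>b\<in>C. \<exists>c\<in>B. (b, c) \<in> E"
          using dom[OF True sub(1,3)] dj by (simp add: Int_commute)
        then obtain b c where "b \<in> C" "c \<in> B" "(b, c) \<in> E" by blast
        with symD[OF assms(2), of b c] show ?thesis by blast
      next
        case False
        then show ?thesis using BC x assms(4) by (auto simp: is_clique_def)
      qed
    qed
  qed
  moreover have "card (?S \<union> F) = card K + card F"
    using K assms(5) F by (subst card_Un_disjoint) (auto simp: card_image)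
  ultimately show ?thesis by blast
qed

lemma averaging:
  fixes \<theta> :: real
  assumes "finite X" "finite Z" "Z \<noteq> {}"
    and "\<And>x. x \<in> X \<Longrightarrow> real (card {z \<in> Z. Q x z}) \<le> \<theta> * real (card Z)"
  shows "\<exists>z\<in>Z. real (card {x \<in> X. Q x z}) \<le> \<theta> * real (card X)"
proof (rule ccontr)
  assume "\<not> ?thesis"
  then have "(\<Sum>z\<in>Z. \<theta> * real (card X)) < (\<Sum>z\<in>Z. real (card {x \<in> X. Q x z}))"
    using assms(2,3) by (intro sum_strict_mono) auto
  also have "\<dots> = (\<Sum>z\<in>Z. \<Sum>x\<in>X. if Q x z then 1 else 0)"
    using assms(1) by (simp add: sum.If_cases Int_def)
  also have "\<dots> = (\<Sum>x\<in>X. \<Sum>z\<in>Z. if Q x z then 1 else 0)" by (rule sum.swap)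
  also have "\<dots> = (\<Sum>x\<in>X. real (card {z \<in> Z. Q x z}))"
    using assms(2) by (simp add: sum.If_cases Int_def)
  also have "\<dots> \<le> (\<Sum>x\<in>X. \<theta> * real (card Z))" using assms(4) by (rule sum_mono)
  finally show False by (simp add: mult.commute mult.left_commute)
qed

text \<open>Each chosen vertex leaves at most a fraction \<theta> of the vertices not yet dominated.
  Once \<theta>^c |W| < 1 none is left.\<close>

lemma greedy_domination:
  fixes \<theta> :: real
  assumes "finite W" "0 \<le> \<theta>"
    and "\<And>X. X \<subseteq> W \<Longrightarrow> X \<noteq> {} \<Longrightarrow> \<exists>z\<in>Z. real (card {x \<in> X. x \<noteq> z \<and> (z, x) \<notin> E}) \<le> \<theta> * real (card X)"
  shows "\<exists>D\<subseteq>Z. finite D \<and> card D \<le> c \<and>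
    real (card {x \<in> W. x \<notin> D \<and> (\<forall>d\<in>D. (d, x) \<notin> E)}) \<le> \<theta> ^ c * real (card W)"
proof (induction c)
  case 0
  show ?case by (rule exI[of _ "{}"]) simp
next
  case (Suc c)
  then obtain D where D: "D \<subseteq> Z" "finite D" "card D \<le> c"
    "real (card {x \<in> W. x \<notin> D \<and> (\<forall>d\<in>D. (d, x) \<notin> E)}) \<le> \<theta> ^ c * real (card W)" by blast
  let ?X = "{x \<in> W. x \<notin> D \<and> (\<forall>d\<in>D. (d, x) \<notin> E)}"
  show ?case
  proof (cases "?X = {}")
    case True
    then have "real (card ?X) \<le> \<theta> ^ Suc c * real (card W)" using assms(2) by (simp only: True) simp
    then show ?thesis using D by (intro exI[of _ D]) auto
  next
    case False
    then obtain z where z: "z \<in> Z" "real (card {x \<in> ?X. x \<noteq> z \<and> (z, x) \<notin> E}) \<le> \<theta> * real (card ?X)"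
      using assms(3)[of ?X] by blast
    have "{x \<in> W. x \<notin> insert z D \<and> (\<forall>d\<in>insert z D. (d, x) \<notin> E)} = {x \<in> ?X. x \<noteq> z \<and> (z, x) \<notin> E}"
      by auto
    then have "real (card {x \<in> W. x \<notin> insert z D \<and> (\<forall>d\<in>insert z D. (d, x) \<notin> E)}) \<le> \<theta> * real (card ?X)"
      using z(2) by simp
    also have "\<dots> \<le> \<theta> * (\<theta> ^ c * real (card W))" using D(4) assms(2) by (rule mult_left_mono)
    finally show ?thesis using D z(1)
      by (intro exI[of _ "insert z D"]) (auto simp: card_insert_if mult.assoc)
  qed
qed

text \<open>Every further vertex of \<open>D\<close> is tied to an earlier one by at most two
  connecting vertices, which gives the factor 3.\<close>

lemma connect_set:
  assumes "finite D" "D \<noteq> {}" "D \<subseteq> Z" "sym E"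
    and "\<And>a b. a \<in> Z \<Longrightarrow> b \<in> Z \<Longrightarrow> \<exists>P\<subseteq>Z. finite P \<and> card P \<le> 2 \<and> linked E ({a, b} \<union> P)"
  shows "\<exists>B. D \<subseteq> B \<and> B \<subseteq> Z \<and> finite B \<and> card B \<le> 3 * card D \<and> linked E B"
  using assms(1-3)
proof (induction D rule: finite_ne_induct)
  case (singleton x)
  then show ?case by (intro exI[of _ "{x}"]) (auto simp: linked_singleton)
next
  case (insert x D)
  then obtain B where B: "D \<subseteq> B" "B \<subseteq> Z" "finite B" "card B \<le> 3 * card D" "linked E B" by auto
  obtain y where y: "y \<in> D" using insert by blast
  obtain P where P: "P \<subseteq> Z" "finite P" "card P \<le> 2" "linked E ({y, x} \<union> P)"
    using assms(5)[of y x] y insert.prems by blast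
  have "linked E (B \<union> ({y, x} \<union> P))"
    by (rule linked_Un[OF B(5) P(4) assms(4)]) (use y B(1) in blast)
  moreover have e: "B \<union> ({y, x} \<union> P) = insert x (B \<union> P)" using y B(1) by blast
  moreover have "card (insert x (B \<union> P)) \<le> 3 * card (insert x D)"
    using insert.hyps B(3,4) P(2,3) card_Un_le[of B P] card_insert_le_m1[of "card (B \<union> P) + 1" "B \<union> P" x]
    by simp
  ultimately show ?case using B P insert.prems
    by (intro exI[of _ "insert x (B \<union> P)"]) auto
qed

text \<open>Both hypotheses survive the removal of any \<open>u\<close> vertices of
  \<open>R\<close>. Hence dominating connected sets of at most \<open>3 * c\<close> vertices,
  \<open>c\<close> for domination and the rest for connection, can be taken out of \<open>R\<close>
  repeatedly, while the clique \<open>W - R\<close> contributes its singletons.\<close>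

lemma robust_model:
  fixes \<theta> :: real
  assumes W: "finite W" "W \<noteq> {}" and E: "sym E" and R: "R \<subseteq> W" "is_clique E (W - R)" and "0 \<le> \<theta>"
    and dom: "\<And>U0 X. U0 \<subseteq> R \<Longrightarrow> card U0 \<le> u \<Longrightarrow> X \<subseteq> W \<Longrightarrow> X \<noteq> {} \<Longrightarrow>
        \<exists>z\<in>R - U0. real (card {x \<in> X. x \<noteq> z \<and> (z, x) \<notin> E}) \<le> \<theta> * real (card X)"
    and con: "\<And>U0 a b. U0 \<subseteq> R \<Longrightarrow> card U0 \<le> u \<Longrightarrow> a \<in> R - U0 \<Longrightarrow> b \<in> R - U0 \<Longrightarrow>
        \<exists>P\<subseteq>R - U0. finite P \<and> card P \<le> 2 \<and> linked E ({a, b} \<union> P)"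
    and c: "\<theta> ^ c * real (card W) < 1" and q: "q * (3 * c) \<le> u + 3 * c"
  shows "\<exists>F. complete_model E W F \<and> card F = card (W - R) + q"
proof -
  have fR: "finite R" using W R finite_subset by blast
  have fam: "\<exists>B\<subseteq>R - U0. (linked E B \<and> dominates E B W) \<and> card B \<le> 3 * c \<and> B \<noteq> {}"
    if U0: "U0 \<subseteq> R" "card U0 \<le> u" for U0
  proof -
    obtain D where D: "D \<subseteq> R - U0" "finite D" "card D \<le> c"
      "real (card {x \<in> W. x \<notin> D \<and> (\<forall>d\<in>D. (d, x) \<notin> E)}) \<le> \<theta> ^ c * real (card W)"
      using greedy_domination[OF W(1) assms(6) dom[OF U0], of c] by blast
    have "card {x \<in> W. x \<notin> D \<and> (\<forall>d\<in>D. (d, x) \<notin> E)} = 0" using D(4) c by linarith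
    then have "{x \<in> W. x \<notin> D \<and> (\<forall>d\<in>D. (d, x) \<notin> E)} = {}" using W(1) by simp
    then have d: "dominates E D W" unfolding dominates_def by blast
    with W(2) have "D \<noteq> {}" unfolding dominates_def by blast
    then obtain B where B: "D \<subseteq> B" "B \<subseteq> R - U0" "card B \<le> 3 * card D" "linked E B"
      using connect_set[OF D(2) _ D(1) E con[OF U0]] by blast
    have "dominates E B W" using d B(1) unfolding dominates_def by blast
    then show ?thesis using B D(3) by (intro exI[of _ B]) (auto simp: linked_def)
  qed
  have ex: "\<exists>F. card F = q \<and> finite F \<and> (\<forall>B\<in>F. (linked E B \<and> dominates E B W) \<and> B \<subseteq> R) \<and>
     (\<forall>B\<in>F. \<forall>C\<in>F. B \<noteq> C \<longrightarrow> B \<inter> C = {}) \<and> card (\<Union>F) \<le> q * (3 * c)"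
    by (rule disjoint_family_exists[where P = "\<lambda>B. linked E B \<and> dominates E B W", OF fR _ q])
      (rule fam)
  obtain F where F: "card F = q" "finite F" "\<forall>B\<in>F. (linked E B \<and> dominates E B W) \<and> B \<subseteq> R"
    "\<forall>B\<in>F. \<forall>C\<in>F. B \<noteq> C \<longrightarrow> B \<inter> C = {}"
    using ex by (elim exE conjE) (rule that)
  have "W - (W - R) = R" using R by blast
  then show ?thesis
    using complete_model_dominating[OF W(1) E _ R(2) F(2)] F by auto
qed

section \<open>Degeneracy of minor-free graphs\<close>

lemma linked_insert: "linked E S \<Longrightarrow> sym E \<Longrightarrow> s \<in> S \<Longrightarrow> (s, x) \<in> E \<Longrightarrow> linked E (insert x S)"
  using linked_Un[of E S "{x}"] linked_singleton[of E x] by auto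

lemma linked_common_neighbour:
  assumes "sym E" "z = a \<or> (a, z) \<in> E" "z = b \<or> (b, z) \<in> E"
  shows "linked E ({a, b} \<union> {z})"
proof -
  have "linked E {a, z}" "linked E {b, z}"
    using assms(2,3) linked_insert[OF linked_singleton assms(1) singletonI]
    by (auto simp: linked_singleton insert_commute)
  then have "linked E ({a, z} \<union> {b, z})" using assms(1) by (intro linked_Un) auto
  moreover have "{a, z} \<union> {b, z} = {a, b} \<union> {z}" by auto
  ultimately show ?thesis by simp
qed

text \<open>Without \<open>U0\<close> every vertex keeps at least d - u >= |A| / 4 neighbours in the
  rest, so on average a remaining vertex misses at most 3/4 of \<open>X\<close>.\<close>

lemma dominating_vertex_of_degree:
  assumes "finite A" and deg: "\<And>x. x \<in> A \<Longrightarrow> d \<le> card (A \<inter> E `` {x})" and "sym E"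
    and "card A + 4 * u \<le> 4 * d" "U0 \<subseteq> A" "card U0 \<le> u" "X \<subseteq> A" "X \<noteq> {}"
  shows "\<exists>z\<in>A - U0. real (card {x \<in> X. x \<noteq> z \<and> (z, x) \<notin> E}) \<le> 3 / 4 * real (card X)"
proof (rule averaging)
  have fin: "finite U0" "finite X" using assms finite_subset by blast+
  show "finite X" "finite (A - U0)" using fin assms(1) by auto
  have nb: "d - u \<le> card ((A - U0) \<inter> E `` {x})" if "x \<in> A" for x
  proof -
    have "card (A \<inter> E `` {x}) \<le> card (((A - U0) \<inter> E `` {x}) \<union> U0)"
      by (rule card_mono) (use assms(1) fin in auto)
    also have "\<dots> \<le> card ((A - U0) \<inter> E `` {x}) + card U0" by (rule card_Un_le)
    finally show ?thesis using deg[OF that] assms(6) by linarith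
  qed
  have "card A > 0" using assms(1,7,8) by (auto simp: card_gt_0_iff)
  then have "d - u > 0" using assms(4) by linarith
  then show "A - U0 \<noteq> {}" using nb assms(7,8) by fastforce
  fix x assume "x \<in> X"
  then have x: "x \<in> A" using assms by blast
  have "card {z \<in> A - U0. x \<noteq> z \<and> (z, x) \<notin> E} \<le> card (A - U0 - E `` {x})"
    by (rule card_mono) (use assms(1,3) in \<open>auto dest: symD\<close>)
  also have "\<dots> = card (A - U0) - card ((A - U0) \<inter> E `` {x})"
    using assms(1) by (metis Int_Diff_Un card_Diff_subset_Int Int_commute finite_Diff finite_Int)
  finally have "real (card {z \<in> A - U0. x \<noteq> z \<and> (z, x) \<notin> E}) \<le> real (card (A - U0)) - real (d - u)"
    using nb[OF x] card_mono[of "A - U0" "(A - U0) \<inter> E `` {x}"] assms(1) by auto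
  moreover have "card (A - U0) \<le> 4 * (d - u)"
    using card_mono[of A "A - U0"] assms(1,4) by auto
  ultimately show "real (card {z \<in> A - U0. x \<noteq> z \<and> (z, x) \<notin> E}) \<le> 3 / 4 * real (card (A - U0))"
    by linarith
qed

lemma robust_degree_model:
  assumes A: "finite A" "A \<noteq> {}" "sym E" and deg: "\<And>x. x \<in> A \<Longrightarrow> d \<le> card (A \<inter> E `` {x})" "card A + 4 * u \<le> 4 * d"
    and con: "\<And>U0 a b. U0 \<subseteq> A \<Longrightarrow> card U0 \<le> u \<Longrightarrow> a \<in> A - U0 \<Longrightarrow> b \<in> A - U0 \<Longrightarrow>
        \<exists>P\<subseteq>A - U0. finite P \<and> card P \<le> 2 \<and> linked E ({a, b} \<union> P)"
    and c: "(3 / 4 :: real) ^ c * real (card A) < 1" and q: "q * (3 * c) \<le> u + 3 * c"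
  shows "\<exists>F. complete_model E A F \<and> card F = q"
proof -
  \<comment> \<open>Taking \<open>R = A\<close> leaves an empty clique, so all branch sets are
    dominating ones.\<close>
  have "is_clique E (A - A)" by (simp add: is_clique_def)
  from robust_model[OF A subset_refl this _ dominating_vertex_of_degree[OF A(1) deg(1) A(3) deg(2)] con c q]
  show ?thesis by simp
qed

text \<open>
  If some \<open>a\<close> and \<open>b\<close> cannot be joined through two further vertices, their neighbourhoods are disjoint
  with no edge in between, so each induces a graph of minimum degree almost its size.
\<close>
lemma dense_model:
  assumes fin: "finite V" "V \<noteq> {}" and E: "sym E" "irrefl E"
    and D: "0 < D" "card V \<le> 2 * D" "\<And>x. x \<in> V \<Longrightarrow> D \<le> card (V \<inter> E `` {x})"
    and c: "(3 / 4 :: real) ^ c * (2 * real D) < 1" and u: "16 * u \<le> D" and q: "q * (3 * c) \<le> u + 3 * c"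
  shows "\<exists>F. complete_model E V F \<and> card F = q"
proof -
  define joined where "joined U0 a b \<longleftrightarrow> (\<exists>P\<subseteq>V - U0. finite P \<and> card P \<le> 2 \<and> linked E ({a, b} \<union> P))"
    for U0 a b
  show ?thesis
  proof (cases "\<forall>U0 a b. U0 \<subseteq> V \<and> card U0 \<le> u \<and> a \<in> V - U0 \<and> b \<in> V - U0 \<longrightarrow> joined U0 a b")
    case True
    have "(3 / 4 :: real) ^ c * real (card V) \<le> (3 / 4) ^ c * (2 * real D)"
      using D(2) by (intro mult_left_mono) auto
    then have "(3 / 4 :: real) ^ c * real (card V) < 1" using c by linarith
    from robust_degree_model[OF fin E(1) D(3) _ _ this q] show ?thesis
      using True D(2) u unfolding joined_def by simp
  next
    case False
    then obtain U0 a b where U0: "U0 \<subseteq> V" "card U0 \<le> u" "a \<in> V - U0" "b \<in> V - U0"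
      and "\<not> joined U0 a b" by blast
    then have no: "\<not> linked E ({a, b} \<union> P)" if "P \<subseteq> V - U0" "finite P" "card P \<le> 2" for P
      using that unfolding joined_def by blast
    define A where "A = V \<inter> E `` {a} - U0"
    define B where "B = V \<inter> E `` {b} - U0"
    have fin': "finite A" "finite B" "finite U0"
      using fin(1) finite_subset[OF U0(1)] by (simp_all add: A_def B_def)
    have size: "D - u \<le> card (V \<inter> E `` {x} - U0)" if "x \<in> V" for x
      using diff_card_le_card_Diff[OF fin'(3), of "V \<inter> E `` {x}"] D(3)[OF that] U0(2) by linarith
    have AB: "D - u \<le> card A" "D - u \<le> card B" using size U0 by (auto simp: A_def B_def)
    have disj: "A \<inter> B = {}"
    proof (rule ccontr)
      assume "A \<inter> B \<noteq> {}"
      then obtain z where z: "z \<in> V - U0" "(a, z) \<in> E" "(b, z) \<in> E" by (auto simp: A_def B_def)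
      then have "linked E ({a, b} \<union> {z})" using E(1) by (intro linked_common_neighbour) auto
      then show False using no[of "{z}"] z(1) by simp
    qed
    have noedge: "(x, y) \<notin> E" if "x \<in> A" "y \<in> B" for x y
    proof
      assume e: "(x, y) \<in> E"
      have z: "x \<in> V - U0" "y \<in> V - U0" "(a, x) \<in> E" "(b, y) \<in> E" using that by (auto simp: A_def B_def)
      have "linked E (insert b (insert y (insert x {a})))"
        using linked_insert[OF linked_insert[OF linked_insert[OF linked_singleton[of E a] E(1) _ z(3)]
            E(1) _ e] E(1), of y b] symD[OF E(1) z(4)] by auto
      moreover have "insert b (insert y (insert x {a})) = {a, b} \<union> {x, y}" by auto
      ultimately have "linked E ({a, b} \<union> {x, y})" by simp
      moreover have "card {x, y} \<le> 2" by (simp add: card_insert_if)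
      ultimately show False using no[of "{x, y}"] z(1,2) by simp
    qed
    have sub: "A \<subseteq> V" "B \<subseteq> V" by (auto simp: A_def B_def)
    have "card (A \<union> B) = card A + card B" using fin' disj by (simp add: card_Un_disjoint)
    then have rest: "card (V - (A \<union> B)) = card V - card A - card B"
      using fin' sub by (simp add: card_Diff_subset)
    have cA: "card A \<le> D + u"
      using card_mono[OF fin(1), of "A \<union> B"] \<open>card (A \<union> B) = _\<close> sub AB D(2) by simp
    have deg: "D - 2 * u \<le> card (A \<inter> E `` {x})" if "x \<in> A" for x
    proof -
      have "V \<inter> E `` {x} \<subseteq> (A \<inter> E `` {x}) \<union> (V - (A \<union> B))" using noedge[OF that] by auto
      then have "card (V \<inter> E `` {x}) \<le> card ((A \<inter> E `` {x}) \<union> (V - (A \<union> B)))"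
        using fin fin' by (intro card_mono) auto
      also have "\<dots> \<le> card (A \<inter> E `` {x}) + card (V - (A \<union> B))" by (rule card_Un_le)
      finally show ?thesis using rest AB D(2) D(3)[of x] that sub by fastforce
    qed
    have "A \<noteq> {}" using AB(1) D(1) u by auto
    have "(3 / 4 :: real) ^ c * real (card A) \<le> (3 / 4) ^ c * (2 * real D)"
      using cA u by (intro mult_left_mono) auto
    then have cA1: "(3 / 4 :: real) ^ c * real (card A) < 1" using c by linarith
    have "\<exists>F. complete_model E A F \<and> card F = q"
    proof (rule robust_degree_model[OF fin'(1) \<open>A \<noteq> {}\<close> E(1) deg _ _ cA1 q])
      show "card A + 4 * u \<le> 4 * (D - 2 * u)" using cA u by linarith
      show "\<exists>P\<subseteq>A - U1. finite P \<and> card P \<le> 2 \<and> linked E ({x, y} \<union> P)"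
        if U1: "U1 \<subseteq> A" "card U1 \<le> u" and xy: "x \<in> A - U1" "y \<in> A - U1" for U1 x y
      proof -
        let ?X = "A \<inter> E `` {x}" and ?Y = "A \<inter> E `` {y}"
        have "card ?X + card ?Y = card (?X \<union> ?Y) + card (?X \<inter> ?Y)"
          using fin' by (intro card_Un_Int) auto
        moreover have "card (?X \<union> ?Y) \<le> card A" using fin' by (intro card_mono) auto
        ultimately have "u < card (?X \<inter> ?Y)"
          using deg[of x] deg[of y] xy cA u D(1) by auto
        then have "\<not> ?X \<inter> ?Y \<subseteq> U1"
          using U1 fin' card_mono[of U1 "?X \<inter> ?Y"] finite_subset by fastforce
        then obtain z where z: "z \<in> A - U1" "(x, z) \<in> E" "(y, z) \<in> E" by blast
        then have "linked E ({x, y} \<union> {z})" using E(1) by (intro linked_common_neighbour) auto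
        then show ?thesis using z(1) by (intro exI[of _ "{z}"]) auto
      qed
    qed
    then show ?thesis using complete_model_mono[OF _ sub(1) subset_refl] by auto
  qed
qed

lemma complete_model_subrel: "complete_model E U F \<Longrightarrow> E \<subseteq> E' \<Longrightarrow> complete_model E' U F"
  unfolding complete_model_def using linked_subrel by (meson subsetD)

lemma card_arcs_eq_sum:
  assumes "finite V" "E \<subseteq> V \<times> V"
  shows "card E = (\<Sum>v\<in>V. card (E `` {v}))"
proof -
  have "E = (SIGMA v:V. E `` {v})" using assms by auto
  then have "card E = card (SIGMA v:V. E `` {v})" by simp
  also have "\<dots> = (\<Sum>v\<in>V. card (E `` {v}))"
    using assms finite_subset[of "E `` {_}" V] by (intro card_SigmaI) auto
  finally show ?thesis .
qed

text \<open>
  Each edge is a pair of arcs, hence the factor 2. Contracting \<open>xy\<close> destroys one edge more than it has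
  common neighbours, so in a minimal counterexample every edge lies in \<open>D\<close> triangles, and the
  neighbourhood of a vertex of minimum degree is dense.
\<close>
lemma edge_bound_minor_free:
  assumes "simple_graph V E" "minor_free t E V" "V \<noteq> {}" and D: "0 < D"
    and c: "(3 / 4 :: real) ^ c * (2 * real D) < 1" and u: "16 * u \<le> D" and q: "t * (3 * c) \<le> u + 3 * c"
  shows "card E < 2 * D * card V"
  using assms(1-3)
proof (induction "card V + card E" arbitrary: V E rule: less_induct)
  case less
  note G = simple_graphD[OF less.prems(1)]
  show ?case
  proof (rule ccontr)
    assume "\<not> card E < 2 * D * card V"
    then have ge: "2 * D * card V \<le> card E" by simp
    have cV: "0 < card V" using G(1) less.prems(3) by (simp add: card_gt_0_iff)
    have nE: "finite (E `` {x})" "E `` {x} \<subseteq> V" for x using G(1,7) finite_subset[of "E `` {x}" V] by auto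
    have "card E > 0" using ge cV D by (metis less_le_trans mult_pos_pos zero_less_numeral)
    then have "E \<noteq> {}" by auto
    then obtain x0 y0 where e0: "(x0, y0) \<in> E" by auto
    \<comment> \<open>Otherwise deleting one edge, that is two arcs, leaves a smaller
      counterexample.\<close>
    have upper: "card E < 2 * D * card V + 2"
    proof (rule ccontr)
      assume a: "\<not> ?thesis"
      let ?E = "E - {(x0, y0), (y0, x0)}"
      have sg: "simple_graph V ?E"
        using less.prems(1) by (auto simp: simple_graph_def sym_def irrefl_def)
      have "x0 \<noteq> y0" using e0 G(9) by auto
      then have cE: "card ?E = card E - 2" using e0 G(5,8) by (subst card_Diff_subset) auto
      have "card ?E < 2 * D * card V"
      proof (rule less.hyps[OF _ sg])
        show "card V + card ?E < card V + card E" using cE \<open>card E > 0\<close> by linarith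
        show "minor_free t ?E V"
          using less.prems(2) complete_model_subrel[of ?E V _ E] unfolding minor_free_def by blast
      qed (use less.prems in auto)
      then show False using cE a by linarith
    qed
    have common: "D \<le> card (E `` {x} \<inter> E `` {y})" if xy: "(x, y) \<in> E" for x y
    proof (rule ccontr)
      assume a: "\<not> ?thesis"
      define H where "H = contract_edge \<lparr>pverts = V, parcs = E\<rparr> x y"
      have ne: "x \<noteq> y" using xy G(9) by auto
      have sH: "simple_graph (pverts H) (parcs H)"
        using simple_graph_minor_step[OF minor_step.intros(3), of x y "\<lparr>pverts = V, parcs = E\<rparr>"]
          xy less.prems(1) by (simp add: H_def)
      have VH: "pverts H = V - {y}"
        using G(6,7) xy ne unfolding H_def contract_edge_def Let_def by auto
      have EH: "parcs H = {(if a = y then x else a, if b = y then x else b) |a b.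
          (a, b) \<in> E \<and> (if a = y then x else a) \<noteq> (if b = y then x else b)}"
        by (simp add: H_def contract_edge_def Let_def)
      \<comment> \<open>The contraction replaces the arcs \<open>?S\<close> at \<open>y\<close> by
        the arcs \<open>?N\<close> between \<open>x\<close> and those neighbours of \<open>y\<close>
        that were not yet adjacent to \<open>x\<close>. The loss is two arcs for \<open>xy\<close>
        and two for each common neighbour.\<close>
      let ?Y = "E `` {y} - E `` {x} - {x}"
      let ?S = "{y} \<times> E `` {y} \<union> E `` {y} \<times> {y}" and ?N = "{x} \<times> ?Y \<union> ?Y \<times> {x}"
      let ?E0 = "E - ?S"
      have sub: "?E0 \<union> ?N \<subseteq> parcs H"
      proof
        fix p assume "p \<in> ?E0 \<union> ?N"
        then consider "p \<in> ?E0" | z where "p = (x, z)" "z \<in> ?Y" | z where "p = (z, x)" "z \<in> ?Y" by auto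
        then show "p \<in> parcs H"
        proof cases
          case 1
          then obtain a b where p: "p = (a, b)" "(a, b) \<in> E" by (cases p) auto
          then have "a \<noteq> y" "b \<noteq> y" using 1 G(8) by auto
          moreover have "a \<noteq> b" using p G(9) by auto
          ultimately show ?thesis unfolding EH p(1) using p(2)
            by (intro CollectI exI[of _ a] exI[of _ b]) auto
        next
          case 2
          then have "(y, z) \<in> E" "z \<noteq> y" "z \<noteq> x" using G(9) by auto
          then show ?thesis unfolding EH 2 by (intro CollectI exI[of _ y] exI[of _ z]) auto
        next
          case 3
          then have "(z, y) \<in> E" "z \<noteq> y" "z \<noteq> x" using G(8,9) by auto
          then show ?thesis unfolding EH 3 by (intro CollectI exI[of _ z] exI[of _ y]) auto
        qed
      qed
      have finY: "finite ?Y" using nE by simp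
      have "card ?N = 2 * card ?Y"
        using finY by (subst card_Un_disjoint) (auto simp: card_cartesian_product)
      moreover have "card ?S = 2 * card (E `` {y})"
        using nE G(9) by (subst card_Un_disjoint) (auto simp: card_cartesian_product)
      moreover have "card ?E0 = card E - card ?S"
        using G(8) nE by (intro card_Diff_subset) auto
      moreover have "?E0 \<inter> ?N = {}" using G(8) by auto
      moreover have "card ?Y = card (E `` {y}) - card (E `` {x} \<inter> E `` {y}) - 1"
      proof -
        have "x \<in> E `` {y} - E `` {x}" using xy G(8,9) by auto
        then show ?thesis using nE by (simp add: card_Diff_subset_Int Int_commute)
      qed
      moreover have "card (?E0 \<union> ?N) = card ?E0 + card ?N"
        using G(5) finY calculation(4) by (intro card_Un_disjoint) auto
      moreover have "card (?E0 \<union> ?N) \<le> card (parcs H)"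
        using simple_graphD(5)[OF sH] sub by (rule card_mono)
      moreover have "card (E `` {x} \<inter> E `` {y}) + 1 \<le> card (E `` {y})"
        using card_mono[of "E `` {y}" "insert x (E `` {x} \<inter> E `` {y})"] nE G(8,9) xy by auto
      moreover have "card ?S \<le> card E"
        using G(5,8) by (intro card_mono) auto
      ultimately have big: "card E \<le> card (parcs H) + 2 * card (E `` {x} \<inter> E `` {y}) + 2" by linarith
      have VH1: "card V = Suc (card (pverts H))" using G(1,7) xy VH by (metis card.remove)
      have Hne: "pverts H \<noteq> {}" using VH G(6) xy ne by auto
      have "card (parcs H) < 2 * D * card (pverts H)"
      proof (rule less.hyps[OF _ sH _ Hne])
        have "parcs H \<subseteq> (\<lambda>(a, b). (if a = y then x else a, if b = y then x else b)) ` E" unfolding EH by force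
        then have "card (parcs H) \<le> card E" by (rule surj_card_le[OF G(5)])
        then show "card (pverts H) + card (parcs H) < card V + card E" using VH1 by simp
        show "minor_free t (parcs H) (pverts H)"
          using lift_model_contract[of "\<lparr>pverts = V, parcs = E\<rparr>" x y] less.prems(1,2) xy
          unfolding minor_free_def H_def by fastforce
      qed
      moreover have "2 * D * card V = 2 * D * card (pverts H) + 2 * D" using VH1 by simp
      ultimately show False using big ge a by linarith
    qed
    \<comment> \<open>If all degrees were at least 2D + 1, there would be at least 2D|V| + |V| >=
      2D|V| + 2 arcs, against \<open>upper\<close>.\<close>
    obtain v where v: "v \<in> V" "card (E `` {v}) \<le> 2 * D"
    proof (rule ccontr)
      assume "\<not> thesis"
      then have "2 * D + 1 \<le> card (E `` {v})" if "v \<in> V" for v using that \<open>\<And>v. _ \<Longrightarrow> _ \<Longrightarrow> thesis\<close> by force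
      then have "(\<Sum>v\<in>V. 2 * D + 1) \<le> card E"
        unfolding card_arcs_eq_sum[OF G(1,2)] by (intro sum_mono) auto
      then have "2 * D * card V + card V \<le> card E" by (simp add: algebra_simps)
      moreover have "2 \<le> card V" using card_mono[of V "{x0, y0}"] G(1,6,7,9) e0
        by (metis card_2_iff empty_subsetI insert_subset)
      ultimately show False using upper by linarith
    qed
    show False
    proof (cases "E `` {v} = {}")
      case True
      then have E': "E \<subseteq> (V - {v}) \<times> (V - {v})" using G(2,8) by auto
      have sg: "simple_graph (V - {v}) E" using less.prems(1) E' by (auto simp: simple_graph_def)
      have c1: "card V = Suc (card (V - {v}))" using G(1) v(1) by (metis card.remove)
      have "card E < 2 * D * card (V - {v})"
      proof (rule less.hyps[OF _ sg])
        show "minor_free t E (V - {v})" using less.prems(2) by (rule minor_free_subset) auto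
        show "V - {v} \<noteq> {}" using E' e0 by auto
      qed (use c1 in simp)
      then show False using ge c1 by simp
    next
      case False
      have "\<exists>F. complete_model E (E `` {v}) F \<and> card F = t"
      proof (rule dense_model[OF nE(1) False G(3,4) D v(2) _ c u q])
        fix x assume "x \<in> E `` {v}"
        then show "D \<le> card (E `` {v} \<inter> E `` {x})" using common by auto
      qed
      then show False using less.prems(2) minor_free_subset[OF _ nE(2)] unfolding minor_free_def by metis
    qed
  qed
qed

text \<open>The edge bound is applied to the graph induced on \<open>W\<close>, whose arcs number
  the sum of its degrees.\<close>

lemma minor_free_degenerate:
  assumes "simple_graph V E" "minor_free t E V" "W \<subseteq> V" "W \<noteq> {}" "0 < D"
    and "(3 / 4 :: real) ^ c * (2 * real D) < 1" "16 * u \<le> D" "t * (3 * c) \<le> u + 3 * c"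
  shows "\<exists>v\<in>W. card (W \<inter> E `` {v}) \<le> 2 * D"
proof (rule ccontr)
  assume a: "\<not> ?thesis"
  let ?E = "E \<inter> W \<times> W"
  have fW: "finite W" using assms(1,3) simple_graphD(1) finite_subset by blast
  have sg: "simple_graph W ?E"
    using assms(1) fW by (auto simp: simple_graph_def sym_def irrefl_def)
  have mf: "minor_free t ?E W"
    using minor_free_subset[OF assms(2,3)] complete_model_subrel[of ?E W _ E] unfolding minor_free_def by blast
  have "card W * (2 * D) = (\<Sum>v\<in>W. 2 * D)" by simp
  also have "\<dots> \<le> (\<Sum>v\<in>W. card (?E `` {v}))"
  proof (rule sum_mono)
    fix v assume v: "v \<in> W"
    then have "?E `` {v} = W \<inter> E `` {v}" by auto
    then show "2 * D \<le> card (?E `` {v})" using a v by auto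
  qed
  also have "\<dots> = card ?E" using card_arcs_eq_sum[OF fW, of ?E] by auto
  also have "\<dots> < 2 * D * card W"
    by (rule edge_bound_minor_free[OF sg mf assms(4-)])
  finally show False by (simp add: mult.commute)
qed

section \<open>Almost complete minor-free graphs\<close>

text \<open>Up to half of R = W - K may be used up, whence 6 = 2 * 3: if |R| >= 6c(t - |K|), half of
  R holds t - |K| branch sets of 3c vertices. Fewer than \<delta>|R| non-neighbours are at most a
  fraction 2\<delta> of what remains of R, which is the domination ratio; for two vertices together
  the fraction is at most 4\<delta> < 1, so they have a common connector.\<close>

lemma few_nonneighbours_bound:
  fixes \<delta> :: real
  assumes W: "finite W" "W \<noteq> {}" and E: "sym E" "irrefl E" and K: "K \<subseteq> W" "is_clique E K" "card K \<le> t"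
    and mf: "minor_free t E W" and \<delta>: "0 < \<delta>" "4 * \<delta> < 1"
    and non: "\<And>v. v \<in> W \<Longrightarrow> real (card (W - E `` {v} - {v})) < \<delta> * (real (card W) - real (card K))"
    and c: "(2 * \<delta>) ^ c * real (card W) < 1"
  shows "card W < card K + 6 * c * (t - card K)"
proof (rule ccontr)
  assume a: "\<not> ?thesis"
  define R where "R = W - K"
  define q where "q = t - card K"
  have fin: "finite K" "finite R" using W K finite_subset by (auto simp: R_def)
  have cW: "card W = card K + card R"
    using W(1) K(1) fin by (simp add: R_def card_Diff_subset card_mono)
  have WR: "W - R = K" using K by (auto simp: R_def)
  have x: "real (card W) - real (card K) = real (card R)" using cW by simp
  have Rq: "6 * c * q \<le> card R" using a cW by (simp add: q_def)
  obtain w where "w \<in> W" using W(2) by blast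
  have "0 < \<delta> * real (card R)" using non[OF \<open>w \<in> W\<close>] unfolding x by linarith
  then have R0: "0 < card R" using \<delta> by (simp add: zero_less_mult_iff)
  define u where "u = card R div 2"
  have half: "real (card R) \<le> 2 * real (card (R - U0))" if "U0 \<subseteq> R" "card U0 \<le> u" for U0
  proof -
    have "card (R - U0) = card R - card U0" using that fin finite_subset by (metis card_Diff_subset)
    then have "card R \<le> 2 * card (R - U0)" using that by (simp add: u_def)
    then show ?thesis by linarith
  qed
  have "\<exists>F. complete_model E W F \<and> card F = card (W - R) + q"
  proof (rule robust_model[where \<theta> = "2 * \<delta>" and u = u and c = c])
    show "\<exists>z\<in>R - U0. real (card {x \<in> X. x \<noteq> z \<and> (z, x) \<notin> E}) \<le> 2 * \<delta> * real (card X)"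
      if U0: "U0 \<subseteq> R" "card U0 \<le> u" and X: "X \<subseteq> W" "X \<noteq> {}" for U0 X
    proof (rule averaging)
      show "finite X" using X W finite_subset by blast
      show "finite (R - U0)" using fin by simp
      show "R - U0 \<noteq> {}"
      proof
        assume e: "R - U0 = {}"
        show False using half[OF U0] R0 unfolding e by simp
      qed
      fix x assume "x \<in> X"
      then have "x \<in> W" using X by blast
      have "card {z \<in> R - U0. x \<noteq> z \<and> (z, x) \<notin> E} \<le> card (W - E `` {x} - {x})"
        using W(1) symD[OF E(1)] by (intro card_mono) (auto simp: R_def)
      then have "real (card {z \<in> R - U0. x \<noteq> z \<and> (z, x) \<notin> E}) \<le> \<delta> * real (card R)"
        using non[OF \<open>x \<in> W\<close>] unfolding x by linarith
      also have "\<dots> \<le> \<delta> * (2 * real (card (R - U0)))" using half[OF U0] \<delta> by (intro mult_left_mono) auto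
      finally show "real (card {z \<in> R - U0. x \<noteq> z \<and> (z, x) \<notin> E}) \<le> 2 * \<delta> * real (card (R - U0))" by simp
    qed
    show "\<exists>P\<subseteq>R - U0. finite P \<and> card P \<le> 2 \<and> linked E ({a, b} \<union> P)"
      if U0: "U0 \<subseteq> R" "card U0 \<le> u" and ab: "a \<in> R - U0" "b \<in> R - U0" for U0 a b
    proof -
      let ?N = "\<lambda>v. W - E `` {v} - {v}"
      have ab': "a \<in> W" "b \<in> W" using ab by (auto simp: R_def)
      have "real (card (?N a \<union> ?N b)) \<le> real (card (?N a)) + real (card (?N b))"
        by (metis card_Un_le of_nat_add of_nat_le_iff)
      also have "\<dots> < 2 * \<delta> * real (card R)" using non[OF ab'(1)] non[OF ab'(2)] unfolding x by simp
      also have "\<dots> \<le> 2 * \<delta> * (2 * real (card (R - U0)))" using half[OF U0] \<delta> by (intro mult_left_mono) auto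
      also have "\<dots> = 4 * \<delta> * real (card (R - U0))" by simp
      also have "\<dots> \<le> 1 * real (card (R - U0))" using \<delta> by (intro mult_right_mono) auto
      finally have "\<not> R - U0 \<subseteq> ?N a \<union> ?N b"
        using card_mono[of "?N a \<union> ?N b" "R - U0"] W(1) by force
      then obtain z where z: "z \<in> R - U0" "z = a \<or> (a, z) \<in> E" "z = b \<or> (b, z) \<in> E"
        by (auto simp: R_def)
      then have "linked E ({a, b} \<union> {z})" using E(1) by (intro linked_common_neighbour) auto
      then show ?thesis using z(1) by (intro exI[of _ "{z}"]) auto
    qed
    show "q * (3 * c) \<le> u + 3 * c" using Rq by (simp add: u_def mult.commute)
  qed (use W E K \<delta> c WR in \<open>auto simp: R_def\<close>)
  then obtain F where "complete_model E W F" "card F = t" using WR K(3) by (auto simp: q_def)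
  then show False using mf unfolding minor_free_def by blast
qed

lemma sparse_complement_bound:
  assumes W: "finite W" and E: "sym E" "irrefl E" and K: "K \<subseteq> W" "is_clique E K" "card K < t"
    and mf: "minor_free t E W"
    and non: "\<And>v. v \<in> W \<Longrightarrow> card (W - E `` {v} - {v}) \<le> d"
    and L: "card W * d ^ 2 + l * (d + 1) < l ^ 2"
  shows "card W < card K + 2 * (t - card K) + l"
proof (rule ccontr)
  assume a: "\<not> ?thesis"
  define R where "R = W - K"
  define q where "q = t - card K"
  have fin: "finite K" "finite R" using W K finite_subset by (auto simp: R_def)
  have cW: "card W = card K + card R"
    using W(1) K(1) fin by (simp add: R_def card_Diff_subset card_mono)
  have q: "0 < q" "2 * q + l \<le> card R" using a K(3) cW by (auto simp: q_def)
  let ?N = "\<lambda>v. W - E `` {v} - {v}"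
  have fam: "\<exists>B\<subseteq>R - U0. (linked E B \<and> dominates E B W) \<and> card B \<le> 2 \<and> B \<noteq> {}"
    if U0: "U0 \<subseteq> R" "card U0 \<le> 2 * q - 2" for U0
  proof -
    have "card (R - U0) = card R - card U0" using that fin finite_subset by (metis card_Diff_subset)
    then have "l \<le> card (R - U0)" using that q by linarith
    then obtain Z where Z: "Z \<subseteq> R - U0" "card Z = l" "finite Z"
      using obtain_subset_with_card_n by metis
    have ZW: "Z \<subseteq> W" using Z by (auto simp: R_def)
    let ?bad = "(SIGMA a:Z. insert a (?N a)) \<union> (\<Union>y\<in>W. ?N y \<times> ?N y)"
    have "card ?bad \<le> card (SIGMA a:Z. insert a (?N a)) + card (\<Union>y\<in>W. ?N y \<times> ?N y)" by (rule card_Un_le)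
    also have "card (SIGMA a:Z. insert a (?N a)) = (\<Sum>a\<in>Z. card (insert a (?N a)))"
      using Z W by (intro card_SigmaI) auto
    also have "\<dots> \<le> (\<Sum>a\<in>Z. d + 1)"
    proof (rule sum_mono)
      fix a assume "a \<in> Z"
      have "card (insert a (?N a)) = Suc (card (?N a))"
        by (rule card_insert_disjoint) (use W in auto)
      then show "card (insert a (?N a)) \<le> d + 1" using non[of a] \<open>a \<in> Z\<close> ZW by auto
    qed
    also have "\<dots> = l * (d + 1)" using Z by simp
    also have "card (\<Union>y\<in>W. ?N y \<times> ?N y) \<le> (\<Sum>y\<in>W. card (?N y \<times> ?N y))" by (rule card_UN_le[OF W])
    also have "\<dots> \<le> (\<Sum>y\<in>W. d * d)"
      using non by (intro sum_mono) (auto simp: card_cartesian_product intro!: mult_le_mono)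
    also have "\<dots> = card W * d ^ 2" by (simp add: power2_eq_square)
    finally have "card ?bad < card (Z \<times> Z)" using L Z by (simp add: card_cartesian_product power2_eq_square)
    moreover have "finite ?bad" using Z W by auto
    ultimately have "\<not> Z \<times> Z \<subseteq> ?bad" using card_mono[of ?bad "Z \<times> Z"] by linarith
    then obtain a b where ab: "a \<in> Z" "b \<in> Z" "(a, b) \<notin> ?bad" by auto
    have adj: "a \<noteq> b" "(a, b) \<in> E" using ab ZW by auto
    have nb: "\<not> (a \<in> ?N y \<and> b \<in> ?N y)" if "y \<in> W" for y using ab(3) that by blast
    have "dominates E {a, b} W"
      unfolding dominates_def
    proof
      fix y assume y: "y \<in> W"
      then have "a = y \<or> (y, a) \<in> E \<or> b = y \<or> (y, b) \<in> E" using nb[OF y] ab ZW by auto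
      then show "y \<in> {a, b} \<or> (\<exists>b\<in>{a, b}. (b, y) \<in> E)" using symD[OF E(1)] by auto
    qed
    moreover have "linked E {a, b}"
      using linked_insert[OF linked_singleton[of E a] E(1) _ adj(2)] by (simp add: insert_commute)
    moreover have "{a, b} \<subseteq> R - U0" "card {a, b} \<le> 2" using ab Z by (auto simp: card_insert_if)
    ultimately show ?thesis by blast
  qed
  have "\<exists>F. card F = q \<and> finite F \<and> (\<forall>B\<in>F. (linked E B \<and> dominates E B W) \<and> B \<subseteq> R) \<and>
     (\<forall>B\<in>F. \<forall>C\<in>F. B \<noteq> C \<longrightarrow> B \<inter> C = {}) \<and> card (\<Union>F) \<le> q * 2"
    by (rule disjoint_family_exists[where u = "2 * q - 2", OF fin(2) _]) (use fam q in auto)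
  then obtain F where F: "card F = q" "finite F" "\<forall>B\<in>F. (linked E B \<and> dominates E B W) \<and> B \<subseteq> R"
    "\<forall>B\<in>F. \<forall>C\<in>F. B \<noteq> C \<longrightarrow> B \<inter> C = {}" by (elim exE conjE) (rule that)
  have "\<exists>F'. complete_model E W F' \<and> card F' = card K + card F"
    by (rule complete_model_dominating[OF W E(1) K(1,2) F(2)]) (use F in \<open>auto simp: R_def\<close>)
  then show False using mf F(1) K(3) unfolding minor_free_def q_def by auto
qed

section \<open>Zykov's theorem\<close>

definition balanced_part :: "nat \<Rightarrow> nat \<Rightarrow> nat \<Rightarrow> nat" where
  "balanced_part N w i = (if i < N mod w then N div w + 1 else N div w)"

text \<open>The clique polynomial of T(N, w): its coefficient at k is the elementary symmetric
  function of degree k in the part sizes, the number of k-cliques.\<close>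

definition turan_poly :: "nat \<Rightarrow> nat \<Rightarrow> nat poly" where
  "turan_poly N w = (\<Prod>i<w. [:1, balanced_part N w i:])"

text \<open>Comparing all clique orders at once makes the order compatible with products, that is,
  with joins of graphs.\<close>

definition coeff_le :: "nat poly \<Rightarrow> nat poly \<Rightarrow> bool" where
  "coeff_le p q \<longleftrightarrow> (\<forall>k. coeff p k \<le> coeff q k)"

lemma coeff_le_refl [simp]: "coeff_le p p" by (simp add: coeff_le_def)

lemma coeff_le_trans: "coeff_le p q \<Longrightarrow> coeff_le q r \<Longrightarrow> coeff_le p r"
  unfolding coeff_le_def using le_trans by blast

lemma coeff_le_mult: "coeff_le p q \<Longrightarrow> coeff_le p' q' \<Longrightarrow> coeff_le (p * p') (q * q')"
  unfolding coeff_le_def coeff_mult by (auto intro!: sum_mono mult_le_mono)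

lemma coeff_le_prod:
  "finite I \<Longrightarrow> (\<And>i. i \<in> I \<Longrightarrow> coeff_le (f i) (g i)) \<Longrightarrow> coeff_le (\<Prod>i\<in>I. f i) (\<Prod>i\<in>I. g i)"
  by (induction I rule: finite_induct) (auto intro!: coeff_le_mult)

lemma coeff_linear_times_Suc: "coeff ([:1, a:] * p) (Suc k) = coeff p (Suc k) + (a::nat) * coeff p k"
  by simp

lemma coeff_linear_times_0: "coeff ([:1, a::nat:] * p) 0 = coeff p 0"
  by simp

lemma sum_balanced_part:
  assumes "0 < w" shows "(\<Sum>i<w. balanced_part N w i) = N"
proof -
  have "(\<Sum>i<w. balanced_part N w i) = (\<Sum>i<w. N div w + (if i < N mod w then 1 else 0))"
    by (rule sum.cong) (auto simp: balanced_part_def)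
  also have "\<dots> = w * (N div w) + card {i. i < w \<and> i < N mod w}"
    by (simp add: sum.distrib sum.If_cases Int_def)
  also have "{i. i < w \<and> i < N mod w} = {..<N mod w}"
    using assms mod_less_divisor[OF assms, of N] by auto
  finally show ?thesis by simp
qed

lemma prod_if_power:
  assumes "finite I" "A \<subseteq> I"
  shows "(\<Prod>i\<in>I. if i \<in> A then x else y) = x ^ card A * (y :: 'b :: comm_monoid_mult) ^ (card I - card A)"
proof -
  have "I \<inter> {i. i \<in> A} = A" "I \<inter> - {i. i \<in> A} = I - A" using assms by auto
  then show ?thesis using assms finite_subset[OF assms(2,1)]
    by (simp add: prod.If_cases card_Diff_subset)
qed

text \<open>Sizes that differ by at most 1 are determined by their sum and number: with minimum m
  and \<open>A\<close> the parts of size m + 1, the sum is w m + |A|. As the minimum is attained,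
  |A| < w, so quotient and remainder are m and |A|.\<close>

lemma prod_balanced_eq:
  fixes p :: "'i \<Rightarrow> nat"
  assumes "finite I" "\<And>i j. i \<in> I \<Longrightarrow> j \<in> I \<Longrightarrow> p i \<le> p j + 1"
  shows "(\<Prod>i\<in>I. [:1, p i:]) = turan_poly (\<Sum>i\<in>I. p i) (card I)"
proof (cases "I = {}")
  case True
  then show ?thesis by (simp add: turan_poly_def)
next
  case False
  define m where "m = Min (p ` I)"
  define A where "A = {i \<in> I. p i = m + 1}"
  define w where "w = card I"
  obtain i0 where i0: "i0 \<in> I" "p i0 = m"
  proof -
    have "Min (p ` I) \<in> p ` I" using False assms(1) by (intro Min_in) auto
    then show ?thesis using that by (auto simp: m_def)
  qed
  have p: "p i = (if i \<in> A then m + 1 else m)" if "i \<in> I" for i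
  proof -
    have "m \<le> p i" using that assms(1) by (simp add: m_def)
    moreover have "p i \<le> m + 1" using assms(2)[OF that i0(1)] i0(2) by simp
    ultimately show ?thesis using that by (auto simp: A_def)
  qed
  have "i0 \<notin> A" using i0 by (simp add: A_def)
  moreover have "A \<subseteq> I" by (auto simp: A_def)
  ultimately have AI: "A \<subseteq> I" "A \<subset> I" using i0(1) by blast+
  have fA: "finite A" using AI(1) assms(1) finite_subset by blast
  have cA: "card A < w" unfolding w_def using AI(2) assms(1) by (rule psubset_card_mono[rotated])
  have "(\<Sum>i\<in>I. p i) = (\<Sum>i\<in>I. m + (if i \<in> A then 1 else 0))" by (rule sum.cong) (auto simp: p)
  also have "\<dots> = w * m + card A" using assms(1) Int_absorb1[OF AI(1)]
    by (simp add: sum.distrib sum.If_cases w_def Int_commute)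
  finally have S: "(\<Sum>i\<in>I. p i) = w * m + card A" .
  have dm: "(w * m + card A) div w = m" "(w * m + card A) mod w = card A" using cA by auto
  have "(\<Prod>i\<in>I. [:1, p i:]) = (\<Prod>i\<in>I. if i \<in> A then [:1, m + 1:] else [:1, m:])"
    by (rule prod.cong) (auto simp: p)
  also have "\<dots> = [:1, m + 1:] ^ card A * [:1, m:] ^ (w - card A)"
    unfolding w_def by (rule prod_if_power[OF assms(1) AI(1)])
  also have "\<dots> = (\<Prod>i<w. if i \<in> {..<card A} then [:1, m + 1:] else [:1, m:])"
    using cA by (subst prod_if_power) auto
  also have "\<dots> = turan_poly (w * m + card A) w"
    unfolding turan_poly_def balanced_part_def dm by (rule prod.cong) auto
  finally show ?thesis unfolding S w_def .
qed

text \<open>Moving a unit from a part to one smaller by at least 2 keeps the sum of the two sizes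
  and raises their product, so no coefficient decreases. The sum of squares falls, so the process
  ends with balanced parts.\<close>

lemma prod_le_turan_poly:
  fixes p :: "'i \<Rightarrow> nat"
  assumes "finite I"
  shows "coeff_le (\<Prod>i\<in>I. [:1, p i:]) (turan_poly (\<Sum>i\<in>I. p i) (card I))"
proof (induction "\<Sum>i\<in>I. p i ^ 2" arbitrary: p rule: less_induct)
  case less
  show ?case
  proof (cases "\<forall>i\<in>I. \<forall>j\<in>I. p i \<le> p j + 1")
    case True
    then show ?thesis using prod_balanced_eq[OF assms, of p] by simp
  next
    case False
    then obtain i j where ij: "i \<in> I" "j \<in> I" "p j + 2 \<le> p i" by force
    then have "i \<noteq> j" by auto
    define r where "r = (p(i := p i - 1))(j := p j + 1)"
    have r: "r i = p i - 1" "r j = p j + 1" "\<And>l. l \<noteq> i \<Longrightarrow> l \<noteq> j \<Longrightarrow> r l = p l"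
      using \<open>i \<noteq> j\<close> by (auto simp: r_def)
    let ?J = "I - {i} - {j}"
    have split: "(\<Sum>l\<in>I. f l) = f i + (f j + (\<Sum>l\<in>?J. f l))" for f :: "'i \<Rightarrow> nat"
      using assms ij \<open>i \<noteq> j\<close> by (simp add: sum.remove[of I i] sum.remove[of "I - {i}" j])
    have psplit: "(\<Prod>l\<in>I. f l) = (f i * f j) * (\<Prod>l\<in>?J. f l)" for f :: "'i \<Rightarrow> nat poly"
      using assms ij \<open>i \<noteq> j\<close> by (simp add: prod.remove[of I i] prod.remove[of "I - {i}" j] mult.assoc)
    have J: "(\<Sum>l\<in>?J. r l) = (\<Sum>l\<in>?J. p l)" "(\<Sum>l\<in>?J. r l ^ 2) = (\<Sum>l\<in>?J. p l ^ 2)"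
      "(\<Prod>l\<in>?J. [:1, r l:]) = (\<Prod>l\<in>?J. [:1, p l:])"
      by (auto intro!: sum.cong prod.cong simp: r(3))
    obtain d where d: "p i = p j + 2 + d" using ij(3) le_Suc_ex by blast
    have sum: "(\<Sum>l\<in>I. r l) = (\<Sum>l\<in>I. p l)" unfolding split J r(1,2) using d by simp
    have "(\<Sum>l\<in>I. r l ^ 2) < (\<Sum>l\<in>I. p l ^ 2)" unfolding split J r(1,2) d
      by (simp add: power2_eq_square algebra_simps)
    then have IH: "coeff_le (\<Prod>i\<in>I. [:1, r i:]) (turan_poly (\<Sum>i\<in>I. p i) (card I))"
      using less[of r] sum by simp
    have "coeff_le ([:1, p i:] * [:1, p j:]) ([:1, r i:] * [:1, r j:])"
      unfolding r(1,2) d by (auto simp: coeff_le_def coeff_pCons algebra_simps split: nat.splits)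
    then have "coeff_le (\<Prod>i\<in>I. [:1, p i:]) (\<Prod>i\<in>I. [:1, r i:])"
      unfolding psplit J by (rule coeff_le_mult) simp
    then show ?thesis using IH coeff_le_trans by blast
  qed
qed

lemma coeff_turan_poly_0: "coeff (turan_poly N w) 0 = 1"
proof -
  have "poly (turan_poly N w) 0 = 1" by (simp add: turan_poly_def poly_prod)
  then show ?thesis by (simp add: poly_0_coeff_0)
qed

lemma clique_count_remove:
  assumes "finite U" "sym E" "irrefl E" "X \<subseteq> U"
    and "\<And>x. x \<in> X \<Longrightarrow> clique_count E (U \<inter> E `` {x}) j \<le> M"
  shows "clique_count E U (Suc j) \<le> clique_count E (U - X) (Suc j) + card X * M"
proof -
  have "finite X" using assms finite_subset by blast
  then show ?thesis using assms(4,5)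
  proof (induction X rule: finite_induct)
    case (insert x X)
    let ?V = "U - X"
    have V: "?V - {x} = U - insert x X" by blast
    have "clique_count E ?V (Suc j) = clique_count E (?V - {x}) (Suc j) + clique_count E (?V \<inter> E `` {x}) j"
      by (rule clique_count_Suc) (use insert assms in auto)
    moreover have "clique_count E (?V \<inter> E `` {x}) j \<le> clique_count E (U \<inter> E `` {x}) j"
      by (rule clique_count_mono) (use assms in auto)
    moreover have "clique_count E (U \<inter> E `` {x}) j \<le> M" using insert by simp
    moreover have "clique_count E U (Suc j) \<le> clique_count E ?V (Suc j) + card X * M"
      using insert by simp
    moreover have "card (insert x X) * M = M + card X * M" using insert by simp
    ultimately show ?case unfolding V by linarith
  qed simp
qed

text \<open>
  A \<open>k\<close>-clique not inside the neighbourhood of \<open>v\<close> meets its complement, where no vertex is in more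
  \<open>k\<close>-cliques than \<open>v\<close>. This needs one bound that is extremal for \<open>k\<close> and \<open>k - 1\<close> simultaneously,
  which balanced part sizes provide.
\<close>
theorem clique_count_le_turan_poly:
  assumes "finite U" "sym E" "irrefl E" "\<And>S. S \<subseteq> U \<Longrightarrow> is_clique E S \<Longrightarrow> card S \<le> w"
  shows "clique_count E U k \<le> coeff (turan_poly (card U) w) k"
  using assms(1,4)
proof (induction w arbitrary: U k)
  case 0
  have "U = {}"
  proof (rule ccontr)
    assume "U \<noteq> {}"
    then obtain x where "x \<in> U" by blast
    then show False using 0(2)[of "{x}"] by (simp add: is_clique_def)
  qed
  then show ?case using clique_count_le_choose[of "{}" E k] by (cases k) (auto simp: turan_poly_def)
next
  case (Suc w)
  show ?case
  proof (cases k)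
    case 0
    then show ?thesis using Suc.prems by (simp add: coeff_turan_poly_0)
  next
    case (Suc j)
    show ?thesis
    proof (cases "U = {}")
      case True
      then show ?thesis using clique_count_le_choose[of "{}" E k] Suc by simp
    next
      case False
      let ?f = "\<lambda>v. clique_count E (U \<inter> E `` {v}) j"
      have "Max (?f ` U) \<in> ?f ` U" using False Suc.prems(1) by (intro Max_in) auto
      then obtain v where v: "v \<in> U" "Max (?f ` U) = ?f v" by auto
      have vmax: "?f x \<le> ?f v" if "x \<in> U" for x
        using Max_ge[of "?f ` U" "?f x"] that v(2) Suc.prems(1) by simp
      define A where "A = U \<inter> E `` {v}"
      have fA: "finite A" using Suc.prems(1) by (simp add: A_def)
      have A: "card S \<le> w" if S: "S \<subseteq> A" "is_clique E S" for S
      proof -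
        have "is_clique E (insert v S)"
          using S symD[OF assms(2)] by (auto simp: is_clique_def A_def)
        then have "card (insert v S) \<le> Suc w" using Suc.prems(2)[of "insert v S"] S(1) v(1) by (auto simp: A_def)
        moreover have "v \<notin> S" using S(1) assms(3) by (auto simp: A_def irrefl_def)
        ultimately show ?thesis using S(1) fA finite_subset[of S A] by simp
      qed
      have "clique_count E U (Suc j) \<le> clique_count E (U - (U - A)) (Suc j) + card (U - A) * ?f v"
        by (rule clique_count_remove) (use Suc.prems assms vmax in auto)
      also have "U - (U - A) = A" by (auto simp: A_def)
      also have "clique_count E A (Suc j) + card (U - A) * ?f v \<le>
          coeff (turan_poly (card A) w) (Suc j) + card (U - A) * coeff (turan_poly (card A) w) j"
        using Suc.IH[OF fA A, of "Suc j"] Suc.IH[OF fA A, of j] unfolding A_def[symmetric]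
        by (intro add_mono mult_le_mono) auto
      also have "\<dots> = coeff ([:1, card (U - A):] * turan_poly (card A) w) (Suc j)"
        by (simp only: coeff_linear_times_Suc)
      also have "\<dots> \<le> coeff (turan_poly (card U) (Suc w)) (Suc j)"
      proof -
        \<comment> \<open>The non-neighbours of \<open>v\<close> act as one more part beside the
          \<open>w\<close> balanced parts of \<open>A\<close>; the total is |U|, and rebalancing
          only raises the coefficients.\<close>
        define p where "p i = (if i < w then balanced_part (card A) w i else card (U - A))" for i
        have "(\<Prod>i<Suc w. [:1, p i:]) = [:1, card (U - A):] * turan_poly (card A) w"
          unfolding prod.lessThan_Suc turan_poly_def by (simp add: p_def mult.commute)
        moreover have "(\<Sum>i<Suc w. p i) = card U"
        proof -
          have "(\<Sum>i<w. p i) = card A"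
          proof (cases "w = 0")
            case True
            then have "A = {}" using A[of "{x}" for x] by (auto simp: is_clique_def)
            then show ?thesis using True by simp
          next
            case False
            then show ?thesis using sum_balanced_part[of w "card A"] by (simp add: p_def)
          qed
          moreover have "card U = card A + card (U - A)"
            unfolding A_def using Suc.prems(1) by (metis card_Int_Diff Diff_Int_distrib2 Diff_Int Diff_cancel Un_empty_left)
          ultimately show ?thesis by (simp add: p_def)
        qed
        ultimately show ?thesis using prod_le_turan_poly[of "{..<Suc w}" p]
          by (simp only: coeff_le_def finite_lessThan card_lessThan)
      qed
      finally show ?thesis using Suc by simp
    qed
  qed
qed

text \<open>The surplus N' - N is put into the first part, and the sizes are then
  rebalanced.\<close>

lemma turan_poly_mono:
  assumes "0 < w" "N \<le> N'"
  shows "coeff_le (turan_poly N w) (turan_poly N' w)"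
proof -
  define p where "p i = balanced_part N w i + (if i = 0 then N' - N else 0)" for i
  have "coeff_le (turan_poly N w) (\<Prod>i<w. [:1, p i:])"
    unfolding turan_poly_def
    by (rule coeff_le_prod) (auto simp: p_def coeff_le_def coeff_pCons split: nat.splits)
  moreover have "(\<Sum>i<w. p i) = N'"
    using assms by (simp add: p_def sum.distrib sum_balanced_part)
  ultimately show ?thesis
    using prod_le_turan_poly[of "{..<w}" p] coeff_le_trans by (metis card_lessThan finite_lessThan)
qed

text \<open>Double counting in a complete multipartite graph with w nonempty parts: a k-clique
  misses w - k parts and extends into each of them, and a (k+1)-clique arises in this way at most k
  + 1 times. The term with \<open>k\<close> stands on the right to avoid subtraction.\<close>

lemma coeff_prod_linear_step:
  fixes p :: "'i \<Rightarrow> nat"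
  assumes "finite I" "\<And>i. i \<in> I \<Longrightarrow> 1 \<le> p i"
  shows "card I * coeff (\<Prod>i\<in>I. [:1, p i:]) k \<le>
     k * coeff (\<Prod>i\<in>I. [:1, p i:]) k + Suc k * coeff (\<Prod>i\<in>I. [:1, p i:]) (Suc k)"
  using assms
proof (induction I arbitrary: k rule: finite_induct)
  case (insert x I)
  define P where "P = (\<Prod>i\<in>I. [:1, p i:])"
  have IH: "card I * coeff P k \<le> k * coeff P k + Suc k * coeff P (Suc k)" for k
    using insert by (simp add: P_def)
  have px: "1 \<le> p x" using insert by simp
  have P: "(\<Prod>i\<in>insert x I. [:1, p i:]) = [:1, p x:] * P" using insert by (simp add: P_def)
  have c: "card (insert x I) = Suc (card I)" using insert by simp
  show ?case
  proof (cases k)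
    case 0
    have "card I * coeff P 0 \<le> coeff P (Suc 0)" using IH[of 0] by simp
    moreover have "coeff P 0 \<le> p x * coeff P 0" using px by simp
    ultimately have "card I * coeff P 0 + coeff P 0 \<le> coeff P (Suc 0) + p x * coeff P 0" by (rule add_mono)
    then show ?thesis unfolding P c 0 coeff_linear_times_Suc coeff_linear_times_0
      by (simp add: add.commute)
  next
    case (Suc j)
    define a b d n where "a = p x * coeff P j" and "b = coeff P (Suc j)"
      and "d = coeff P (Suc (Suc j))" and "n = card I"
    have "p x * (card I * coeff P j) \<le> p x * (j * coeff P j + Suc j * coeff P (Suc j))"
      using IH[of j] by (rule mult_le_mono2)
    then have 1: "n * a \<le> j * a + j * (p x * b) + p x * b"
      by (simp add: a_def b_def n_def algebra_simps)
    have 2: "b \<le> p x * b" using px by simp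
    have 3: "n * b \<le> j * b + b + (j * d + 2 * d)"
      using IH[of "Suc j"] by (simp add: b_def d_def n_def algebra_simps)
    have "Suc n * (b + a) = n * b + n * a + b + a" by (simp add: algebra_simps)
    moreover have "Suc j * (b + a) + Suc (Suc j) * (d + p x * b) =
        j * b + b + j * a + a + (j * d + 2 * d) + j * (p x * b) + 2 * (p x * b)"
      by (simp add: algebra_simps)
    moreover have "nb + na + b + a \<le> jb + b + ja + a + (jd + 2 * d) + jpb + 2 * pb"
      if "na \<le> ja + jpb + pb" "b \<le> pb" "nb \<le> jb + b + (jd + 2 * d)"
      for na nb ja jb jd jpb pb a b d :: nat using that by linarith
    ultimately have "Suc n * (b + a) \<le> Suc j * (b + a) + Suc (Suc j) * (d + p x * b)"
      using 1 2 3 by presburger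
    then show ?thesis unfolding P c Suc coeff_linear_times_Suc a_def b_def d_def n_def .
  qed
qed simp

text \<open>Passing from order i to i + 1 <= w costs a factor of at most i + 1 <= t. This compares
  the smaller cliques left over after peeling with those of order \<open>k\<close>.\<close>

lemma coeff_turan_poly_le_power:
  assumes "i \<le> k" "k \<le> w" "w \<le> N" "k \<le> t"
  shows "coeff (turan_poly N w) i \<le> t ^ (k - i) * coeff (turan_poly N w) k"
  using assms(1)
proof (induction "k - i" arbitrary: i)
  case (Suc d)
  have "0 < w" using Suc assms by linarith
  then have pos: "1 \<le> balanced_part N w i" for i
    using assms(3) div_le_mono[of w N w] by (auto simp: balanced_part_def)
  let ?c = "coeff (turan_poly N w)"
  have "w * ?c i \<le> i * ?c i + Suc i * ?c (Suc i)"
    using coeff_prod_linear_step[of "{..<w}" "balanced_part N w" i] pos by (simp add: turan_poly_def)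
  moreover have "(i + 1) * ?c i \<le> w * ?c i" using Suc assms by (intro mult_le_mono1) auto
  ultimately have "?c i \<le> Suc i * ?c (Suc i)" by (simp add: algebra_simps)
  also have "\<dots> \<le> t * ?c (Suc i)" using Suc assms by (intro mult_le_mono1) auto
  also have "?c (Suc i) \<le> t ^ (k - Suc i) * ?c k" using Suc by simp
  then have "t * ?c (Suc i) \<le> t ^ (k - i) * ?c k"
    using Suc(2) mult_le_mono2[of "?c (Suc i)" "t ^ (k - Suc i) * ?c k" t]
    by (simp add: Suc_diff_Suc[symmetric] mult.assoc)
  finally show ?case .
qed simp

section \<open>Clique numbers of complete multipartite graphs\<close>

lemma clique_count_independent_join:
  assumes "finite A" "finite U" "sym E" "irrefl E" "A \<inter> U = {}"
    and "\<And>x. x \<in> A \<Longrightarrow> (A \<union> U) \<inter> E `` {x} = U"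
  shows "clique_count E (A \<union> U) (Suc j) = clique_count E U (Suc j) + card A * clique_count E U j"
  using assms(1,5,6)
proof (induction A rule: finite_induct)
  case (insert x A)
  have "clique_count E (insert x A \<union> U) (Suc j) =
      clique_count E (insert x A \<union> U - {x}) (Suc j) + clique_count E ((insert x A \<union> U) \<inter> E `` {x}) j"
    by (rule clique_count_Suc) (use insert assms in auto)
  also have "insert x A \<union> U - {x} = A \<union> U" using insert by auto
  also have "(insert x A \<union> U) \<inter> E `` {x} = U" using insert by simp
  also have "clique_count E (A \<union> U) (Suc j) = clique_count E U (Suc j) + card A * clique_count E U j"
  proof (rule insert.IH)
    show "(A \<union> U) \<inter> E `` {y} = U" if "y \<in> A" for y
      using insert.prems(2)[of y] that insert.hyps(2) insert.prems(1) by auto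
  qed (use insert in auto)
  finally show ?case using insert by simp
qed simp

lemma clique_count_multipartite:
  assumes "finite P" "\<And>A. A \<in> P \<Longrightarrow> finite A" "sym E" "irrefl E"
    and "\<And>A B. A \<in> P \<Longrightarrow> B \<in> P \<Longrightarrow> A \<noteq> B \<Longrightarrow> A \<inter> B = {}"
    and "\<And>u v. u \<in> \<Union>P \<Longrightarrow> v \<in> \<Union>P \<Longrightarrow> (u, v) \<in> E \<longleftrightarrow> \<not> (\<exists>A\<in>P. u \<in> A \<and> v \<in> A)"
  shows "clique_count E (\<Union>P) k = coeff (\<Prod>A\<in>P. [:1, card A:]) k"
  using assms(1,2,5,6)
proof (induction P arbitrary: k rule: finite_induct)
  case empty
  then show ?case using clique_count_le_choose[of "{}" E k] by (cases k) auto
next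
  case (insert A P)
  have disj: "A \<inter> \<Union>P = {}" using insert.prems(2)[of A] insert.hyps(2) by auto
  have IH: "clique_count E (\<Union>P) k = coeff (\<Prod>A\<in>P. [:1, card A:]) k" for k
  proof (rule insert.IH)
    show "(u, v) \<in> E \<longleftrightarrow> \<not> (\<exists>A\<in>P. u \<in> A \<and> v \<in> A)" if "u \<in> \<Union>P" "v \<in> \<Union>P" for u v
      using insert.prems(3)[of u v] that disj by auto
  qed (use insert.prems in auto)
  have P: "(\<Prod>A\<in>insert A P. [:1, card A:]) = [:1, card A:] * (\<Prod>A\<in>P. [:1, card A:])"
    using insert by simp
  show ?case
  proof (cases k)
    case 0
    have "finite (\<Union>(insert A P))" using insert by auto
    then show ?thesis using IH[of 0] insert.hyps(1) insert.prems(1) unfolding P 0 coeff_linear_times_0 by simp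
  next
    case (Suc j)
    have "clique_count E (A \<union> \<Union>P) (Suc j) = clique_count E (\<Union>P) (Suc j) + card A * clique_count E (\<Union>P) j"
    proof (rule clique_count_independent_join[OF _ _ assms(3,4) disj])
      fix x assume x: "x \<in> A"
      have "(x, y) \<notin> E" if "y \<in> A" for y using insert.prems(3)[of x y] that x by auto
      moreover have "(x, y) \<in> E" if "y \<in> \<Union>P" for y using insert.prems(3)[of x y] that x disj by auto
      ultimately show "(A \<union> \<Union>P) \<inter> E `` {x} = \<Union>P" by blast
    qed (use insert in auto)
    then show ?thesis unfolding P Suc coeff_linear_times_Suc IH by simp
  qed
qed

lemma num_cliques_turan_graph:
  assumes "turan_graph N w G" "1 \<le> w"
  shows "num_cliques k G = coeff (turan_poly N w) k"
proof -
  obtain P where P: "partition_on (pverts G) P" "card P = w"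
    "\<forall>A\<in>P. int (card A) = \<lfloor>real N / real w\<rfloor> \<or> int (card A) = \<lceil>real N / real w\<rceil>"
    "parcs G = {(u, v). u \<in> pverts G \<and> v \<in> pverts G \<and> \<not> (\<exists>A\<in>P. u \<in> A \<and> v \<in> A)}"
    and G: "simple_graph (pverts G) (parcs G)" "card (pverts G) = N"
    using assms(1) unfolding turan_graph_def pair_graph_iff by blast
  note GD = simple_graphD[OF G(1)]
  have U: "pverts G = \<Union>P" and dis: "\<And>A B. A \<in> P \<Longrightarrow> B \<in> P \<Longrightarrow> A \<noteq> B \<Longrightarrow> A \<inter> B = {}"
    using P(1) by (auto simp: partition_on_def disjoint_def)
  have fP: "finite P" using assms(2) P(2) by (metis card.infinite not_one_le_zero)
  have fA: "finite A" if "A \<in> P" for A using that GD(1) unfolding U by (meson Sup_upper finite_subset)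
  have "num_cliques k G = coeff (\<Prod>A\<in>P. [:1, card A:]) k"
    unfolding num_cliques_eq U
    by (rule clique_count_multipartite[OF fP fA GD(3,4) dis]) (use P(4) U in auto)
  also have "(\<Prod>A\<in>P. [:1, card A:]) = turan_poly (\<Sum>A\<in>P. card A) (card P)"
  proof (rule prod_balanced_eq[OF fP])
    fix A B assume "A \<in> P" "B \<in> P"
    then have "int (card A) \<le> \<lceil>real N / real w\<rceil>" "\<lfloor>real N / real w\<rfloor> \<le> int (card B)"
      using P(3) floor_le_ceiling[of "real N / real w"] by fastforce+
    then show "card A \<le> card B + 1" using ceiling_diff_floor_le_1[of "real N / real w"] by linarith
  qed
  also have "(\<Sum>A\<in>P. card A) = N"
    using card_Union_disjoint[of P] dis fA U G(2) by (auto simp: pairwise_def disjnt_def)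
  finally show ?thesis using P(2) by simp
qed

lemma turan_star_ge:
  assumes "turan_star t k T" "1 \<le> k" "k \<le> w" "w < t"
  shows "coeff (turan_poly (2 * t - w - 1) w) k \<le> num_cliques k T"
proof -
  have "1 \<le> w" "w \<le> 2 * t - w - 1" using assms by auto
  then obtain T' :: "nat pair_pre_digraph" where T': "turan_graph (2 * t - w - 1) w T'"
    using turan_graph_exists by metis
  have "w \<in> {k..t - 1}" using assms by auto
  then have "num_cliques k T' \<le> num_cliques k T" using assms(1) T' unfolding turan_star_def by blast
  then show ?thesis using num_cliques_turan_graph[OF T' \<open>1 \<le> w\<close>] by simp
qed

section \<open>Disjoint Turan graphs\<close>

lemma minor_free_of_small_cliques:
  assumes U: "finite U" and E: "sym E" and w: "\<And>S. S \<subseteq> U \<Longrightarrow> is_clique E S \<Longrightarrow> card S \<le> w"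
    and less: "card U + w < 2 * t"
  shows "minor_free t E U"
  unfolding minor_free_def
proof
  assume "\<exists>F. complete_model E U F \<and> card F = t"
  then obtain F where F: "complete_model E U F" "card F = t" by blast
  have B: "B \<subseteq> U" "B \<noteq> {}" "finite B" if "B \<in> F" for B
    using F(1) that U finite_subset[of B U] by (auto simp: complete_model_def linked_def)
  have dis: "B \<inter> C = {}" "\<exists>b\<in>B. \<exists>c\<in>C. (b, c) \<in> E" if "B \<in> F" "C \<in> F" "B \<noteq> C" for B C
    using F(1) that by (auto simp: complete_model_def)
  have fF: "finite F" using B(1) U finite_subset[of F "Pow U"] by auto
  define S where "S = {x \<in> U. {x} \<in> F}"
  have "is_clique E S" unfolding is_clique_def S_def using dis(2) by fastforce
  then have cS: "card S \<le> w" using w[of S] by (auto simp: S_def)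
  have "{B \<in> F. card B = 1} = (\<lambda>x. {x}) ` S"
    using B(1) by (auto simp: S_def card_1_singleton_iff)
  then have sing: "card {B \<in> F. card B = 1} = card S" by (simp add: card_image)
  have "2 * card F = (\<Sum>B\<in>F. 2)" by simp
  also have "\<dots> \<le> (\<Sum>B\<in>F. card B + (if card B = 1 then 1 else 0))"
  proof (rule sum_mono)
    fix C assume "C \<in> F"
    then have "card C \<noteq> 0" using B(2,3)[of C] by simp
    then show "2 \<le> card C + (if card C = 1 then 1 else 0)" by auto
  qed
  also have "\<dots> = (\<Sum>B\<in>F. card B) + card {B \<in> F. card B = 1}"
    using fF by (simp add: sum.distrib sum.If_cases Int_def)
  also have "(\<Sum>B\<in>F. card B) = card (\<Union>F)"
    using dis(1) B(3) by (intro card_Union_disjoint[symmetric]) (auto simp: pairwise_def disjnt_def)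
  also have "\<dots> \<le> card U" using U B(1) by (intro card_mono) auto
  finally show False using sing cS F(2) less by linarith
qed

text \<open>A connected branch set cannot leave its label class, and adjacent branch sets share a
  class, so a complete model lives in a single class.\<close>

lemma minor_free_of_classes:
  assumes lab: "\<And>a b. (a, b) \<in> E \<Longrightarrow> lab a = lab b" and t: "1 \<le> t"
    and cl: "\<And>i. minor_free t E {x \<in> U. lab x = i}"
  shows "minor_free t E U"
  unfolding minor_free_def
proof
  assume "\<exists>F. complete_model E U F \<and> card F = t"
  then obtain F where F: "complete_model E U F" "card F = t" by blast
  have B: "B \<subseteq> U" "linked E B" if "B \<in> F" for B
    using F(1) that by (auto simp: complete_model_def)
  have const: "lab x = lab y" if "B \<in> F" "x \<in> B" "y \<in> B" for B x y
  proof (rule ccontr)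
    assume ne: "lab x \<noteq> lab y"
    let ?A = "{z \<in> B. lab z = lab x}"
    have "y \<notin> ?A" "x \<in> ?A" using that ne by auto
    then have "?A \<subseteq> B" "?A \<noteq> {}" "?A \<noteq> B" using that(3) by blast+
    from linkedD[OF B(2)[OF that(1)] this] obtain a b where "a \<in> ?A" "b \<in> B" "b \<notin> ?A" "(a, b) \<in> E" .
    then show False using lab by auto
  qed
  have "F \<noteq> {}" using F(2) t by auto
  then obtain B0 where B0: "B0 \<in> F" by blast
  then obtain x0 where x0: "x0 \<in> B0" using B(2) by (force simp: linked_def)
  have all: "lab y = lab x0" if C: "C \<in> F" "y \<in> C" for C y
  proof (cases "C = B0")
    case True
    then show ?thesis using const[OF B0 _ x0] C by simp
  next
    case False
    then obtain b c where "b \<in> B0" "c \<in> C" "(b, c) \<in> E"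
      using F(1) B0 C(1) unfolding complete_model_def by metis
    then show ?thesis using const[OF B0, of b x0] const[OF C(1), of c y] x0 C(2) lab by metis
  qed
  have "complete_model E {x \<in> U. lab x = lab x0} F"
    using F(1) all unfolding complete_model_def by blast
  then show False using cl[of "lab x0"] F(2) unfolding minor_free_def by blast
qed

lemma clique_count_sum_le:
  assumes "finite U" "finite I" "1 \<le> k" "\<And>i. i \<in> I \<Longrightarrow> A i \<subseteq> U"
    and "\<And>i j. i \<in> I \<Longrightarrow> j \<in> I \<Longrightarrow> i \<noteq> j \<Longrightarrow> A i \<inter> A j = {}"
  shows "(\<Sum>i\<in>I. clique_count E (A i) k) \<le> clique_count E U k"
proof -
  have fA: "finite (A i)" if "i \<in> I" for i using assms(1,4) that finite_subset by blast
  have "(\<Sum>i\<in>I. clique_count E (A i) k) = card (\<Union>i\<in>I. cliques_in E (A i) k)"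
    unfolding clique_count_def
  proof (rule card_UN_disjoint[symmetric, OF assms(2)])
    show "\<forall>i\<in>I. finite (cliques_in E (A i) k)" using fA by simp
    show "\<forall>i\<in>I. \<forall>j\<in>I. i \<noteq> j \<longrightarrow> cliques_in E (A i) k \<inter> cliques_in E (A j) k = {}"
    proof (intro ballI impI, rule ccontr)
      fix i j assume ij: "i \<in> I" "j \<in> I" "i \<noteq> j" "cliques_in E (A i) k \<inter> cliques_in E (A j) k \<noteq> {}"
      then obtain S where "S \<subseteq> A i" "S \<subseteq> A j" "card S = k" by (auto simp: cliques_in_def)
      then have "S = {}" using assms(5)[OF ij(1-3)] by blast
      then show False using \<open>card S = k\<close> assms(3) by simp
    qed
  qed
  also have "\<dots> \<le> card (cliques_in E U k)"
    using assms(1,4) by (intro card_mono) (auto simp: cliques_in_def)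
  finally show ?thesis by (simp add: clique_count_def)
qed

text \<open>The block of \<open>x\<close> is \<open>x div N\<close>, its part within the block
  \<open>x mod N mod w\<close>. The incomplete last block is kept: it makes the order exactly
  \<open>n\<close> and, being smaller, creates no minor.\<close>

lemma disjoint_turan_graphs:
  assumes "1 \<le> w" "w \<le> N" "N + w < 2 * t" "1 \<le> k"
  shows "\<exists>G :: nat pair_pre_digraph. pair_graph G \<and> card (pverts G) = n \<and>
    \<not> has_complete_minor t G \<and> (n div N) * coeff (turan_poly N w) k \<le> num_cliques k G"
proof -
  define E where "E = {(u, v). u < n \<and> v < n \<and> u div N = v div N \<and> u mod N mod w \<noteq> v mod N mod w}"
  define G where "G = \<lparr>pverts = {..<n}, parcs = E\<rparr>"
  have sg: "simple_graph {..<n} E"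
    by (auto simp: simple_graph_def E_def sym_def irrefl_def)
  note sgD = simple_graphD[OF sg]
  have pg: "pair_graph G" unfolding pair_graph_iff using sg by (simp add: G_def)
  have N: "0 < N" using assms by simp
  have "minor_free t E {..<n}"
  proof (rule minor_free_of_classes[where lab = "\<lambda>x. x div N"])
    fix i
    let ?U = "{x \<in> {..<n}. x div N = i}"
    have "?U \<subseteq> {i * N..<i * N + N}"
    proof
      fix x assume "x \<in> ?U"
      then show "x \<in> {i * N..<i * N + N}"
        using mod_less_divisor[OF N, of x] div_mult_mod_eq[of x N] by auto
    qed
    then have "card ?U \<le> card {i * N..<i * N + N}" by (intro card_mono) auto
    then have "card ?U \<le> N" by simp
    show "minor_free t E ?U"
    proof (rule minor_free_of_small_cliques[where w = w])
      fix S assume S: "S \<subseteq> ?U" "is_clique E S"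
      have "inj_on (\<lambda>x. x mod N mod w) S"
        using S(2) by (auto simp: inj_on_def is_clique_def E_def)
      moreover have "(\<lambda>x. x mod N mod w) ` S \<subseteq> {..<w}" using assms(1) by auto
      ultimately have "card S \<le> card {..<w}" using card_inj_on_le finite_lessThan by blast
      then show "card S \<le> w" by simp
    qed (use sgD \<open>card ?U \<le> N\<close> assms in auto)
  qed (use assms in \<open>auto simp: E_def\<close>)
  then have nm: "\<not> has_complete_minor t G" using has_complete_minor_iff[OF pg] by (simp add: G_def)
  have block: "clique_count E {i * N..<i * N + N} k = coeff (turan_poly N w) k" if i: "i < n div N" for i
  proof -
    define A where "A r = (\<lambda>x. i * N + x) ` {x. x < N \<and> x mod w = r}" for r
    have "Suc i * N \<le> n div N * N" using i by (intro mult_le_mono1) simp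
    from le_trans[OF this div_times_less_eq_dividend] have iN: "i * N + N \<le> n" by simp
    have cA: "card (A r) = balanced_part N w r" if "r < w" for r
      unfolding A_def balanced_part_def using card_residue_class[OF that, of N] by (simp add: card_image)
    have memA: "u \<in> A r \<longleftrightarrow> i * N \<le> u \<and> u < i * N + N \<and> (u - i * N) mod w = r" for u r
      unfolding A_def by (auto intro!: image_eqI[of _ _ "u - i * N"])
    have neA: "A r \<noteq> {}" if "r < w" for r
      using that assms(2) by (auto simp: A_def intro!: exI[of _ r])
    have inj: "inj_on A {..<w}"
    proof (rule inj_onI)
      fix r s assume r: "r \<in> {..<w}" "A r = A s"
      then obtain x where "x \<in> A r" "x \<in> A s" using neA[of r] by auto
      then show "r = s" using memA by metis
    qed
    have U: "\<Union>(A ` {..<w}) = {i * N..<i * N + N}" using assms(1) by (auto simp: memA)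
    have "clique_count E (\<Union>(A ` {..<w})) k = coeff (\<Prod>B\<in>A ` {..<w}. [:1, card B:]) k"
    proof (rule clique_count_multipartite)
      show "B \<inter> C = {}" if "B \<in> A ` {..<w}" "C \<in> A ` {..<w}" "B \<noteq> C" for B C
        using that by (auto simp: memA)
      fix u v assume "u \<in> \<Union>(A ` {..<w})" "v \<in> \<Union>(A ` {..<w})"
      then have uv: "i * N \<le> u" "u < i * N + N" "i * N \<le> v" "v < i * N + N" unfolding U by auto
      define a b where "a = u - i * N" and "b = v - i * N"
      have ab: "u = i * N + a" "v = i * N + b" "a < N" "b < N" using uv by (auto simp: a_def b_def)
      have "(u, v) \<in> E \<longleftrightarrow> a mod w \<noteq> b mod w" using ab iN N by (auto simp: E_def)
      also have "\<dots> \<longleftrightarrow> \<not> (\<exists>B\<in>A ` {..<w}. u \<in> B \<and> v \<in> B)"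
        using assms(1) uv by (auto simp: memA a_def b_def)
      finally show "(u, v) \<in> E \<longleftrightarrow> \<not> (\<exists>B\<in>A ` {..<w}. u \<in> B \<and> v \<in> B)" .
    qed (use sgD in \<open>auto simp: A_def\<close>)
    also have "(\<Prod>B\<in>A ` {..<w}. [:1, card B:]) = (\<Prod>r<w. [:1, card (A r):])"
      using inj by (simp add: prod.reindex)
    also have "\<dots> = turan_poly N w" unfolding turan_poly_def by (rule prod.cong) (auto simp: cA)
    finally show ?thesis unfolding U .
  qed
  have "(\<Sum>i<n div N. clique_count E {i * N..<i * N + N} k) \<le> clique_count E {..<n} k"
  proof (rule clique_count_sum_le)
    show "{i * N..<i * N + N} \<subseteq> {..<n}" if "i \<in> {..<n div N}" for i
    proof -
      have "Suc i * N \<le> n div N * N" using that by (intro mult_le_mono1) simp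
      from le_trans[OF this div_times_less_eq_dividend] show ?thesis by auto
    qed
    show "{i * N..<i * N + N} \<inter> {j * N..<j * N + N} = {}" if "i \<noteq> j" for i j
    proof -
      have "x div N = i" if "x \<in> {i * N..<i * N + N}" for x i
        using that by (intro div_nat_eqI) (auto simp: mult.commute)
      then show ?thesis using that by blast
    qed
  qed (use assms in auto)
  then have "(n div N) * coeff (turan_poly N w) k \<le> num_cliques k G"
    using block by (simp add: num_cliques_eq G_def)
  then show ?thesis using pg nm by (intro exI[of _ G]) (auto simp: G_def)
qed

section \<open>Lower bounds for the extremal number of cliques\<close>

lemma le_choose:
  assumes "1 \<le> k" "k < n" shows "n \<le> n choose k"
  using assms
proof (induction n arbitrary: k)
  case (Suc n)
  then obtain j where k: "k = Suc j" by (cases k) auto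
  show ?case
  proof (cases "k = n")
    case True
    then show ?thesis by simp
  next
    case False
    then have "n \<le> n choose k" "0 < n choose j" using Suc k by auto
    then show ?thesis unfolding k binomial_Suc_Suc by linarith
  qed
qed simp

lemma turan_starE:
  assumes "turan_star t k T" "1 \<le> k" "k < t"
  obtains w where "k \<le> w" "w < t" "turan_graph (2 * t - w - 1) w T" "card (pverts T) = 2 * t - w - 1"
    "num_cliques k T = coeff (turan_poly (2 * t - w - 1) w) k"
proof -
  obtain w where w: "w \<in> {k..t - 1}" "turan_graph (2 * t - w - 1) w T"
    using assms(1) unfolding turan_star_def by blast
  show thesis
    by (rule that[of w]) (use w assms num_cliques_turan_graph[OF w(2)] in \<open>auto simp: turan_graph_def\<close>)
qed

text \<open>The choice w = t - 1 gives T(t, t - 1), one part of size 2 and t - 2 singletons, with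
  clique polynomial (1 + 2X)(1 + X)^(t-2).\<close>

lemma turan_star_ge_binomial:
  assumes "turan_star t k T" "1 \<le> k" "k < t"
  shows "(t - 1 choose k) + (t - 2 choose (k - 1)) \<le> num_cliques k T"
proof -
  obtain j where k: "k = Suc j" using assms(2) by (cases k) auto
  obtain s where t: "t = Suc (Suc s)" using assms(2,3) by (metis Suc_le_D less_iff_Suc_add add_Suc_right
        le_add_diff_inverse add.commute One_nat_def)
  define p where "p i = (if i = 0 then 2 else 1 :: nat)" for i :: nat
  have "(\<Prod>i<Suc s. [:1, p i:]) = [:1, 2:] * [:1, 1:] ^ s"
    unfolding prod.lessThan_Suc_shift by (simp add: p_def)
  moreover have "(\<Sum>i<Suc s. p i) = t"
    unfolding sum.lessThan_Suc_shift by (simp add: p_def t)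
  moreover have "coeff ([:1, 2:] * [:1, 1:] ^ s) k = (s choose k) + 2 * (s choose j)"
  proof -
    have "coeff ([:1, 1:] ^ s) i = (s choose i)" for i
    proof (induction s arbitrary: i)
      case (Suc s)
      show ?case
        unfolding power_Suc by (cases i) (simp_all only: coeff_linear_times_Suc coeff_linear_times_0 Suc; simp)+
    qed (cases i; simp)
    then show ?thesis unfolding k coeff_linear_times_Suc by simp
  qed
  ultimately have "(s choose k) + 2 * (s choose j) \<le> coeff (turan_poly t (Suc s)) k"
    using prod_le_turan_poly[of "{..<Suc s}" p] unfolding coeff_le_def by (metis card_lessThan finite_lessThan)
  also have "\<dots> \<le> num_cliques k T"
    using turan_star_ge[OF assms(1,2), of "Suc s"] assms(3) by (simp add: t)
  finally show ?thesis by (simp add: t k)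
qed

text \<open>This makes the base of the power exceed 1. For k >= 3 the two binomials are at least t -
  1 and t - 2, with sum 2t - 3 > 2t - w - 1. For k = 2 the order may itself be 2t - 3, so the (t -
  1)(t - 2) edges of T(2t - 3, 2) are used instead.\<close>

lemma turan_star_card_less:
  assumes "turan_star t k T" "2 \<le> k" "k + 2 \<le> t"
  shows "card (pverts T) < num_cliques k T"
proof -
  obtain w where w: "k \<le> w" "w < t" "card (pverts T) = 2 * t - w - 1"
    by (rule turan_starE[OF assms(1)]) (use assms in auto)
  show ?thesis
  proof (cases "k = 2")
    case True
    obtain s where t: "t = s + 4" using assms True
      using le_Suc_ex[of 4 t] by (auto simp: add.commute)
    define p where "p b = (if b then t - 1 else t - 2)" for b
    have ft: "finite {True, False}" "card {True, False} = 2" by simp_all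
    have "(\<Prod>b\<in>{True, False}. [:1, p b:]) = [:1, t - 1:] * [:1, t - 2:]" by (simp add: p_def)
    moreover have "(\<Sum>b\<in>{True, False}. p b) = 2 * t - 2 - 1" by (simp add: p_def t)
    ultimately have "coeff_le ([:1, t - 1:] * [:1, t - 2:]) (turan_poly (2 * t - 2 - 1) 2)"
      using prod_le_turan_poly[OF ft(1), of p] ft(2) by simp
    then have "coeff ([:1, t - 1:] * [:1, t - 2:]) (Suc (Suc 0)) \<le> coeff (turan_poly (2 * t - 2 - 1) 2) 2"
      unfolding coeff_le_def by (simp only: numeral_2_eq_2)
    then have "(t - 1) * (t - 2) \<le> coeff (turan_poly (2 * t - 2 - 1) 2) 2"
      unfolding coeff_linear_times_Suc by simp
    also have "\<dots> \<le> num_cliques k T" using turan_star_ge[OF assms(1), of 2] assms True by simp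
    finally have "(t - 1) * (t - 2) \<le> num_cliques k T" .
    moreover have "2 * t - 3 < (t - 1) * (t - 2)" by (simp add: t algebra_simps)
    ultimately show ?thesis using w True by linarith
  next
    case False
    then have "t - 1 \<le> (t - 1 choose k)" "t - 2 \<le> (t - 2 choose (k - 1))"
      using assms by (auto intro!: le_choose)
    moreover have "(t - 1 choose k) + (t - 2 choose (k - 1)) \<le> num_cliques k T"
      by (rule turan_star_ge_binomial[OF assms(1)]) (use assms in auto)
    ultimately show ?thesis using w assms False by linarith
  qed
qed

section \<open>Upper bounds\<close>

text \<open>Packs the numerical conditions of the edge bound; any such \<open>d\<close> bounds the
  degeneracy of every graph without a complete minor of order \<open>t\<close>.\<close>

definition degeneracy_bound :: "nat \<Rightarrow> nat \<Rightarrow> bool" where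
  "degeneracy_bound t d \<longleftrightarrow> (\<exists>D c u. 0 < D \<and> d = 2 * D \<and> (3 / 4 :: real) ^ c * (2 * real D) < 1 \<and>
     16 * u \<le> D \<and> t * (3 * c) \<le> u + 3 * c)"

lemma clique_count_minor_free_le:
  assumes "simple_graph V E" "minor_free t E V" "degeneracy_bound t d"
    and M: "\<And>W. W \<subseteq> V \<Longrightarrow> card W \<le> d \<Longrightarrow> minor_free t E W \<Longrightarrow> real (clique_count E W j) \<le> M"
  shows "real (clique_count E V (Suc j)) \<le> real (card V) * M"
proof -
  note G = simple_graphD[OF assms(1)]
  obtain D c u where D: "0 < D" "d = 2 * D" "(3 / 4 :: real) ^ c * (2 * real D) < 1"
     "16 * u \<le> D" "t * (3 * c) \<le> u + 3 * c" using assms(3) unfolding degeneracy_bound_def by blast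
  have M0: "0 \<le> M" using M[of "{}"] minor_free_subset[OF assms(2)] by fastforce
  have "clique_count E V (Suc j) \<le> card V * nat \<lfloor>M\<rfloor>"
  proof (rule clique_count_degenerate[OF G(1,3,4)])
    show "\<exists>v\<in>W. card (W \<inter> E `` {v}) \<le> d" if "W \<subseteq> V" "W \<noteq> {}" for W
      unfolding D(2) by (rule minor_free_degenerate[OF assms(1,2) that D(1,3,4,5)])
    show "clique_count E W j \<le> nat \<lfloor>M\<rfloor>" if "W \<subseteq> V" "card W \<le> d" for W
      using M[OF that minor_free_subset[OF assms(2) that(1)]] by (simp add: le_nat_floor)
  qed
  then have "real (clique_count E V (Suc j)) \<le> real (card V) * real (nat \<lfloor>M\<rfloor>)"
    by (metis of_nat_le_iff of_nat_mult)
  also have "\<dots> \<le> real (card V) * M" using M0 by (intro mult_left_mono) auto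
  finally show ?thesis .
qed

lemma clique_count_bound_choose:
  assumes "simple_graph V E" "minor_free t E V" "degeneracy_bound t d"
  shows "real (clique_count E V (Suc j)) \<le> real (card V) * real (d choose j)"
proof (rule clique_count_minor_free_le[OF assms])
  fix W assume W: "W \<subseteq> V" "card W \<le> d"
  have "finite W" using simple_graphD(1)[OF assms(1)] W(1) finite_subset by blast
  then show "real (clique_count E W j) \<le> real (d choose j)"
    using clique_count_le_choose[of W E j] binomial_right_mono[OF W(2), of j] by (meson le_trans of_nat_mono)
qed

lemma maximum_clique_exists:
  assumes "finite W" "clique_count E W i \<noteq> 0" "minor_free t E W"
  obtains K where "K \<subseteq> W" "is_clique E K" "i \<le> card K" "card K < t"
    "\<And>S. S \<subseteq> W \<Longrightarrow> is_clique E S \<Longrightarrow> card S \<le> card K"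
proof -
  have "cliques_in E W i \<noteq> {}" using assms(2) by (auto simp: clique_count_def)
  then obtain S0 where S0: "S0 \<subseteq> W" "card S0 = i" "is_clique E S0" by (auto simp: cliques_in_def)
  let ?P = "\<lambda>S. S \<subseteq> W \<and> is_clique E S"
  have "\<forall>S. ?P S \<longrightarrow> card S < card W + 1" using assms(1) by (auto simp: card_mono less_Suc_eq_le)
  then obtain K where K: "?P K" "\<forall>S. ?P S \<longrightarrow> card S \<le> card K"
    using ex_has_greatest_nat[of ?P S0 card "card W + 1"] S0 by (metis less_imp_le)
  have "complete_model E W ((\<lambda>x. {x}) ` K)"
    using K(1) unfolding complete_model_def by (auto simp: linked_singleton is_clique_def)
  then have "card K < t" using minor_free_card_less[OF assms(3) _ assms(1)] by (fastforce simp: card_image)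
  then show thesis using that[of K] K S0 by auto
qed

text \<open>Degeneracy followed by peeling, the common start of the near and the middle range. What
  is left to bound are cliques of order between j - r and j in an almost complete \<open>W\<close>
  with a maximum clique \<open>K\<close>.\<close>

lemma clique_count_minor_free_peel:
  fixes \<delta> :: real and M :: nat
  assumes G: "simple_graph V E" "minor_free t E V" "degeneracy_bound t d" and r: "r \<le> j" "real d < (1 / (1 - \<delta>)) ^ r"
    and \<delta>: "0 < \<delta>" "\<delta> < 1" and M: "1 \<le> M"
    and bound: "\<And>W i K. finite W \<Longrightarrow> W \<noteq> {} \<Longrightarrow> card W \<le> d \<Longrightarrow> minor_free t E W \<Longrightarrow> j - r \<le> i \<Longrightarrow> i \<le> j \<Longrightarrow>
      (\<And>v. v \<in> W \<Longrightarrow> real (card (W - E `` {v} - {v})) < \<delta> * (real (card W) - real i)) \<Longrightarrow>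
      K \<subseteq> W \<Longrightarrow> is_clique E K \<Longrightarrow> i \<le> card K \<Longrightarrow> card K < t \<Longrightarrow>
      (\<And>S. S \<subseteq> W \<Longrightarrow> is_clique E S \<Longrightarrow> card S \<le> card K) \<Longrightarrow> clique_count E W i \<le> M"
  shows "real (clique_count E V (Suc j)) \<le> real (card V) * (real (d + 1) ^ r * real M)"
proof (rule clique_count_minor_free_le[OF G])
  fix U assume U: "U \<subseteq> V" "card U \<le> d" "minor_free t E U"
  note GD = simple_graphD[OF G(1)]
  have fU: "finite U" using GD(1) U(1) finite_subset by blast
  have "real (clique_count E U j) \<le> real (card U + 1) ^ r * real M"
  proof (rule clique_count_peel[where \<delta> = \<delta> and ?j0.0 = "j - r"])
    show "real (card U) - real j < (1 / (1 - \<delta>)) ^ r" using r U(2) by linarith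
    fix W i assume W: "W \<subseteq> U" "j - r \<le> i" "i \<le> j" "i < card W"
      "\<And>v. v \<in> W \<Longrightarrow> real (card (W - E `` {v} - {v})) < \<delta> * (real (card W) - real i)"
    have fW: "finite W" using fU W(1) finite_subset by blast
    have mW: "minor_free t E W" using minor_free_subset[OF U(3) W(1)] .
    have W0: "W \<noteq> {}" "card W \<le> d" using W(4) card_mono[OF fU W(1)] U(2) by auto
    have "clique_count E W i \<le> M"
    proof (cases "clique_count E W i = 0")
      case False
      obtain K where K: "K \<subseteq> W" "is_clique E K" "i \<le> card K" "card K < t"
        "\<And>S. S \<subseteq> W \<Longrightarrow> is_clique E S \<Longrightarrow> card S \<le> card K"
        using maximum_clique_exists[OF fW False mW] by metis
      show ?thesis by (rule bound[OF fW W0 mW W(2,3,5) K])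
    qed simp
    then show "real (clique_count E W i) \<le> real M" by simp
  qed (use \<delta> M GD fU r in auto)
  also have "\<dots> \<le> real (d + 1) ^ r * real M" using U(2) by (intro mult_right_mono power_mono) auto
  finally show "real (clique_count E U j) \<le> real (d + 1) ^ r * real M" .
qed

lemma clique_count_bound_near:
  fixes \<delta> :: real
  assumes G: "simple_graph V E" "minor_free t E V" "degeneracy_bound t d" and k: "Suc j < t" "r \<le> j"
    and \<delta>: "0 < \<delta>" "4 * \<delta> < 1" and c: "(2 * \<delta>) ^ c * real d < 1" and r: "real d < (1 / (1 - \<delta>)) ^ r"
    and m: "t = Suc j + m" "2 * (m + r) \<le> t - 1"
  shows "real (clique_count E V (Suc j)) \<le>
     real (card V) * (real (d + 1) ^ r * (2 ^ (6 * c * (m + r + 1)) * real (t - 1 choose (m + r))))"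
proof -
  note GD = simple_graphD[OF G(1)]
  have M: "1 \<le> 2 ^ (6 * c * (m + r + 1)) * (t - 1 choose (m + r))" using m by (simp add: Suc_le_eq)
  have \<delta>1: "\<delta> < 1" using \<delta> by linarith
  have "real (clique_count E V (Suc j)) \<le>
     real (card V) * (real (d + 1) ^ r * real (2 ^ (6 * c * (m + r + 1)) * (t - 1 choose (m + r))))"
  proof (rule clique_count_minor_free_peel[OF G k(2) r \<delta>(1) \<delta>1 M])
    fix W i K assume fW: "finite W" and W0: "W \<noteq> {}" and Wd: "card W \<le> d" and mW: "minor_free t E W"
      and i: "j - r \<le> i" "i \<le> j"
      and non: "\<And>v. v \<in> W \<Longrightarrow> real (card (W - E `` {v} - {v})) < \<delta> * (real (card W) - real i)"
      and K: "K \<subseteq> W" "is_clique E K" "i \<le> card K" "card K < t"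
        "\<And>S. S \<subseteq> W \<Longrightarrow> is_clique E S \<Longrightarrow> card S \<le> card K"
    \<comment> \<open>The non-neighbour bound is relative to |W| - i, so the domination argument is
      run with a subclique of size exactly \<open>i\<close>; the maximum clique \<open>K\<close>
      returns in the count.\<close>
    obtain K' where K': "K' \<subseteq> K" "card K' = i" using K(3) by (meson obtain_subset_with_card_n)
    have "(2 * \<delta>) ^ c * real (card W) \<le> (2 * \<delta>) ^ c * real d" using Wd \<delta> by (intro mult_left_mono) auto
    then have "(2 * \<delta>) ^ c * real (card W) < 1" using c by linarith
    then have "card W < card K' + 6 * c * (t - card K')"
      by (intro few_nonneighbours_bound[OF fW W0 GD(3,4) _ _ _ mW \<delta>])
        (use K K' non k i is_clique_subset in auto)
    moreover have "6 * c * (t - card K') \<le> 6 * c * (m + r + 1)"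
      using m(1) i k K'(2) by (intro mult_le_mono2) auto
    moreover have "card (W - K) = card W - card K"
      using K(1) fW finite_subset by (metis card_Diff_subset)
    ultimately have R: "card (W - K) \<le> 6 * c * (m + r + 1)" using K(3) K'(2) by linarith
    have it: "i \<le> t - 1" "t - 1 - i \<le> m + r" using i k m by auto
    have "card K choose i \<le> (t - 1) choose i" using K(4) by (intro binomial_right_mono) auto
    also have "\<dots> = (t - 1) choose (t - 1 - i)" using it by (simp add: binomial_symmetric)
    also have "\<dots> \<le> (t - 1) choose (m + r)" using it m(2) by (intro binomial_mono) auto
    finally have ch: "card K choose i \<le> (t - 1) choose (m + r)" .
    have "clique_count E W i \<le> 2 ^ card (W - K) * (card K choose i)"
      by (rule clique_count_near_clique[OF fW GD(3) K(1,2,3)]) (use K(5) in auto)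
    also have "\<dots> \<le> 2 ^ (6 * c * (m + r + 1)) * ((t - 1) choose (m + r))"
      using ch R by (intro mult_le_mono power_increasing) auto
    finally show "clique_count E W i \<le> 2 ^ (6 * c * (m + r + 1)) * (t - 1 choose (m + r))" .
  qed
  then show ?thesis by simp
qed

lemma clique_count_bound_middle:
  fixes \<delta> :: real
  assumes G: "simple_graph V E" "minor_free t E V" "degeneracy_bound t d" and k: "Suc j < t" "r \<le> j"
    and \<delta>: "0 < \<delta>" "\<delta> < 1" and r: "real d < (1 / (1 - \<delta>)) ^ r"
    and b: "\<delta> * real d \<le> real b" "d * b ^ 2 + l * (b + 1) < l ^ 2"
    and T: "turan_star t (Suc j) T"
  shows "real (clique_count E V (Suc j)) \<le> real (card V) * (real (d + 1) ^ r *
     (2 ^ (l + r + 1) * real t ^ (l + 2 * r + 2) * real (num_cliques (Suc j) T)))"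
proof -
  note GD = simple_graphD[OF G(1)]
  define C where "C = num_cliques (Suc j) T"
  have "(t - 1 choose Suc j) + (t - 2 choose (Suc j - 1)) \<le> C"
    unfolding C_def by (rule turan_star_ge_binomial[OF T]) (use k in auto)
  moreover have "0 < t - 1 choose Suc j" using k by simp
  ultimately have "0 < C" by linarith
  then have M: "1 \<le> 2 ^ (l + r + 1) * (t ^ (l + 2 * r + 2) * C)" using k by (simp add: Suc_le_eq)
  have "real (clique_count E V (Suc j)) \<le>
     real (card V) * (real (d + 1) ^ r * real (2 ^ (l + r + 1) * (t ^ (l + 2 * r + 2) * C)))"
  proof (rule clique_count_minor_free_peel[OF G k(2) r \<delta> M])
    fix W i K assume fW: "finite W" and cWd: "card W \<le> d" and mW: "minor_free t E W"
      and i: "j - r \<le> i" "i \<le> j"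
      and non: "\<And>v. v \<in> W \<Longrightarrow> real (card (W - E `` {v} - {v})) < \<delta> * (real (card W) - real i)"
      and K: "K \<subseteq> W" "is_clique E K" "i \<le> card K" "card K < t"
        "\<And>S. S \<subseteq> W \<Longrightarrow> is_clique E S \<Longrightarrow> card S \<le> card K"
    have "card W < card K + 2 * (t - card K) + l"
    proof (rule sparse_complement_bound[OF fW GD(3,4) K(1,2,4) mW, of b])
      fix v assume "v \<in> W"
      then have "real (card (W - E `` {v} - {v})) < \<delta> * (real (card W) - real i)" by (rule non)
      also have "\<dots> \<le> \<delta> * real d" using cWd \<delta> by (intro mult_left_mono) auto
      finally show "card (W - E `` {v} - {v}) \<le> b" using b(1) by linarith
    next
      have "card W * b ^ 2 \<le> d * b ^ 2" using cWd by (rule mult_le_mono1)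
      then show "card W * b ^ 2 + l * (b + 1) < l ^ 2" using b(2) by linarith
    qed
    \<comment> \<open>The clique number of \<open>W\<close> may fall short of \<open>Suc j\<close>
      by up to r + 1, while T(2t - w - 1, w) competes in the maximum only for w >=
      \<open>Suc j\<close>. Raising w keeps the clique bound valid and adds at most r + 1 surplus
      vertices to \<open>R\<close>.\<close>
    define w where "w = max (card K) (Suc j)"
    have w: "Suc j \<le> w" "w < t" "card K \<le> w" using K(4) k by (auto simp: w_def)
    obtain W' where W': "W' \<subseteq> W" "card W' = min (card W) (2 * t - w - 1)"
      by (meson min.cobounded1 obtain_subset_with_card_n)
    define R where "R = W - W'"
    have fW': "finite W'" using W' fW finite_subset by blast
    have cR: "card R \<le> l + r + 1"
    proof -
      have "card R = card W - card W'" using W'(1) fW' by (simp add: R_def card_Diff_subset)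
      moreover have "w - card K \<le> r + 1" using K(3) i k by (auto simp: w_def)
      ultimately show ?thesis using W'(2) \<open>card W < _\<close> K(4) w by linarith
    qed
    have t1: "1 \<le> t" using k by simp
    have "clique_count E W i \<le> 2 ^ card R * (t ^ (l + 2 * r + 2) * C)"
    proof (rule clique_count_decompose[OF fW])
      show "R \<subseteq> W" by (auto simp: R_def)
      fix I assume I: "I \<subseteq> R" "card I \<le> i"
      have "card I \<le> card R" using I(1) fW by (intro card_mono) (auto simp: R_def)
      have "clique_count E {x \<in> W - R. \<forall>i\<in>I. (i, x) \<in> E} (i - card I) \<le> clique_count E W' (i - card I)"
        using fW' by (intro clique_count_mono) (auto simp: R_def)
      also have "\<dots> \<le> coeff (turan_poly (card W') w) (i - card I)"
        by (rule clique_count_le_turan_poly[OF fW' GD(3,4)]) (use W'(1) K(5) w(3) le_trans in blast)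
      also have "\<dots> \<le> coeff (turan_poly (2 * t - w - 1) w) (i - card I)"
        using turan_poly_mono[of w "card W'" "2 * t - w - 1"] w W'(2) unfolding coeff_le_def by auto
      also have "\<dots> \<le> t ^ (Suc j - (i - card I)) * coeff (turan_poly (2 * t - w - 1) w) (Suc j)"
        by (rule coeff_turan_poly_le_power) (use i w in auto)
      also have "\<dots> \<le> t ^ (l + 2 * r + 2) * C"
      proof (rule mult_le_mono)
        \<comment> \<open>The order is short of \<open>Suc j\<close> by at most r + 1 from peeling
          and l + r + 1 from the trace, in total l + 2r + 2.\<close>
        show "t ^ (Suc j - (i - card I)) \<le> t ^ (l + 2 * r + 2)"
          using \<open>card I \<le> card R\<close> cR i t1 k by (intro power_increasing) auto
        show "coeff (turan_poly (2 * t - w - 1) w) (Suc j) \<le> C"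
          unfolding C_def using w by (intro turan_star_ge[OF T]) auto
      qed
      finally show "clique_count E {x \<in> W - R. \<forall>i\<in>I. (i, x) \<in> E} (i - card I) \<le> t ^ (l + 2 * r + 2) * C" .
    qed
    also have "\<dots> \<le> 2 ^ (l + r + 1) * (t ^ (l + 2 * r + 2) * C)"
      using cR by (intro mult_le_mono1 power_increasing) auto
    finally show "clique_count E W i \<le> 2 ^ (l + r + 1) * (t ^ (l + 2 * r + 2) * C)" .
  qed
  then show ?thesis by (simp add: C_def mult.assoc)
qed

section \<open>Asymptotics\<close>

text \<open>k^k / k! is a single term of the series for exp k.\<close>

lemma choose_le_exp_power:
  assumes "1 \<le> k"
  shows "real (n choose k) \<le> (exp 1 * real n / real k) ^ k"
proof -
  have "real k ^ k / fact k \<le> exp (real k)"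
  proof -
    have "(\<lambda>i. real k ^ i / fact i) sums exp (real k)"
      using exp_converges[of "real k"] by (simp add: field_simps)
    then have "(\<Sum>i\<in>{k}. real k ^ i / fact i) \<le> exp (real k)"
      using sum_le_suminf[of "\<lambda>i. real k ^ i / fact i" "{k}"] by (auto simp: sums_iff)
    then show ?thesis by simp
  qed
  then have "real k ^ k \<le> exp 1 ^ k * fact k"
    by (simp add: field_simps exp_of_nat_mult[symmetric])
  then have "real (n choose k) * real k ^ k \<le> real (n choose k) * (exp 1 ^ k * fact k)"
    by (intro mult_left_mono) auto
  also have "\<dots> = exp 1 ^ k * real ((n choose k) * fact k)" by simp
  also have "\<dots> \<le> exp 1 ^ k * real (n ^ k)"
    by (intro mult_left_mono of_nat_mono binomial_fact_pow) auto
  finally show ?thesis using assms by (simp add: power_divide power_mult_distrib field_simps)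
qed

lemma choose_le_exp:
  assumes "1 \<le> k" "exp 1 * real n / real k \<le> exp x"
  shows "real (n choose k) \<le> exp (real k * x)"
proof -
  have "real (n choose k) \<le> (exp 1 * real n / real k) ^ k" by (rule choose_le_exp_power[OF assms(1)])
  also have "\<dots> \<le> exp x ^ k" using assms(2) by (intro power_mono) auto
  also have "\<dots> = exp (real k * x)" by (simp add: exp_of_nat_mult)
  finally show ?thesis .
qed

lemma two_power_le_exp: "(2::real) ^ n \<le> exp (real n)"
proof -
  have "2 \<le> exp (1::real)" using exp_ge_add_one_self[of "1::real"] by simp
  then have "2 ^ n \<le> exp (1::real) ^ n" by (intro power_mono) auto
  then show ?thesis using exp_of_nat_mult[of n "1::real"] by simp
qed

text \<open>The base enters the estimates through an explicit lower bound \<open>exp a\<close>, so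
  only the exponents \<open>a\<close> and \<open>b\<close> need comparing.\<close>

lemma powr_ge_of_exp:
  fixes B a b e x :: real
  assumes "exp a \<le> B" "x \<le> exp b" "b \<le> (1 + e) * a" "0 \<le> e"
  shows "x \<le> B powr (1 + e)"
proof -
  have "exp b \<le> exp a powr (1 + e)" using assms(3) by (simp add: powr_def)
  also have "\<dots> \<le> B powr (1 + e)" using assms by (intro powr_mono2) auto
  finally show ?thesis using assms(2) by simp
qed

lemma two_le_powr:
  fixes B a e :: real
  assumes "exp a \<le> B" "ln 2 \<le> e * a" "0 \<le> e"
  shows "2 \<le> B powr e"
proof -
  have "exp (ln 2) \<le> exp (e * a)" using assms(2) by (simp only: exp_le_cancel_iff)
  then have "2 \<le> exp (e * a)" by simp
  also have "\<dots> = exp a powr e" by (simp add: powr_def)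
  also have "\<dots> \<le> B powr e" using assms by (intro powr_mono2) auto
  finally show ?thesis .
qed

text \<open>The depth needed for peeling, from 1 - \<delta> <= exp(-\<delta>).\<close>

lemma less_power_ceiling:
  fixes \<delta> :: real
  assumes "0 < \<delta>" "\<delta> < 1"
  shows "real d < (1 / (1 - \<delta>)) ^ nat \<lceil>ln (real d + 1) / \<delta>\<rceil>"
proof -
  let ?r = "nat \<lceil>ln (real d + 1) / \<delta>\<rceil>"
  have "ln (real d + 1) / \<delta> \<le> real ?r" by linarith
  then have "ln (real d + 1) \<le> real ?r * \<delta>" using assms(1) by (simp only: pos_divide_le_eq)
  then have "exp (ln (real d + 1)) \<le> exp (real ?r * \<delta>)" by (simp only: exp_le_cancel_iff)
  moreover have "exp (ln (real d + 1)) = real d + 1" by simp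
  ultimately have "real d + 1 \<le> exp \<delta> ^ ?r" by (simp only: exp_of_nat_mult)
  also have "exp \<delta> \<le> 1 / (1 - \<delta>)"
  proof -
    have "1 - \<delta> \<le> exp (- \<delta>)" using exp_ge_add_one_self[of "- \<delta>"] by simp
    then show ?thesis using assms by (simp add: exp_minus field_simps)
  qed
  then have "exp \<delta> ^ ?r \<le> (1 / (1 - \<delta>)) ^ ?r" by (intro power_mono) auto
  finally show ?thesis by simp
qed

text \<open>This is 96 c t with c at most (ln t)^2 + 1. A large multiple of ln t would do for c, but
  with (ln t)^2 the power (3/4)^c beats every power of t without tuning, and a polylogarithmic
  factor is harmless.\<close>

definition deg_limit :: "nat \<Rightarrow> real" where
  "deg_limit t = 96 * real t * ((ln (real t)) ^ 2 + 1)"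

definition clique_ratio :: "nat \<Rightarrow> nat pair_pre_digraph \<Rightarrow> real" where
  "clique_ratio k T = real (num_cliques k T) / real (card (pverts T))"

lemma clique_ratio_bounds:
  assumes "turan_star t k T" "2 \<le> k" "k + 2 \<le> t"
  shows "1 + 1 / (2 * real t) \<le> clique_ratio k T"
    and "real (t - 1 choose k) / (2 * real t) \<le> clique_ratio k T"
    and "real (num_cliques k T) \<le> clique_ratio k T * (2 * real t)"
proof -
  define N where "N = card (pverts T)"
  define C where "C = num_cliques k T"
  have k: "1 \<le> k" "k < t" using assms by auto
  obtain w where "w < t" "N = 2 * t - w - 1"
    unfolding N_def by (rule turan_starE[OF assms(1) k])
  then have N: "0 < real N" "real N \<le> 2 * real t" by auto
  have "N + 1 \<le> C" using turan_star_card_less[OF assms] by (simp add: N_def C_def)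
  then have "real N + 1 \<le> real C" by linarith
  then have "(real N + 1) / real N \<le> real C / real N" by (intro divide_right_mono) auto
  moreover have "1 / (2 * real t) \<le> 1 / real N" using N by (intro divide_left_mono) auto
  ultimately show "1 + 1 / (2 * real t) \<le> clique_ratio k T"
    using N by (simp add: clique_ratio_def add_divide_distrib N_def C_def)
  have "(t - 1 choose k) \<le> C" using turan_star_ge_binomial[OF assms(1) k] by (simp add: C_def)
  then have "real (t - 1 choose k) / (2 * real t) \<le> real C / real N"
    using N by (intro frac_le) auto
  then show "real (t - 1 choose k) / (2 * real t) \<le> clique_ratio k T"
    by (simp add: clique_ratio_def N_def C_def)
  have "real C = real C / real N * real N" using N by simp
  also have "\<dots> \<le> real C / real N * (2 * real t)" using N by (intro mult_left_mono) auto
  finally show "real (num_cliques k T) \<le> clique_ratio k T * (2 * real t)"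
    by (simp add: clique_ratio_def N_def C_def)
qed

section \<open>Upper bounds in the three ranges of k\<close>

definition cliques_bounded :: "nat \<Rightarrow> nat \<Rightarrow> real \<Rightarrow> bool" where
  "cliques_bounded t k x \<longleftrightarrow> (\<forall>(V :: nat set) E. simple_graph V E \<longrightarrow> minor_free t E V \<longrightarrow>
     real (clique_count E V k) \<le> real (card V) * x)"

lemma cliques_bounded_mono: "cliques_bounded t k x \<Longrightarrow> x \<le> y \<Longrightarrow> cliques_bounded t k y"
  unfolding cliques_bounded_def by (meson mult_left_mono of_nat_0_le_iff order_trans)

lemma cliques_bounded_choose: "degeneracy_bound t d \<Longrightarrow> cliques_bounded t (Suc j) (real (d choose j))"
  unfolding cliques_bounded_def using clique_count_bound_choose by blast

lemma power_le_exp: "ln (real d + 1) \<le> x \<Longrightarrow> real (d + 1) ^ r \<le> exp (real r * x)"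
proof -
  assume "ln (real d + 1) \<le> x"
  then have "exp (ln (real d + 1)) \<le> exp x" by (simp only: exp_le_cancel_iff)
  then have "real (d + 1) ^ r \<le> exp x ^ r" by (intro power_mono) auto
  then show ?thesis by (simp add: exp_of_nat_mult)
qed

text \<open>The condition that the power of the base be at least 2 is for the sharpness part: it
  pays for the factor lost when n is not a multiple of the order of the Turan graph.\<close>

definition reaches_exponent :: "nat \<Rightarrow> nat \<Rightarrow> nat pair_pre_digraph \<Rightarrow> real \<Rightarrow> bool" where
  "reaches_exponent t k T e \<longleftrightarrow> 2 \<le> clique_ratio k T powr e \<and>
     cliques_bounded t k (clique_ratio k T powr (1 + e))"

definition turan_setting :: "nat \<Rightarrow> nat \<Rightarrow> nat pair_pre_digraph \<Rightarrow> nat \<Rightarrow> bool" where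
  "turan_setting t k T d \<longleftrightarrow> 2 \<le> k \<and> k + 2 \<le> t \<and> turan_star t k T \<and>
     degeneracy_bound t d \<and> real d \<le> deg_limit t \<and> ln (real d + 1) \<le> 2 * ln (real t)"

lemma turan_settingD:
  assumes "turan_setting t k T d"
  shows "2 \<le> k" "k < t" "turan_star t k T" "degeneracy_bound t d" "real d \<le> deg_limit t"
    "ln (real d + 1) \<le> 2 * ln (real t)" "real (t - 1 choose k) / (2 * real t) \<le> clique_ratio k T"
    "real (num_cliques k T) \<le> clique_ratio k T * (2 * real t)"
  using assms clique_ratio_bounds(2,3)[of t k T] by (auto simp: turan_setting_def)

text \<open>With y = ln(t/j) both logarithms are j y up to an error of O(j ln ln t), since d exceeds
  t only by a polylogarithmic factor. As k <= t^0.95 gives y >= L/20, the relative error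
  vanishes.\<close>

lemma regime_small:
  fixes e :: real
  assumes "0 < e"
  shows "\<forall>\<^sub>F t in sequentially. \<forall>k T d. turan_setting t k T d \<and> real k \<le> real t powr 0.95 \<longrightarrow>
     reaches_exponent t k T e"
proof -
  have "((\<lambda>t. (1 + ln (96 * ((ln (real t)) ^ 2 + 1)) + (1 + e) * ln 32) / ln (real t)) \<longlongrightarrow> 0) sequentially"
    by real_asymp
  from order_tendstoD(2)[OF this, of "e / 20"]
  have 1: "\<forall>\<^sub>F t in sequentially. (1 + ln (96 * ((ln (real t)) ^ 2 + 1)) + (1 + e) * ln 32) / ln (real t) < e / 20"
    using assms by simp
  have "((\<lambda>t. (ln 2 + e * ln 32) / ln (real t)) \<longlongrightarrow> 0) sequentially" by real_asymp
  from order_tendstoD(2)[OF this, of "e / 20"]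
  have 2: "\<forall>\<^sub>F t in sequentially. (ln 2 + e * ln 32) / ln (real t) < e / 20" using assms by simp
  have 3: "\<forall>\<^sub>F t in sequentially. real t powr 0.95 + 2 \<le> real t" by real_asymp
  have 4: "\<forall>\<^sub>F t in sequentially. 4 \<le> real t" by real_asymp
  from 1 2 3 4 show ?thesis
  proof eventually_elim
    case (elim t)
    define L where "L = ln (real t)"
    have L: "0 < L" using elim(4) by (simp add: L_def)
    have e1: "1 + ln (96 * (L ^ 2 + 1)) + (1 + e) * ln 32 \<le> e * (L / 20)"
      using elim(1) L by (simp add: L_def[symmetric] field_simps)
    have e2: "ln 2 \<le> e * (L / 20 - ln 32)"
      using elim(2) L by (simp add: L_def[symmetric] field_simps)
    show ?case
    proof (intro allI impI, elim conjE)
      fix k T d assume set: "turan_setting t k T d" and k095: "real k \<le> real t powr 0.95"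
      define B where "B = clique_ratio k T"
      note S = turan_settingD[OF set, folded B_def]
      have k: "2 \<le> k" "real k \<le> real t powr 0.95" and d: "real d \<le> deg_limit t"
        and B: "real (t - 1 choose k) / (2 * real t) \<le> B" using S k095 by blast+
      obtain j where j: "k = Suc j" "1 \<le> j" using k(1) by (cases k) auto
      define y where "y = ln (real t / real j)"
      have expy: "exp y = real t / real j" using j(2) elim(4) by (simp add: y_def)
      have "real j \<le> real t powr 0.95" using k(2) j by simp
      then have "ln (real j) \<le> ln (real t powr 0.95)" using j(2) by (intro ln_mono) auto
      then have "ln (real j) \<le> 0.95 * L" using elim(4) by (simp add: L_def ln_powr)
      then have y: "L / 20 \<le> y" using j(2) elim(4) by (simp add: y_def L_def ln_div)
      \<comment> \<open>32 = 4 * 8: (t - 1)/k >= t/(4j), and 8^j absorbs the remaining factor (t -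
        1)/k of the k-th power together with the division by 2t.\<close>
      define a where "a = real j * (y - ln 32)"
      have "exp a \<le> real (t - 1 choose k) / (2 * real t)"
      proof -
        let ?q = "real (t - 1) / real k"
        have "k \<le> t - 1" using k(2) elim(3) by linarith
        then have "?q ^ k \<le> real (t - 1 choose k)" by (rule binomial_ge_n_over_k_pow_k)
        have t1: "real t / 2 \<le> real (t - 1)" using elim(4) by linarith
        have kj: "real k \<le> 2 * real j" using j by simp
        have "real t / (4 * real j) \<le> ?q"
        proof -
          have "real t / (4 * real j) = (real t / 2) / (2 * real j)" by simp
          also have "\<dots> \<le> real (t - 1) / real k" using t1 kj j elim(4) by (intro frac_le) auto
          finally show ?thesis .
        qed
        moreover have "1 / 8 ^ j \<le> ?q / (2 * real t)"
        proof -
          have "4 * (j + 1) \<le> 8 ^ j" using j(2)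
          proof (induction j rule: dec_induct)
            case (step n) then show ?case by simp
          qed simp
          then have "real (4 * (j + 1)) \<le> real (8 ^ j)" by (rule of_nat_mono)
          then have "4 * real k \<le> 8 ^ j" using j(1) by simp
          then have "1 / 8 ^ j \<le> 1 / (4 * real k)" using j by (intro frac_le) auto
          also have "\<dots> \<le> ?q / (2 * real t)"
          proof -
            have "1 / 4 \<le> real (t - 1) / (2 * real t)"
              using t1 elim(4) by (subst pos_le_divide_eq) linarith+
            then have "1 / 4 / real k \<le> real (t - 1) / (2 * real t) / real k" by (rule divide_right_mono) simp
            then show ?thesis by (simp add: mult.commute)
          qed
          finally show ?thesis .
        qed
        ultimately have "(real t / (4 * real j)) ^ j * (1 / 8 ^ j) \<le> ?q ^ j * (?q / (2 * real t))"
          by (intro mult_mono power_mono) auto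
        also have "\<dots> = ?q ^ k / (2 * real t)" by (simp add: j(1))
        also have "\<dots> \<le> real (t - 1 choose k) / (2 * real t)"
          using \<open>?q ^ k \<le> _\<close> by (intro divide_right_mono) auto
        finally have "(real t / (4 * real j)) ^ j * (1 / 8 ^ j) \<le> real (t - 1 choose k) / (2 * real t)" .
        moreover have "exp a = (real t / (4 * real j)) ^ j * (1 / 8 ^ j)"
        proof -
          have "exp a = (exp y / 32) ^ j" unfolding a_def by (simp add: exp_of_nat_mult exp_diff)
          also have "\<dots> = (real t / (4 * real j) * (1 / 8)) ^ j" by (simp add: expy mult.commute)
          also have "\<dots> = (real t / (4 * real j)) ^ j * (1 / 8) ^ j" by (rule power_mult_distrib)
          finally show ?thesis by (simp add: power_divide)
        qed
        ultimately show ?thesis by simp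
      qed
      then have aB: "exp a \<le> B" using B by linarith
      have y32: "0 \<le> y - ln 32"
      proof -
        have "0 < e * (L / 20 - ln 32)" using e2 ln_gt_zero[of "2::real"] by linarith
        then show ?thesis using y assms by (simp add: zero_less_mult_iff)
      qed
      have "e * (L / 20 - ln 32) \<le> e * a"
      proof -
        have "L / 20 - ln 32 \<le> 1 * (y - ln 32)" using y by simp
        also have "\<dots> \<le> a" unfolding a_def using j(2) y32 by (intro mult_right_mono) auto
        finally show ?thesis using assms by simp
      qed
      then have 2: "2 \<le> B powr e" using e2 assms by (intro two_le_powr[OF aB]) linarith+
      define b where "b = 1 + y + ln (96 * (L ^ 2 + 1))"
      have "exp 1 * real d / real j \<le> exp b"
      proof -
        have "exp b = exp 1 * (exp y * (96 * (L ^ 2 + 1)))"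
        proof -
          have "0 < 96 * (L ^ 2 + 1)" by (intro mult_pos_pos add_nonneg_pos) auto
          then show ?thesis unfolding b_def exp_add by (simp only: exp_ln mult.assoc)
        qed
        also have "\<dots> = exp 1 * deg_limit t / real j" by (simp add: expy deg_limit_def L_def)
        finally show ?thesis using d j by (simp add: divide_right_mono)
      qed
      then have "real (d choose j) \<le> exp (real j * b)" using j(2) by (intro choose_le_exp) auto
      moreover have "real j * b \<le> (1 + e) * a"
      proof -
        have "b \<le> (1 + e) * (y - ln 32)"
        proof -
          have "e * (L / 20) \<le> e * y" using y assms by simp
          then show ?thesis using e1 unfolding b_def by (simp add: algebra_simps)
        qed
        then have "real j * b \<le> real j * ((1 + e) * (y - ln 32))" by (intro mult_left_mono) auto
        then show ?thesis by (simp add: a_def algebra_simps)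
      qed
      ultimately have "real (d choose j) \<le> B powr (1 + e)"
        using assms by (intro powr_ge_of_exp[OF aB]) auto
      then show "reaches_exponent t k T e"
        using 2 cliques_bounded_mono[OF cliques_bounded_choose[OF S(4)]]
        unfolding reaches_exponent_def j(1) B_def by blast
    qed
  qed
qed

lemma choose_near_top:
  assumes "k < t" "2 \<le> t - k" "1 \<le> k"
  shows "(real t / real (t - k)) ^ (t - k - 1) \<le> real (t - 1 choose k)"
proof -
  define m where "m = t - k"
  have "(t - 1 choose k) = (t - 1 choose (m - 1))"
    using assms binomial_symmetric[of k "t - 1"] by (simp add: m_def)
  moreover have "(real (t - 1) / real (m - 1)) ^ (m - 1) \<le> real (t - 1 choose (m - 1))"
    by (rule binomial_ge_n_over_k_pow_k) (use assms in \<open>auto simp: m_def\<close>)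
  moreover have "real t / real m \<le> real (t - 1) / real (m - 1)"
  proof -
    have "real (m - 1) = real m - 1" "real (t - 1) = real t - 1" "2 \<le> real m" "real m \<le> real t"
      using assms by (auto simp: m_def)
    then show ?thesis by (simp add: field_simps)
  qed
  then have "(real t / real m) ^ (m - 1) \<le> (real (t - 1) / real (m - 1)) ^ (m - 1)"
    by (intro power_mono) auto
  ultimately show ?thesis by (simp add: m_def)
qed

text \<open>With M = t - k and y = ln(t/M) >= L/20, log B is at least (1 - 2h) M y. Peeling costs 2
  L r, where r is at most a constant times L; the growth of \<open>g\<close> makes r <= h M, so this
  cost is O(h M y).\<close>

lemma regime_near:
  fixes e :: real and g :: "nat \<Rightarrow> real"
  assumes e: "0 < e" "e \<le> 1" and g: "filterlim g at_top sequentially"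
  shows "\<forall>\<^sub>F t in sequentially. \<forall>k T d. turan_setting t k T d \<and> g t * log 2 (real t) \<le> real (t - k) \<and>
     real (t - k) \<le> real t powr 0.95 \<longrightarrow> reaches_exponent t k T e"
proof -
  define h where "h = e / 1000"
  \<comment> \<open>Then 2\<delta> = exp(-4/h), so about (h/4) ln d greedy choices dominate
    everything, and branch sets have at most 3hL vertices. \<delta> depends on \<open>e\<close>
    only, which keeps the peeling depth logarithmic.\<close>
  define \<delta> where "\<delta> = exp (- (4 / h)) / 2"
  have h: "0 < h" "h \<le> 1 / 1000" using e by (auto simp: h_def)
  have "exp (- (4 / h)) \<le> exp (- 4)" using h by (simp add: field_simps)
  also have "exp (- 4) < (1 / 2 :: real)"
    using exp_ge_add_one_self[of "4::real"] by (simp add: exp_minus field_simps)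
  finally have \<delta>: "0 < \<delta>" "4 * \<delta> < 1" by (auto simp: \<delta>_def)
  have 2: "\<forall>\<^sub>F t in sequentially. (2 / \<delta> + 2) / h \<le> g t"
    using g by (simp add: filterlim_at_top)
  have L: "filterlim (\<lambda>t. ln (real t)) at_top sequentially" by real_asymp
  then have 3: "\<forall>\<^sub>F t in sequentially. 20 / h \<le> ln (real t)" by (simp add: filterlim_at_top)
  have 4: "\<forall>\<^sub>F t in sequentially. 5 * real t powr 0.95 + 5 \<le> real t" by real_asymp
  from 2 3 4 show ?thesis
  proof eventually_elim
    case (elim t)
    define L where "L = ln (real t)"
    have L: "20 / h \<le> L" using elim(2) by (simp add: L_def)
    then have L1: "20 \<le> h * L" using h by (simp add: field_simps)
    have "20000 \<le> 20 / h" using h by (simp add: field_simps)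
    then have L0: "1 \<le> L" using L by linarith
    have t2: "2 \<le> real t" using elim(3) powr_ge_zero[of "real t" "0.95"] by linarith
    show ?case
    proof (intro allI impI, elim conjE)
      fix k T d assume set: "turan_setting t k T d"
        and range: "g t * log 2 (real t) \<le> real (t - k)" "real (t - k) \<le> real t powr 0.95"
      define B where "B = clique_ratio k T"
      define m where "m = t - k"
      note S = turan_settingD[OF set, folded B_def]
      have k: "k < t" and m: "m = t - k" "g t * log 2 (real t) \<le> real m" "real m \<le> real t powr 0.95"
        and lnd: "ln (real d + 1) \<le> 2 * L" and B: "real (t - 1 choose k) / (2 * real t) \<le> B"
        using S range by (auto simp: m_def L_def)
      define M where "M = real m"
      have "L \<le> log 2 (real t)"
      proof -
        have "ln 2 \<le> (1 :: real)" using ln_le_minus_one[of "2::real"] by simp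
        then show ?thesis using L0 unfolding log_def L_def[symmetric] by (simp add: field_simps)
      qed
      moreover have g0: "0 < (2 / \<delta> + 2) / h" using h \<delta> by (simp add: add_pos_pos)
      ultimately have "(2 / \<delta> + 2) / h * L \<le> g t * log 2 (real t)"
        using elim(1) L0 by (intro mult_mono) auto
      then have "(2 / \<delta> + 2) / h * L \<le> M" using m(2) by (simp add: M_def)
      then have hM: "(2 / \<delta> + 2) * L \<le> h * M" using h by (simp add: field_simps)
      have d2: "0 < 2 / \<delta>" using \<delta> by simp
      have "2 * L \<le> (2 / \<delta> + 2) * L" using d2 L0 by (intro mult_right_mono) auto
      then have hM2: "2 * L \<le> h * M" using hM by linarith
      have "0 \<le> M" by (simp add: M_def)
      then have "h * M \<le> (1 / 1000) * M" using h by (intro mult_right_mono) auto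
      then have M2: "2 \<le> M" using hM2 L0 by linarith
      define r where "r = nat \<lceil>ln (real d + 1) / \<delta>\<rceil>"
      define c where "c = nat \<lceil>ln (real d + 1) * (h / 4)\<rceil>"
      have nonneg: "0 \<le> ln (real d + 1)" by simp
      have "real r \<le> ln (real d + 1) / \<delta> + 1"
        unfolding r_def using nonneg \<delta> by (simp add: ceiling_less_iff le_of_int_ceiling)
      also have "\<dots> \<le> 2 * L / \<delta> + 1" using lnd \<delta> by (simp add: divide_right_mono)
      also have "\<dots> \<le> (2 / \<delta> + 2) * L" using L0 by (simp add: algebra_simps)
      finally have r: "real r \<le> h * M" using hM by linarith
      have "real c \<le> ln (real d + 1) * (h / 4) + 1"
        unfolding c_def using nonneg h by (simp add: ceiling_less_iff le_of_int_ceiling)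
      also have "\<dots> \<le> 2 * L * (h / 4) + 1" using lnd h by (intro add_right_mono mult_right_mono) auto
      also have "\<dots> = (h * L) / 2 + 1" by simp
      finally have c: "real c \<le> h * L" using L1 by linarith
      have rr: "real d < (1 / (1 - \<delta>)) ^ r" unfolding r_def by (rule less_power_ceiling) (use \<delta> in auto)
      have cc: "(2 * \<delta>) ^ c * real d < 1"
      proof -
        have "ln (real d + 1) * (h / 4) \<le> real c" unfolding c_def by linarith
        then have "ln (real d + 1) \<le> real c * (4 / h)" using h by (simp add: field_simps)
        then have "exp (ln (real d + 1)) \<le> exp (real c * (4 / h))" by (simp only: exp_le_cancel_iff)
        moreover have "exp (ln (real d + 1)) = real d + 1" by simp
        ultimately have lt: "real d < exp (real c * (4 / h))" by linarith
        have "2 * \<delta> = exp (- (4 / h))" by (simp add: \<delta>_def)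
        then have "(2 * \<delta>) ^ c = exp (real c * (- (4 / h)))" by (simp only: exp_of_nat_mult)
        also have "\<dots> = 1 / exp (real c * (4 / h))" by (simp add: exp_minus inverse_eq_divide)
        finally have "(2 * \<delta>) ^ c * real d = real d / exp (real c * (4 / h))" by simp
        also have "\<dots> < 1" using lt by (subst pos_divide_less_eq) auto
        finally show ?thesis .
      qed
      have tp: "M \<le> real t powr 0.95" using m(3) by (simp add: M_def)
      have "h * M \<le> 1 * M" using h M2 by (intro mult_right_mono) auto
      then have rM: "real r \<le> M" using r by linarith
      have kt: "real t = real k + M" using k m(1) by (simp add: M_def)
      have rk: "r \<le> k - 1" "2 * (m + r) \<le> t - 1" using rM tp elim(3) kt M2 by (auto simp: M_def)
      define y where "y = ln (real t / M)"
      have expy: "exp y = real t / M" using M2 t2 by (simp add: y_def)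
      have "ln M \<le> ln (real t powr 0.95)" using M2 tp by (intro ln_mono) auto
      then have "ln M \<le> 0.95 * L" using t2 by (simp add: L_def ln_powr)
      then have y: "L \<le> 20 * y" using M2 t2 by (simp add: y_def L_def ln_div)
      have y1: "1 \<le> h * y"
      proof -
        have "h * L \<le> h * (20 * y)" using y h by (intro mult_left_mono) auto
        then show ?thesis using L1 by linarith
      qed
      have "h * y \<le> 1 * y" using h y L0 by (intro mult_right_mono) auto
      then have y0: "1 \<le> y" using y1 by linarith
      have M1: "1 \<le> h * M" using hM2 L0 by linarith
      have My: "0 \<le> M * y" using M2 y0 by simp
      \<comment> \<open>One h M y covers the exponent m - 1 in place of m, the other the division by
        2t.\<close>
      define a where "a = (1 - 2 * h) * (M * y)"
      have aB: "exp a \<le> B"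
      proof -
        have "y \<le> h * M * y" using M1 y0 mult_right_mono[of 1 "h * M" y] by simp
        moreover have "ln (2 * real t) \<le> h * M * y"
        proof -
          have "ln (2 * real t) \<le> 2 * L" using t2 ln_mono[of 2 "real t"] by (simp add: ln_mult L_def)
          also have "\<dots> \<le> h * M * 1" using hM2 by simp
          also have "\<dots> \<le> h * M * y" using y0 h M2 by (intro mult_left_mono) auto
          finally show ?thesis .
        qed
        ultimately have "a \<le> real (m - 1) * y - ln (2 * real t)"
          using M2 by (simp add: a_def M_def algebra_simps of_nat_diff)
        then have "exp a \<le> exp (real (m - 1) * y - ln (2 * real t))" by simp
        also have "\<dots> = (real t / M) ^ (m - 1) / (2 * real t)"
          using t2 by (simp add: exp_diff exp_of_nat_mult expy)
        also have "\<dots> \<le> real (t - 1 choose k) / (2 * real t)"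
        proof (rule divide_right_mono)
          have "2 \<le> t - k" using M2 m(1) by (simp add: M_def)
          moreover have "1 \<le> k" using kt tp elim(3) powr_ge_zero[of "real t" "0.95"] by linarith
          ultimately show "(real t / M) ^ (m - 1) \<le> real (t - 1 choose k)"
            unfolding M_def m(1) using choose_near_top[OF k] by simp
        qed simp
        finally show ?thesis using B by simp
      qed
      have "ln 2 \<le> e * a"
      proof -
        have "1 / 2 * (M * y) \<le> a" unfolding a_def using h My by (intro mult_right_mono) auto
        moreover have "1 * (1000 / e) \<le> M * y"
        proof (rule mult_mono)
          show "1000 / e \<le> y" using y1 e by (simp add: h_def field_simps)
        qed (use M2 e in auto)
        ultimately have "500 / e \<le> a" by simp
        then have "500 \<le> e * a" using e by (simp add: field_simps)
        then show ?thesis using ln_le_minus_one[of "2::real"] by simp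
      qed
      then have two: "2 \<le> B powr e" using e by (intro two_le_powr[OF aB]) auto
      define b where "b = real r * (2 * L) + real (6 * c * (m + r + 1)) + real (m + r) * (1 + y)"
      have "real (d + 1) ^ r * (2 ^ (6 * c * (m + r + 1)) * real (t - 1 choose (m + r))) \<le>
          exp (real r * (2 * L)) * (exp (real (6 * c * (m + r + 1))) * exp (real (m + r) * (1 + y)))"
      proof (intro mult_mono)
        show "real (d + 1) ^ r \<le> exp (real r * (2 * L))" by (rule power_le_exp[OF lnd])
        show "2 ^ (6 * c * (m + r + 1)) \<le> exp (real (6 * c * (m + r + 1)))" by (rule two_power_le_exp)
        show "real (t - 1 choose (m + r)) \<le> exp (real (m + r) * (1 + y))"
        proof (rule choose_le_exp)
          show "1 \<le> m + r" using M2 by (simp add: M_def)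
          have "exp 1 * real (t - 1) / real (m + r) \<le> exp 1 * real t / M"
            using M2 t2 by (intro frac_le) (auto simp: M_def)
          then show "exp 1 * real (t - 1) / real (m + r) \<le> exp (1 + y)" by (simp add: exp_add expy)
        qed
      qed auto
      also have "\<dots> = exp b" by (simp add: b_def exp_add)
      finally have bb: "real (d + 1) ^ r * (2 ^ (6 * c * (m + r + 1)) * real (t - 1 choose (m + r))) \<le> exp b" .
      \<comment> \<open>403 = 40 + 360 + 3: the choices made in peeling, the traces outside the
        maximum clique, and (1 + h)^2 <= 1 + 3h from the binomial.\<close>
      have "b \<le> (1 + 403 * h) * (M * y)"
      proof -
        have "real r * (2 * L) \<le> (h * M) * (40 * y)"
          by (rule mult_mono; use r y L0 M1 in linarith)
        moreover have "real (6 * c * (m + r + 1)) \<le> (6 * (h * (20 * y))) * (3 * M)"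
        proof -
          have "real c \<le> h * (20 * y)" using c y h mult_left_mono[of L "20 * y" h] by linarith
          moreover have "real (m + r + 1) \<le> 3 * M" using rM M2 by (simp add: M_def)
          ultimately have "(6 * real c) * real (m + r + 1) \<le> (6 * (h * (20 * y))) * (3 * M)"
            by (intro mult_mono) (use h y0 in auto)
          then show ?thesis by (simp only: of_nat_mult of_nat_numeral)
        qed
        moreover have "real (m + r) * (1 + y) \<le> ((1 + h) * M) * ((1 + h) * y)"
          using r y1 M2 h y0 by (intro mult_mono) (auto simp: M_def algebra_simps)
        moreover have "((1 + h) * M) * ((1 + h) * y) \<le> (1 + 3 * h) * (M * y)"
        proof -
          have "(1 + h) * (1 + h) \<le> 1 + 3 * h" using h mult_right_mono[of h 1 h] by (simp add: algebra_simps)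
          then have "((1 + h) * (1 + h)) * (M * y) \<le> (1 + 3 * h) * (M * y)" using My by (rule mult_right_mono)
          then show ?thesis by (simp add: algebra_simps)
        qed
        ultimately show ?thesis unfolding b_def by (simp add: algebra_simps)
      qed
      also have "\<dots> \<le> ((1 + e) * (1 - 2 * h)) * (M * y)"
      proof (intro mult_right_mono My)
        have "e * e \<le> e" using e mult_left_mono[of e 1 e] by simp
        moreover have "1 + 403 * h \<le> 1 + e - (e + x) / 500" if "x \<le> e" for x
          using that e by (simp add: h_def field_simps)
        ultimately have "1 + 403 * h \<le> 1 + e - (e + e * e) / 500" by blast
        also have "\<dots> = (1 + e) * (1 - 2 * h)" by (simp add: h_def field_simps)
        finally show "1 + 403 * h \<le> (1 + e) * (1 - 2 * h)" .
      qed
      also have "\<dots> = (1 + e) * a" by (simp add: a_def)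
      finally have "real (d + 1) ^ r * (2 ^ (6 * c * (m + r + 1)) * real (t - 1 choose (m + r))) \<le> B powr (1 + e)"
        using e by (intro powr_ge_of_exp[OF aB bb]) auto
      moreover obtain j where j: "k = Suc j" using S(1) by (cases k) auto
      then have kj: "Suc j < t" "r \<le> j" "t = Suc j + m" using rk k m(1) by auto
      have "cliques_bounded t k (real (d + 1) ^ r * (2 ^ (6 * c * (m + r + 1)) * real (t - 1 choose (m + r))))"
        unfolding cliques_bounded_def j
        by (intro allI impI, rule clique_count_bound_near[OF _ _ S(4) kj(1,2) \<delta> cc rr kj(3) rk(2)])
      ultimately show "reaches_exponent t k T e"
        using two cliques_bounded_mono unfolding reaches_exponent_def B_def by blast
    qed
  qed
qed

text \<open>With \<delta> = t^(-0.8) and up to polylogarithmic factors, peeling has depth t^0.8, a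
  vertex has b = t^0.2 non-neighbours, and d b^2 = t^1.4 and l b = t^1.05 stay below l^2 = t^1.7.
  All losses have exponent at most about t^0.85, against log B of order at least t^0.95.\<close>

lemma regime_middle:
  fixes e :: real
  assumes e: "0 < e"
  shows "\<forall>\<^sub>F t in sequentially. \<forall>k T d. turan_setting t k T d \<and> real t powr 0.95 \<le> real k \<and>
     real t powr 0.95 \<le> real (t - k) \<longrightarrow> reaches_exponent t k T e"
proof -
  \<comment> \<open>Logarithms of the four losses: branching, traces on the surplus vertices,
    lowering of the clique order, and the factor 2t between C and B. \<open>low\<close> is a lower
    bound for log B.\<close>
  define err where "err L s l = s * (2 * L) + (l + s + 1) + (l + 2 * s + 2) * L + 2 * L" for L s l :: real
  define low where "low t = (t powr 0.95 - 2) * ln (3 / 2) - 2 * ln t" for t :: real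
  have "((\<lambda>t. err (ln (real t)) (2 * ln (real t) * real t powr 0.8 + 1) (real t powr 0.85 + 1) / low (real t))
      \<longlongrightarrow> 0) sequentially"
    unfolding err_def low_def by real_asymp
  from order_tendstoD(2)[OF this e]
  have 1: "\<forall>\<^sub>F t in sequentially.
     err (ln (real t)) (2 * ln (real t) * real t powr 0.8 + 1) (real t powr 0.85 + 1) / low (real t) < e" .
  have 2: "\<forall>\<^sub>F t in sequentially. 1 \<le> low (real t)" unfolding low_def by real_asymp
  have 3: "\<forall>\<^sub>F t in sequentially. 2 * ln (real t) * real t powr 0.8 + 3 \<le> real t powr 0.95" by real_asymp
  have 4: "\<forall>\<^sub>F t in sequentially.
     deg_limit t * (real t powr (-0.8) * deg_limit t + 1) ^ 2
     + (real t powr 0.85 + 1) * (real t powr (-0.8) * deg_limit t + 2) < (real t powr 0.85) ^ 2"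
    unfolding deg_limit_def by real_asymp
  have 5: "\<forall>\<^sub>F t in sequentially. 4 \<le> real t" by real_asymp
  from 1 2 3 4 5 show ?thesis
  proof eventually_elim
    case (elim t)
    define L where "L = ln (real t)"
    define \<delta> where "\<delta> = real t powr (-0.8)"
    have t: "4 \<le> real t" by fact
    have L0: "1 \<le> L"
    proof -
      have "exp 1 \<le> (3 :: real)" by (rule exp_le)
      then have "exp 1 \<le> real t" using t by linarith
      then show ?thesis unfolding L_def using ln_ge_iff[of "real t" 1] t by simp
    qed
    have \<delta>: "0 < \<delta>" "\<delta> < 1" using t by (auto simp: \<delta>_def powr_less_one)
    have inv\<delta>: "x / \<delta> = x * real t powr 0.8" for x
      unfolding \<delta>_def by (simp add: powr_minus_divide)
    show ?case
    proof (intro allI impI, elim conjE)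
      fix k T d assume set: "turan_setting t k T d"
        and range: "real t powr 0.95 \<le> real k" "real t powr 0.95 \<le> real (t - k)"
      define B where "B = clique_ratio k T"
      define C where "C = real (num_cliques k T)"
      note S = turan_settingD[OF set, folded B_def C_def]
      have k: "k < t" "real t powr 0.95 \<le> real k" "real t powr 0.95 \<le> real (t - k)"
        and d: "real d \<le> deg_limit t" and lnd: "ln (real d + 1) \<le> 2 * L" and B: "real (t - 1 choose k) / (2 * real t) \<le> B"
        and C: "C \<le> B * (2 * real t)" using S range unfolding L_def by blast+
      define r where "r = nat \<lceil>ln (real d + 1) / \<delta>\<rceil>"
      define b where "b = nat \<lceil>\<delta> * real d\<rceil>"
      define l where "l = nat \<lceil>real t powr 0.85\<rceil>"
      have ceil: "real (nat \<lceil>x\<rceil>) \<le> x + 1" if "0 \<le> x" for x using that by linarith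
      have "real r \<le> ln (real d + 1) / \<delta> + 1" unfolding r_def by (rule ceil) (use \<delta> in auto)
      also have "\<dots> \<le> 2 * L / \<delta> + 1" using lnd \<delta> by (simp add: divide_right_mono)
      finally have r: "real r \<le> 2 * L * real t powr 0.8 + 1" by (simp add: inv\<delta>)
      have rr: "real d < (1 / (1 - \<delta>)) ^ r" unfolding r_def by (rule less_power_ceiling[OF \<delta>])
      have rk: "r \<le> k - 1" using r elim(3) k(2) by (simp add: L_def)
      have l: "real t powr 0.85 \<le> real l" "real l \<le> real t powr 0.85 + 1"
        unfolding l_def using ceil[of "real t powr 0.85"] by (linarith, simp)
      have b: "\<delta> * real d \<le> real b" "real b \<le> \<delta> * deg_limit t + 1"
      proof -
        show "\<delta> * real d \<le> real b" unfolding b_def by linarith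
        have "real b \<le> \<delta> * real d + 1" unfolding b_def by (rule ceil) (use \<delta> in auto)
        also have "\<dots> \<le> \<delta> * deg_limit t + 1" using d \<delta> by simp
        finally show "real b \<le> \<delta> * deg_limit t + 1" .
      qed
      have "real (d * b ^ 2 + l * (b + 1)) = real d * real b ^ 2 + real l * (real b + 1)"
        by (simp add: algebra_simps)
      also have "\<dots> \<le> deg_limit t * (\<delta> * deg_limit t + 1) ^ 2
          + (real t powr 0.85 + 1) * (\<delta> * deg_limit t + 2)"
      proof (rule add_mono)
        show "real d * real b ^ 2 \<le> deg_limit t * (\<delta> * deg_limit t + 1) ^ 2"
          using d b by (intro mult_mono power_mono) auto
        show "real l * (real b + 1) \<le> (real t powr 0.85 + 1) * (\<delta> * deg_limit t + 2)"
          using b l by (intro mult_mono) auto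
      qed
      also have "\<dots> < (real t powr 0.85) ^ 2" using elim(4) by (simp add: \<delta>_def)
      also have "\<dots> \<le> real l ^ 2" using l by (intro power_mono) auto
      finally have "real (d * b ^ 2 + l * (b + 1)) < real (l ^ 2)" by simp
      then have dl: "d * b ^ 2 + l * (b + 1) < l ^ 2" by (simp only: of_nat_less_iff)
      define a where "a = low (real t)"
      have p2: "2 \<le> real t powr 0.95"
      proof -
        have "0 \<le> 2 * ln (real t) * real t powr 0.8" using L0 by (simp add: L_def)
        then show ?thesis using elim(3) by linarith
      qed
      have ln2t: "ln (2 * real t) \<le> 2 * L" using t ln_mono[of 2 "real t"] by (simp add: ln_mult L_def)
      have grow: "exp ((real t powr 0.95 - 2) * ln (3 / 2)) \<le> x ^ n"
        if "3 / 2 \<le> x" "real t powr 0.95 - 1 \<le> real n" for x :: real and n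
      proof -
        have "(real t powr 0.95 - 2) * ln (3 / 2) \<le> real n * ln x"
          using that p2 by (intro mult_mono ln_mono) auto
        then have "exp ((real t powr 0.95 - 2) * ln (3 / 2)) \<le> exp (real n * ln x)" by simp
        then show ?thesis using that by (simp add: exp_of_nat_mult)
      qed
      \<comment> \<open>For 2k <= t the base (t - 1)/k is at least 3/2 because t >= 4; otherwise
        t/(t - k) exceeds 2. Both exponents are at least t^0.95 - 1.\<close>
      have big: "exp ((real t powr 0.95 - 2) * ln (3 / 2)) \<le> real (t - 1 choose k)"
      proof (cases "2 * k \<le> t")
        case True
        have "3 / 2 \<le> real (t - 1) / real k"
        proof -
          have "real k * 2 \<le> real t" using True by linarith
          moreover have "real (t - 1) = real t - 1" using t by simp
          moreover have "0 < real k" using k(2) p2 by linarith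
          ultimately show ?thesis using t by (simp add: field_simps)
        qed
        then have "exp ((real t powr 0.95 - 2) * ln (3 / 2)) \<le> (real (t - 1) / real k) ^ k"
          using k by (intro grow) auto
        also have "\<dots> \<le> real (t - 1 choose k)" using k by (intro binomial_ge_n_over_k_pow_k) auto
        finally show ?thesis .
      next
        case False
        have tk: "2 \<le> t - k" using k(3) p2 by linarith
        have "3 / 2 \<le> real t / real (t - k)" using False k(1) by (simp add: field_simps)
        then have "exp ((real t powr 0.95 - 2) * ln (3 / 2)) \<le> (real t / real (t - k)) ^ (t - k - 1)"
          using k tk by (intro grow) auto
        also have "\<dots> \<le> real (t - 1 choose k)" using k False tk by (intro choose_near_top) auto
        finally show ?thesis .
      qed
      have aB: "exp a \<le> B"
      proof -
        have "exp a \<le> exp ((real t powr 0.95 - 2) * ln (3 / 2) - ln (2 * real t))"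
          using ln2t by (simp add: a_def low_def L_def)
        also have "\<dots> = exp ((real t powr 0.95 - 2) * ln (3 / 2)) / (2 * real t)" using t by (simp add: exp_diff)
        also have "\<dots> \<le> real (t - 1 choose k) / (2 * real t)" using big by (intro divide_right_mono) auto
        finally show ?thesis using B by simp
      qed
      define s where "s = 2 * L * real t powr 0.8 + 1"
      define E where "E = err L s (real t powr 0.85 + 1)"
      have E: "E \<le> e * a"
        using elim(1,2) by (simp add: E_def s_def L_def[symmetric] a_def field_simps)
      have s1: "1 \<le> s" using L0 by (simp add: s_def)
      have E1: "1 \<le> E"
      proof -
        have "0 \<le> s * (2 * L)" "0 \<le> ((real t powr 0.85 + 1) + 2 * s + 2) * L" using s1 L0 by auto
        then show ?thesis using s1 L0 unfolding E_def err_def by (simp add: add_increasing)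
      qed
      have two: "2 \<le> B powr e"
        by (rule two_le_powr[OF aB]) (use E E1 ln_le_minus_one[of "2::real"] e in auto)
      have B0: "0 < B" using aB exp_gt_zero[of a] by linarith
      have "real (d + 1) ^ r * (2 ^ (l + r + 1) * real t ^ (l + 2 * r + 2) * C) \<le>
          exp (real r * (2 * L)) * (exp (real (l + r + 1)) * exp (real (l + 2 * r + 2) * L) * (B * exp (2 * L)))"
      proof -
        have 1: "real (d + 1) ^ r \<le> exp (real r * (2 * L))" by (rule power_le_exp[OF lnd])
        have 2: "2 ^ (l + r + 1) \<le> exp (real (l + r + 1))" by (rule two_power_le_exp)
        have 3: "real t ^ (l + 2 * r + 2) = exp (real (l + 2 * r + 2) * L)"
          unfolding exp_of_nat_mult using t by (simp add: L_def)
        have 4: "C \<le> B * exp (2 * L)"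
        proof -
          have "2 * real t \<le> exp (2 * L)"
            using ln2t t by (metis exp_le_cancel_iff exp_ln mult_pos_pos less_le_trans zero_less_numeral)
          then show ?thesis using C B0 mult_left_mono[of "2 * real t" "exp (2 * L)" B] by linarith
        qed
        have "real (d + 1) ^ r * (2 ^ (l + r + 1) * real t ^ (l + 2 * r + 2) * C) \<le>
            real (d + 1) ^ r * (2 ^ (l + r + 1) * real t ^ (l + 2 * r + 2) * (B * exp (2 * L)))"
          using 4 by (intro mult_left_mono) auto
        also have "\<dots> \<le> exp (real r * (2 * L)) * (exp (real (l + r + 1)) * exp (real (l + 2 * r + 2) * L) * (B * exp (2 * L)))"
          unfolding 3 using 1 2 B0 by (intro mult_mono) auto
        finally show ?thesis .
      qed
      also have "\<dots> = exp (err L (real r) (real l)) * B"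
        by (simp add: err_def exp_add[symmetric] mult_ac)
      also have "\<dots> \<le> exp E * B"
      proof -
        have "err L (real r) (real l) \<le> E"
          unfolding err_def E_def using r l L0 s1
          by (intro add_mono mult_mono) (auto simp: s_def)
        then show ?thesis using B0 by (intro mult_right_mono) auto
      qed
      also have "\<dots> \<le> B powr e * B"
      proof -
        have "exp E \<le> exp a powr e" using E by (simp add: powr_def)
        also have "\<dots> \<le> B powr e" using aB e by (intro powr_mono2) auto
        finally show ?thesis using B0 by (intro mult_right_mono) auto
      qed
      also have "\<dots> = B powr (1 + e)" using B0 by (simp add: powr_add)
      finally have "real (d + 1) ^ r * (2 ^ (l + r + 1) * real t ^ (l + 2 * r + 2) * C) \<le> B powr (1 + e)" .
      moreover obtain j where j: "k = Suc j" using S(1) by (cases k) auto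
      then have kj: "Suc j < t" "r \<le> j" "turan_star t (Suc j) T" using rk k(1) S(3) by auto
      have "cliques_bounded t k (real (d + 1) ^ r * (2 ^ (l + r + 1) * real t ^ (l + 2 * r + 2) * C))"
        unfolding cliques_bounded_def C_def j
        by (intro allI impI, rule clique_count_bound_middle[OF _ _ S(4) kj(1,2) \<delta> rr b(1) dl kj(3)])
      ultimately show "reaches_exponent t k T e"
        using two cliques_bounded_mono unfolding reaches_exponent_def B_def by blast
    qed
  qed
qed

section \<open>The exponent\<close>

text \<open>u = 3ct leaves room for t branch sets of 3c vertices; D = 16u = 48ct, and the degeneracy
  bound is 2D.\<close>

lemma degeneracy_boundI:
  assumes "1 \<le> t" "1 \<le> c" "(3 / 4 :: real) ^ c * (96 * real c * real t) < 1"
  shows "degeneracy_bound t (96 * c * t)"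
  unfolding degeneracy_bound_def
proof (intro exI conjI)
  show "0 < 48 * c * t" using assms by simp
  show "96 * c * t = 2 * (48 * c * t)" by simp
  show "(3 / 4 :: real) ^ c * (2 * real (48 * c * t)) < 1" using assms(3) by (simp add: mult_ac)
  show "16 * (3 * c * t) \<le> 48 * c * t" by simp
  show "t * (3 * c) \<le> 3 * c * t + 3 * c" by simp
qed

lemma degeneracy_bound_exists:
  assumes "1 \<le> t" shows "\<exists>d. degeneracy_bound t d"
proof -
  have "((\<lambda>c. (3 / 4 :: real) ^ c * real c) \<longlonglongrightarrow> 0)" by real_asymp
  from order_tendstoD(2)[OF this, of "1 / (96 * real t)"]
  have "\<forall>\<^sub>F c in sequentially. (3 / 4 :: real) ^ c * real c < 1 / (96 * real t)" using assms by simp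
  then have "\<forall>\<^sub>F c in sequentially. 1 \<le> c \<and> (3 / 4 :: real) ^ c * real c < 1 / (96 * real t)"
    using eventually_ge_at_top[of "1::nat"] by eventually_elim simp
  from eventually_happens'[OF sequentially_bot this]
  obtain c where c: "1 \<le> c" "(3 / 4 :: real) ^ c * real c < 1 / (96 * real t)" by blast
  then have "(3 / 4 :: real) ^ c * (96 * real c * real t) < 1"
    using assms by (simp add: pos_less_divide_eq mult_ac)
  then show ?thesis using degeneracy_boundI[OF assms c(1)] by blast
qed

lemma degeneracy_bound_eventually:
  "\<forall>\<^sub>F t in sequentially. \<exists>d. degeneracy_bound t d \<and> real d \<le> deg_limit t \<and>
    ln (real d + 1) \<le> 2 * ln (real t)"
proof -
  have 1: "\<forall>\<^sub>F t in sequentially. (3 / 4) powr ((ln (real t)) ^ 2) * (96 * ((ln (real t)) ^ 2 + 1) * real t) < 1"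
    by real_asymp
  have 2: "\<forall>\<^sub>F t in sequentially. 0 < ln (real t) ^ 2" by real_asymp
  have 3: "\<forall>\<^sub>F t in sequentially. ln (deg_limit t + 1) \<le> 2 * ln (real t)"
    unfolding deg_limit_def by real_asymp
  from 1 2 eventually_ge_at_top[of 1] 3 show ?thesis
  proof eventually_elim
    case (elim t)
    define c where "c = nat \<lceil>ln (real t) ^ 2\<rceil>"
    have c: "ln (real t) ^ 2 \<le> real c" "real c \<le> ln (real t) ^ 2 + 1" "1 \<le> c"
      using elim(2) unfolding c_def by linarith+
    have "(3 / 4 :: real) ^ c = (3 / 4) powr real c" by (simp add: powr_realpow)
    also have "\<dots> \<le> (3 / 4) powr (ln (real t) ^ 2)" using c(1) by (intro powr_mono') auto
    finally have "(3 / 4 :: real) ^ c * (96 * real c * real t)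
        \<le> (3 / 4) powr (ln (real t) ^ 2) * (96 * (ln (real t) ^ 2 + 1) * real t)"
      using c(2) by (intro mult_mono) auto
    then have "degeneracy_bound t (96 * c * t)" using elim(1,3) c(3) by (intro degeneracy_boundI) linarith+
    moreover have d: "real (96 * c * t) \<le> deg_limit t"
      using c(2) mult_right_mono[OF c(2), of "96 * real t"] by (simp add: deg_limit_def algebra_simps)
    moreover have "ln (real (96 * c * t) + 1) \<le> ln (deg_limit t + 1)" using d by (intro ln_mono) (auto intro: add_nonneg_pos)
    ultimately show ?case using elim(4) order_trans by blast
  qed
qed

definition admissible_exponent :: "(nat \<Rightarrow> real) \<Rightarrow> nat \<Rightarrow> real \<Rightarrow> bool" where
  "admissible_exponent g t e \<longleftrightarrow> 0 \<le> e \<and>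
     (\<forall>k T. 2 \<le> k \<and> k + 2 \<le> t \<and> g t * log 2 (real t) \<le> real t - real k \<and> turan_star t k T \<longrightarrow>
       reaches_exponent t k T e)"

lemma reaches_exponent_mono:
  assumes "reaches_exponent t k T e" "e \<le> e'" "1 \<le> clique_ratio k T"
  shows "reaches_exponent t k T e'"
  using assms powr_mono[OF assms(2,3)] powr_mono[OF _ assms(3), of "1 + e" "1 + e'"]
    cliques_bounded_mono[of t k "clique_ratio k T powr (1 + e)" "clique_ratio k T powr (1 + e')"]
  by (simp add: reaches_exponent_def)

lemma one_le_clique_ratio:
  assumes "turan_star t k T" "2 \<le> k" "k + 2 \<le> t" shows "1 \<le> clique_ratio k T"
proof -
  have "0 \<le> 1 / (2 * real t)" by simp
  then show ?thesis using clique_ratio_bounds(1)[OF assms] by linarith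
qed

lemma admissible_exponent_mono: "admissible_exponent g t e \<Longrightarrow> e \<le> e' \<Longrightarrow> admissible_exponent g t e'"
  unfolding admissible_exponent_def using reaches_exponent_mono one_le_clique_ratio
  by (meson order_trans)

text \<open>For a single t no asymptotics are available, but the base is at least q = 1 + 1/(2t),
  and \<open>e\<close> is chosen with q^e = 2 * 2^d, which covers both the trivial bound 2^d and the
  factor 2.\<close>

lemma admissible_exponent_exists: "\<exists>e. admissible_exponent g t e"
proof (cases "t = 0")
  case True
  then show ?thesis by (intro exI[of _ 0]) (auto simp: admissible_exponent_def)
next
  case False
  then obtain d where d: "degeneracy_bound t d" using degeneracy_bound_exists[of t] by auto
  define q where "q = 1 + 1 / (2 * real t)"
  have q: "1 < q" using False by (simp add: q_def)
  define e where "e = ln (2 * 2 ^ d) / ln q"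
  have "1 * 1 \<le> 2 * (2 :: real) ^ d" by (intro mult_mono one_le_power) auto
  then have "0 \<le> ln (2 * (2 :: real) ^ d)" by (intro ln_ge_zero) simp
  then have e0: "0 \<le> e" using q by (simp add: e_def)
  have qe: "q powr e = 2 * 2 ^ d" using q by (simp add: e_def powr_def)
  have "reaches_exponent t k T e" if h: "2 \<le> k" "k + 2 \<le> t" "turan_star t k T" for k T
  proof -
    have qr: "q \<le> clique_ratio k T" using clique_ratio_bounds(1)[OF h(3,1,2)] by (simp add: q_def)
    then have "q powr e \<le> clique_ratio k T powr e" using q e0 by (intro powr_mono2) auto
    then have big: "2 * 2 ^ d \<le> clique_ratio k T powr e" by (simp add: qe)
    have "2 * 1 \<le> 2 * (2 :: real) ^ d" by (intro mult_left_mono) auto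
    then have two: "2 \<le> clique_ratio k T powr e" using big by linarith
    obtain j where j: "k = Suc j" using h by (cases k) auto
    have "real (d choose j) \<le> real (2 ^ d)" by (intro of_nat_mono binomial_le_pow2)
    also have "\<dots> \<le> 2 * 2 ^ d" by simp
    also have "\<dots> \<le> clique_ratio k T powr e" by (rule big)
    also have "\<dots> \<le> clique_ratio k T powr (1 + e)" using qr q by (intro powr_mono) auto
    finally show ?thesis
      using two cliques_bounded_mono[OF cliques_bounded_choose[OF d, of j]] j
      by (simp add: reaches_exponent_def)
  qed
  then show ?thesis using e0 by (auto simp: admissible_exponent_def)
qed

lemma admissible_exponent_eventually:
  assumes e: "0 < e" "e \<le> 1" and g: "filterlim g at_top sequentially"
  shows "\<forall>\<^sub>F t in sequentially. admissible_exponent g t e"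
  using regime_small[OF e(1)] regime_near[OF e g] regime_middle[OF e(1)] degeneracy_bound_eventually
proof eventually_elim
  case (elim t)
  obtain d where d: "degeneracy_bound t d" "real d \<le> deg_limit t" "ln (real d + 1) \<le> 2 * ln (real t)"
    using elim(4) by blast
  have "reaches_exponent t k T e"
    if h: "2 \<le> k" "k + 2 \<le> t" "g t * log 2 (real t) \<le> real t - real k" "turan_star t k T" for k T
  proof -
    have S: "turan_setting t k T d" using h d by (simp add: turan_setting_def)
    have gk: "g t * log 2 (real t) \<le> real (t - k)" using h by simp
    consider "real k \<le> real t powr 0.95" | "real (t - k) \<le> real t powr 0.95"
      | "real t powr 0.95 \<le> real k" "real t powr 0.95 \<le> real (t - k)" by linarith
    then show ?thesis
    proof cases
      case 1
      show ?thesis by (rule elim(1)[rule_format, of k T d]) (use S 1 in blast)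
    next
      case 2
      show ?thesis by (rule elim(2)[rule_format, of k T d]) (use S gk 2 in blast)
    next
      case 3
      show ?thesis by (rule elim(3)[rule_format, of k T d]) (use S 3 in blast)
    qed
  qed
  then show ?case using e by (simp add: admissible_exponent_def)
qed

text \<open>Since n >= 2t >= N there is at least one full copy, so rounding n/N down loses less than
  half.\<close>

lemma many_cliques_exists:
  assumes "turan_star t k T" "1 \<le> k" "k < t" "2 * t \<le> n"
  shows "\<exists>G :: nat pair_pre_digraph. pair_graph G \<and> card (pverts G) = n \<and> \<not> has_complete_minor t G \<and>
     real n * (clique_ratio k T / 2) \<le> real (num_cliques k G)"
proof -
  obtain w where w: "k \<le> w" "w < t" "card (pverts T) = 2 * t - w - 1"
    "num_cliques k T = coeff (turan_poly (2 * t - w - 1) w) k"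
    by (rule turan_starE[OF assms(1-3)])
  define N where "N = 2 * t - w - 1"
  define C where "C = coeff (turan_poly N w) k"
  have "1 \<le> w" "w \<le> N" "N + w < 2 * t" using w(1,2) assms(2) by (auto simp: N_def)
  from disjoint_turan_graphs[OF this assms(2), of n] obtain G :: "nat pair_pre_digraph"
    where G: "pair_graph G" "card (pverts G) = n" "\<not> has_complete_minor t G"
      "(n div N) * C \<le> num_cliques k G" unfolding C_def by blast
  have N: "0 < N" "N \<le> n" using w(2) assms(4) by (auto simp: N_def)
  have "n < (n div N) * N + N" using N(1) mod_less_divisor[OF N(1), of n] div_mult_mod_eq[of n N] by linarith
  moreover have "1 * N \<le> (n div N) * N" using N by (intro mult_le_mono1) (simp add: div_greater_zero_iff Suc_leI)
  ultimately have "n \<le> 2 * ((n div N) * N)" by linarith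
  then have "real n \<le> 2 * (real (n div N) * real N)" by (metis of_nat_le_iff of_nat_mult of_nat_numeral)
  then have "real n / (2 * real N) \<le> real (n div N)" using N(1) by (simp add: field_simps)
  then have "real n / (2 * real N) * real C \<le> real (n div N) * real C" by (intro mult_right_mono) auto
  also have "\<dots> \<le> real (num_cliques k G)" using G(4) by (metis of_nat_le_iff of_nat_mult)
  finally have "real n / (2 * real N) * real C \<le> real (num_cliques k G)" .
  moreover have "real n * (clique_ratio k T / 2) = real n / (2 * real N) * real C"
    using w(3,4) by (simp add: clique_ratio_def C_def N_def)
  ultimately show ?thesis using G by auto
qed

lemma edgeless_minor_free:
  assumes "2 \<le> t" shows "minor_free t {} U"
  unfolding minor_free_def
proof
  assume "\<exists>F. complete_model {} U F \<and> card F = t"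
  then obtain F where F: "complete_model {} U F" "card F = t" by blast
  obtain F' where "F' \<subseteq> F" "card F' = 2" using ex_card[of 2 F] F(2) assms by auto
  then obtain B C where "B \<in> F" "C \<in> F" "B \<noteq> C" unfolding card_2_iff by blast
  then show False using F(1) unfolding complete_model_def by blast
qed

text \<open>For k = t - 1 >= 2 the base is below 1 and the upper bound fails. Of the pairs with k =
  t - 1 the hypotheses keep only t = 2, k = 1, where the base equals 1.\<close>

theorem theorem1p7:
  fixes g :: "nat \<Rightarrow> real"
  assumes "filterlim g at_top at_top"
  shows "\<exists>\<epsilon> :: nat \<Rightarrow> real. (\<forall>t. 0 \<le> \<epsilon> t) \<and> \<epsilon> \<longlonglongrightarrow> 0 \<and>
    (\<forall>t k. 1 \<le> k \<and> k < t \<and> real t - real k \<ge> g t * log 2 (real t) \<and> (k = t - 1 \<longrightarrow> t = 2) \<longrightarrow>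
      (\<forall>T. turan_star t k T \<longrightarrow>
        (\<forall>n\<ge>1. \<forall>G :: nat pair_pre_digraph.
           pair_graph G \<and> card (pverts G) = n \<and> \<not> has_complete_minor t G \<longrightarrow>
           real (num_cliques k G)
             \<le> real n * (real (num_cliques k T) / real (card (pverts T))) powr (1 + \<epsilon> t)) \<and>
        (\<forall>n\<ge>2 * t. \<exists>G :: nat pair_pre_digraph.
           pair_graph G \<and> card (pverts G) = n \<and> \<not> has_complete_minor t G \<and>
           real (num_cliques k G)
             \<ge> real n * (real (num_cliques k T) / real (card (pverts T))) powr (1 - \<epsilon> t))))"
    (is "\<exists>\<epsilon>. _ \<and> _ \<and> (\<forall>t k. _ \<longrightarrow> (\<forall>T. _ \<longrightarrow> (\<forall>n\<ge>1. ?upper \<epsilon> t k T n) \<and> (\<forall>n\<ge>2 * t. ?lower \<epsilon> t k T n)))")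
proof -
  define S where "S t = {e. admissible_exponent g t e}" for t
  \<comment> \<open>The infimum itself need not be admissible.\<close>
  define \<epsilon> where "\<epsilon> t = Inf (S t) + 1 / (real t + 1)" for t
  have S0: "S t \<noteq> {}" "bdd_below (S t)" for t
    using admissible_exponent_exists[of g t]
    by (auto simp: S_def admissible_exponent_def intro!: bdd_belowI[of _ 0])
  have "0 \<le> Inf (S t)" for t
    by (rule cInf_greatest[OF S0(1)]) (auto simp: S_def admissible_exponent_def)
  then have pos: "1 / (real t + 1) \<le> \<epsilon> t" for t by (simp add: \<epsilon>_def)
  have adm: "admissible_exponent g t (\<epsilon> t)" for t
  proof -
    have "Inf (S t) < \<epsilon> t" by (simp add: \<epsilon>_def)
    then obtain e where "e \<in> S t" "e < \<epsilon> t" using S0 by (auto simp: cInf_less_iff)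
    then show ?thesis using admissible_exponent_mono[of g t e] by (auto simp: S_def)
  qed
  have \<epsilon>0: "0 \<le> \<epsilon> t" for t using adm[of t] by (simp add: admissible_exponent_def)
  have lim: "\<epsilon> \<longlonglongrightarrow> 0"
  proof (rule tendstoI)
    fix x :: real assume x: "0 < x"
    \<comment> \<open>Half of \<open>x\<close> is reserved for the summand 1 / (t + 1); the cap at 1
      is what the near range requires.\<close>
    define e where "e = min (x / 2) 1"
    have e: "0 < e" "e \<le> 1" "e \<le> x / 2" using x by (auto simp: e_def)
    have "((\<lambda>t. 1 / (real t + 1)) \<longlonglongrightarrow> 0)" by real_asymp
    from order_tendstoD(2)[OF this, of "x / 2"]
    have "\<forall>\<^sub>F t in sequentially. 1 / (real t + 1) < x / 2" using x by simp
    then show "\<forall>\<^sub>F t in sequentially. dist (\<epsilon> t) 0 < x"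
      using admissible_exponent_eventually[OF e(1,2) assms]
    proof eventually_elim
      case (elim t)
      then have "Inf (S t) \<le> e" by (intro cInf_lower S0) (simp add: S_def)
      then show ?case using elim(1) e(3) \<epsilon>0[of t] by (simp add: \<epsilon>_def)
    qed
  qed
  have main: "(\<forall>n\<ge>1. ?upper \<epsilon> t k T n) \<and> (\<forall>n\<ge>2 * t. ?lower \<epsilon> t k T n)"
    if h: "1 \<le> k" "k < t" "g t * log 2 (real t) \<le> real t - real k" "k = t - 1 \<longrightarrow> t = 2" "turan_star t k T"
    for t k T
  \<comment> \<open>Here the base is 1 and no power of it reaches 2. Instead both bounds hold with
    equality, the lower one by an edgeless graph.\<close>
  proof (cases "k = 1")
    case True
    obtain w where "w < t" "card (pverts T) = 2 * t - w - 1" by (rule turan_starE[OF h(5,1,2)])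
    then have "clique_ratio k T = 1"
      using True by (simp add: clique_ratio_def num_cliques_eq clique_count_1[simplified])
    moreover have "\<exists>G :: nat pair_pre_digraph. pair_graph G \<and> card (pverts G) = n \<and>
        \<not> has_complete_minor t G \<and> real n \<le> real (num_cliques k G)" for n
    proof -
      let ?G = "\<lparr>pverts = {..<n}, parcs = {}\<rparr>"
      have "pair_graph ?G" unfolding pair_graph_iff by (simp add: simple_graph_def sym_def irrefl_def)
      moreover have "\<not> has_complete_minor t ?G"
        using has_complete_minor_iff[OF calculation] edgeless_minor_free[of t] h(1,2) by simp
      ultimately show ?thesis
        using True by (intro exI[of _ ?G]) (simp add: num_cliques_eq clique_count_1[simplified])
    qed
    ultimately show ?thesis
      unfolding clique_ratio_def[symmetric] using True by (simp add: num_cliques_eq clique_count_1[simplified])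
  next
    case False
    then have k: "2 \<le> k" "k + 2 \<le> t" using h(1,2,4) by auto
    have ok: "2 \<le> clique_ratio k T powr \<epsilon> t"
      "\<And>(V :: nat set) E. simple_graph V E \<Longrightarrow> minor_free t E V \<Longrightarrow>
          real (clique_count E V k) \<le> real (card V) * clique_ratio k T powr (1 + \<epsilon> t)"
      using adm[of t] k h(3,5)
      unfolding admissible_exponent_def reaches_exponent_def cliques_bounded_def by blast+
    have one: "1 \<le> clique_ratio k T" by (rule one_le_clique_ratio[OF h(5) k])
    \<comment> \<open>The exponent 1 - \<epsilon> divides the base by at least 2, which is all that
      packing disjoint copies loses.\<close>
    have "clique_ratio k T powr (1 - \<epsilon> t) = clique_ratio k T / clique_ratio k T powr \<epsilon> t"
      using one by (simp add: powr_diff)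
    also have "\<dots> \<le> clique_ratio k T / 2" using ok(1) one by (intro divide_left_mono) auto
    finally have half: "clique_ratio k T powr (1 - \<epsilon> t) \<le> clique_ratio k T / 2" .
    show ?thesis
      unfolding clique_ratio_def[symmetric]
    proof (intro conjI allI impI)
      fix n and G :: "nat pair_pre_digraph"
      assume "pair_graph G \<and> card (pverts G) = n \<and> \<not> has_complete_minor t G"
      then show "real (num_cliques k G) \<le> real n * clique_ratio k T powr (1 + \<epsilon> t)"
        using ok(2)[of "pverts G" "parcs G"] has_complete_minor_iff[of G t]
        by (auto simp: pair_graph_iff num_cliques_eq)
    next
      fix n assume n: "2 * t \<le> n"
      have "real n * clique_ratio k T powr (1 - \<epsilon> t) \<le> real n * (clique_ratio k T / 2)"
        using half by (intro mult_left_mono) auto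
      moreover obtain G :: "nat pair_pre_digraph" where G: "pair_graph G" "card (pverts G) = n"
        "\<not> has_complete_minor t G" "real n * (clique_ratio k T / 2) \<le> real (num_cliques k G)"
        using many_cliques_exists[OF h(5,1,2) n] by blast
      ultimately have "real n * clique_ratio k T powr (1 - \<epsilon> t) \<le> real (num_cliques k G)" by linarith
      then show "\<exists>G :: nat pair_pre_digraph. pair_graph G \<and> card (pverts G) = n \<and> \<not> has_complete_minor t G \<and>
           real n * clique_ratio k T powr (1 - \<epsilon> t) \<le> real (num_cliques k G)"
        using G(1-3) by blast
    qed
  qed
  show ?thesis
    by (intro exI[of _ \<epsilon>] conjI allI impI \<epsilon>0 lim main) auto
qed

end
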